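(* Let $\mathbb{X}$ and $\mathbb{U}$ be connected, second countable smooth manifolds, with $r=\dim\mathbb{X}$. Then, for generic $\beta\in\mathcal{C}^\infty(\mathbb{X}\times\mathbb{U},\mathbb{R})$, the set $\mathcal{G}_{\beta,2r+1}$ is generic and of full measure in $\mathbb{U}^{2r+1}$.
   Context: $\mathcal{C}^\infty(\mathbb{X}\times\mathbb{U},\mathbb{R})$ is the set of infinitely differentiable maps $\mathbb{X}\times\mathbb{U}\to\mathbb{R}$ endowed with the Whitney topology. A subset of a topological space is generic if it contains the intersection of a countable family of open dense subsets; "for generic $\beta$, (P) holds" means that the set of $\beta$ for which (P) holds is generic. A subset of a manifold is of full measure if its complement has measure zero (Lebesgue measure zero in charts). For a positive integer $q$, $\mathbb{U}^{(q)}\subseteq\mathbb{U}^q$ is the set of $q$-tuples of pairwise distinct elements of $\mathbb{U}$. Parameters $x_1,x_2\in\mathbb{X}$ are distinguishable, $x_1\not\sim x_2$, if $\beta(x_1,u)\neq\beta(x_2,u)$ for some $u\in\mathbb{U}$. $\mathcal{G}_{\beta,q}$ is the set of those $(u_1,\ldots,u_q)\in\mathbb{U}^{(q)}$ such that for all $x_1,x_2\in\mathbb{X}$ with $x_1\not\sim x_2$ there is some $i$ with $\beta(x_1,u_i)\neq\beta(x_2,u_i)$.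
   Formalization: The formal theorem assumes dim U ≥ 1; as stated the claim fails when U is a single point and r ≥ 1, since then there are no (2r+1)-tuples of pairwise distinct elements of U. The only true case dropped is X and U both single points. *)

theory Defs
  imports "HOL-Analysis.Analysis"
begin

section \<open>Smooth maps between open subsets of normed spaces\<close>

text \<open>For a finite-dimensional domain and open \<open>S\<close>, continuity of all directional derivatives
  \<open>x \<mapsto> D f(x) v\<close> is the same as continuity of \<open>D f\<close> in the operator norm.\<close>

primrec ck_on :: "nat \<Rightarrow> 'a::real_normed_vector set \<Rightarrow> ('a \<Rightarrow> 'b::real_normed_vector) \<Rightarrow> bool" where
  "ck_on 0 S f \<longleftrightarrow> continuous_on S f"
| "ck_on (Suc k) S f \<longleftrightarrow> (\<forall>x\<in>S. f differentiable (at x)) \<and>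
      (\<forall>v. ck_on k S (\<lambda>x. frechet_derivative f (at x) v))"

definition smooth_on :: "'a::real_normed_vector set \<Rightarrow> ('a \<Rightarrow> 'b::real_normed_vector) \<Rightarrow> bool" where
  "smooth_on S f \<longleftrightarrow> (\<forall>k. ck_on k S f)"

text \<open>\<open>iterated_deriv [v\<^sub>1, \<dots>, v\<^sub>k] f x\<close> is \<open>D\<^sup>k f(x)(v\<^sub>1, \<dots>, v\<^sub>k)\<close>.\<close>

primrec iterated_deriv :: "'a::real_normed_vector list \<Rightarrow> ('a \<Rightarrow> 'b::real_normed_vector) \<Rightarrow> 'a \<Rightarrow> 'b" where
  "iterated_deriv [] f = f"
| "iterated_deriv (v # vs) f = iterated_deriv vs (\<lambda>x. frechet_derivative f (at x) v)"


section \<open>Smooth manifolds\<close>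

text \<open>The points of a manifold are the elements of a type of class \<open>t2_space\<close> and
  \<open>second_countable_topology\<close>. A chart is given by its domain and a map into the model space;
  the values of the map outside the domain are irrelevant.\<close>

type_synonym ('x, 'e) chart = "'x set \<times> ('x \<Rightarrow> 'e)"

definition is_chart :: "('x::topological_space, 'e::real_normed_vector) chart \<Rightarrow> bool" where
  "is_chart = (\<lambda>(D, \<phi>). open D \<and> open (\<phi> ` D) \<and> homeomorphism D (\<phi> ` D) \<phi> (inv_into D \<phi>))"

definition in_chart :: "('x, 'e) chart \<Rightarrow> ('x \<Rightarrow> 'b) \<Rightarrow> 'e \<Rightarrow> 'b" where
  "in_chart = (\<lambda>(D, \<phi>) f. f \<circ> inv_into D \<phi>)"

definition smooth_transition ::
    "('x, 'e::real_normed_vector) chart \<Rightarrow> ('x, 'e) chart \<Rightarrow> bool" where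
  "smooth_transition c d \<longleftrightarrow> smooth_on (snd c ` (fst c \<inter> fst d)) (in_chart c (snd d))"

definition smooth_atlas ::
    "('x::topological_space, 'e::real_normed_vector) chart set \<Rightarrow> bool" where
  "smooth_atlas A \<longleftrightarrow> (\<forall>c\<in>A. is_chart c) \<and> (\<Union>c\<in>A. fst c) = UNIV \<and>
     (\<forall>c\<in>A. \<forall>d\<in>A. smooth_transition c d)"

definition max_atlas ::
    "('x::topological_space, 'e::real_normed_vector) chart set \<Rightarrow> ('x, 'e) chart set" where
  "max_atlas A = {c. is_chart c \<and> (\<forall>d\<in>A. smooth_transition c d \<and> smooth_transition d c)}"

text \<open>The model space may be any real normed space of finite dimension \<open>r\<close>. Unlike the class
  \<open>euclidean_space\<close>, this includes \<open>r = 0\<close>.\<close>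

definition smooth_manifold ::
    "nat \<Rightarrow> ('x::{t2_space, second_countable_topology}, 'e::real_normed_vector) chart set \<Rightarrow> bool" where
  "smooth_manifold r A \<longleftrightarrow>
     (\<exists>B::'e set. finite_dimensional_vector_space (*\<^sub>R) B \<and> card B = r) \<and> smooth_atlas A"

definition prod_atlas :: "('x, 'e) chart set \<Rightarrow> ('u, 'f) chart set \<Rightarrow> ('x \<times> 'u, 'e \<times> 'f) chart set" where
  "prod_atlas A B = {(D \<times> E, map_prod \<phi> \<psi>) | D \<phi> E \<psi>. (D, \<phi>) \<in> A \<and> (E, \<psi>) \<in> B}"

definition smooth_functions ::
    "('x::topological_space, 'e::real_normed_vector) chart set \<Rightarrow> ('x \<Rightarrow> real) set" where
  "smooth_functions A = {f. \<forall>c\<in>max_atlas A. smooth_on (snd c ` fst c) (in_chart c f)}"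


section \<open>The Whitney topology\<close>

text \<open>The Whitney (strong) topology in Hirsch's form: a basic neighbourhood of \<open>f\<close> is given by an
  order \<open>k\<close>, a locally finite family of charts \<open>c\<^sub>i\<close>, compact subsets \<open>K\<^sub>i\<close> of their domains and
  \<open>\<epsilon>\<^sub>i > 0\<close>; it consists of the \<open>g\<close> such that, on \<open>K\<^sub>i\<close> read in \<open>c\<^sub>i\<close>, all derivatives of order
  at most \<open>k\<close> of \<open>f\<close> and \<open>g\<close> differ by less than \<open>\<epsilon>\<^sub>i\<close> (evaluation on vectors of norm at most 1
  gives the operator norm). Charts are taken from the maximal atlas, since a given atlas need not
  contain enough locally finite families. Families indexed by subsets of \<open>\<nat>\<close> suffice because a
  locally finite family of nonempty sets in a second countable space is countable.\<close>

definition locally_finite_family :: "nat set \<Rightarrow> (nat \<Rightarrow> 'x::topological_space set) \<Rightarrow> bool" where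
  "locally_finite_family I D \<longleftrightarrow>
     (\<forall>p. \<exists>V. open V \<and> p \<in> V \<and> finite {i\<in>I. D i \<inter> V \<noteq> {}})"

definition whitney_nbhd ::
    "('x::topological_space, 'e::real_normed_vector) chart set \<Rightarrow> nat \<Rightarrow> nat set \<Rightarrow>
     (nat \<Rightarrow> ('x, 'e) chart) \<Rightarrow> (nat \<Rightarrow> 'x set) \<Rightarrow> (nat \<Rightarrow> real) \<Rightarrow> ('x \<Rightarrow> real) \<Rightarrow> ('x \<Rightarrow> real) set" where
  "whitney_nbhd A k I c K \<epsilon> f =
     {g \<in> smooth_functions A. \<forall>i\<in>I. \<forall>p\<in>K i. \<forall>vs. length vs \<le> k \<and> (\<forall>v\<in>set vs. norm v \<le> 1) \<longrightarrow>
        \<bar>iterated_deriv vs (in_chart (c i) f) (snd (c i) p) -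
         iterated_deriv vs (in_chart (c i) g) (snd (c i) p)\<bar> < \<epsilon> i}"

definition whitney_topology ::
    "('x::topological_space, 'e::real_normed_vector) chart set \<Rightarrow> ('x \<Rightarrow> real) topology" where
  "whitney_topology A = topology_generated_by
     {whitney_nbhd A k I c K \<epsilon> f | k I c K \<epsilon> f.
        f \<in> smooth_functions A \<and> locally_finite_family I (\<lambda>i. fst (c i)) \<and>
        (\<forall>i\<in>I. c i \<in> max_atlas A \<and> compact (K i) \<and> K i \<subseteq> fst (c i) \<and> \<epsilon> i > 0)}"

lemma topspace_whitney_topology: "topspace (whitney_topology A) = smooth_functions A"
proof -
  have "whitney_nbhd A 0 {} c K \<epsilon> f = smooth_functions A" for c K \<epsilon> f
    by (simp add: whitney_nbhd_def)
  moreover have "locally_finite_family {} D" for D :: "nat \<Rightarrow> 'a set"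
    unfolding locally_finite_family_def by (auto intro: exI[of _ UNIV])
  ultimately show ?thesis
    unfolding whitney_topology_def topology_generated_by_topspace
    by (auto simp: whitney_nbhd_def) fastforce
qed


section \<open>Genericity and full measure\<close>

definition generic_in :: "'a topology \<Rightarrow> 'a set \<Rightarrow> bool" where
  "generic_in T S \<longleftrightarrow> S \<subseteq> topspace T \<and>
     (\<exists>\<D>. countable \<D> \<and> (\<forall>D\<in>\<D>. openin T D \<and> T closure_of D = topspace T) \<and>
          topspace T \<inter> \<Inter>\<D> \<subseteq> S)"

text \<open>A point of the power \<open>\<bbbU>\<^sup>q\<close> is an extensional function on \<open>{..<q}\<close>.\<close>

abbreviation power_topology :: "nat \<Rightarrow> (nat \<Rightarrow> 'u::topological_space) topology" where
  "power_topology q \<equiv> product_topology (\<lambda>_. euclidean) {..<q}"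

text \<open>Measure zero in \<open>\<bbbU>\<^sup>q\<close>, tested in the product charts. The completed \<open>q\<close>-fold product of
  \<open>lborel\<close> is Lebesgue measure on the \<open>q\<close>-th power of the model space.
  The class \<open>euclidean_space\<close> makes \<open>dim \<bbbU> \<ge> 1\<close>: over a one-point \<open>\<bbbU>\<close> there are no pairwise distinct
  \<open>q\<close>-tuples for \<open>q \<ge> 2\<close>, so no set of such tuples is generic or of full measure in \<open>\<bbbU>\<^sup>q\<close>.\<close>

definition measure_zero ::
    "('u::topological_space, 'f::euclidean_space) chart set \<Rightarrow> nat \<Rightarrow> (nat \<Rightarrow> 'u) set \<Rightarrow> bool" where
  "measure_zero B q S \<longleftrightarrow>
     (\<forall>c. (\<forall>i<q. c i \<in> max_atlas B) \<longrightarrow>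
        (\<lambda>u. \<lambda>i\<in>{..<q}. snd (c i) (u i)) ` (S \<inter> (\<Pi>\<^sub>E i\<in>{..<q}. fst (c i)))
          \<in> null_sets (completion (\<Pi>\<^sub>M i\<in>{..<q}. lborel)))"

definition full_measure ::
    "('u::topological_space, 'f::euclidean_space) chart set \<Rightarrow> nat \<Rightarrow> (nat \<Rightarrow> 'u) set \<Rightarrow> bool" where
  "full_measure B q S \<longleftrightarrow> measure_zero B q (({..<q} \<rightarrow>\<^sub>E UNIV) - S)"


section \<open>Distinguishability\<close>

definition distinguishable :: "('x \<times> 'u \<Rightarrow> real) \<Rightarrow> 'x \<Rightarrow> 'x \<Rightarrow> bool" where
  "distinguishable \<beta> x\<^sub>1 x\<^sub>2 \<longleftrightarrow> (\<exists>u. \<beta> (x\<^sub>1, u) \<noteq> \<beta> (x\<^sub>2, u))"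

definition distinct_tuples :: "nat \<Rightarrow> (nat \<Rightarrow> 'u) set" where
  "distinct_tuples q = {u \<in> {..<q} \<rightarrow>\<^sub>E UNIV. inj_on u {..<q}}"

definition universal_tuples :: "('x \<times> 'u \<Rightarrow> real) \<Rightarrow> nat \<Rightarrow> (nat \<Rightarrow> 'u) set" where
  "universal_tuples \<beta> q = {u \<in> distinct_tuples q.
     \<forall>x\<^sub>1 x\<^sub>2. distinguishable \<beta> x\<^sub>1 x\<^sub>2 \<longrightarrow> (\<exists>i<q. \<beta> (x\<^sub>1, u i) \<noteq> \<beta> (x\<^sub>2, u i))}"

end

theory Submission
  imports Defs
begin

text \<open>
  Put \<open>q = 2 r + 1\<close>. A tuple of distinct points \<open>u\<close> is bad if \<open>F(x\<^sub>1, x\<^sub>2, u) = (\<beta>(x\<^sub>1, u\<^sub>i) - \<beta>(x\<^sub>2, u\<^sub>i))\<^sub>i\<close>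
  vanishes for some \<open>x\<^sub>1 \<noteq> x\<^sub>2\<close>. On a product of small compact sets \<open>K\<^sub>1, K\<^sub>2 \<subseteq> \<bbbX>\<close> and
  \<open>L\<^sub>1, \<dots>, L\<^sub>q \<subseteq> \<bbbU>\<close>, with \<open>K\<^sub>1, K\<^sub>2\<close> disjoint and the \<open>L\<^sub>i\<close> pairwise disjoint, the bad tuples form a
  compact set, and the condition that it has measure less than \<open>\<epsilon>\<close> is open in \<open>\<beta>\<close> already for uniform closeness.

  It is also dense, and multijet transversality is not needed for this. Take bump functions with \<open>a = 1\<close> on \<open>K\<^sub>1\<close>,
  \<open>a = 0\<close> on \<open>K\<^sub>2\<close>, \<open>b\<^sub>j = 1\<close> on \<open>L\<^sub>j\<close> and \<open>b\<^sub>j = 0\<close> on the other \<open>L\<^sub>i\<close>. Replacing \<open>\<beta>\<close> by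
  \<open>\<beta> + \<Sum>\<^sub>j t\<^sub>j a b\<^sub>j\<close> replaces \<open>F\<close> by \<open>F + t\<close> on these pieces. For fixed \<open>u\<close> the parameters \<open>t\<close> that make \<open>u\<close> bad
  are the image of the \<open>2 r\<close>-dimensional set \<open>K\<^sub>1 \<times> K\<^sub>2\<close> under a locally Lipschitz map into \<open>\<real>\<^sup>q\<close>, a null set because
  \<open>2 r < q\<close>. By Fubini the set of bad \<open>u\<close> is null for almost every \<open>t\<close>, in particular for arbitrarily small ones.

  Countably many such pieces suffice by the Lindelof property. For \<open>\<beta>\<close> in the intersection of the resulting
  open dense sets the complement of \<open>\<G>\<^sub>\<beta>\<close> is covered by countably many closed null sets, among them the
  diagonals \<open>u\<^sub>i = u\<^sub>j\<close>, so \<open>\<G>\<^sub>\<beta>\<close> is of full measure and, closed null sets having dense complement, generic.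
\<close>

subsection \<open>Calculus of \<open>C\<^sup>k\<close> maps\<close>

text \<open>Being null is not an open condition on \<beta>, but having measure less than \<epsilon>
  is, because a bad set is compact and is approached from above, in measure, by the sets where the
  equations hold up to an error \<eta>. Intersecting over \<epsilon> = 1/(n+1) recovers nullity. The
  pieces must be fixed before \<beta> is chosen, while distinguishability depends on \<beta>; hence
  all pairs of distinct parameters are treated, which only enlarges the bad set. The configurations
  with distinct entries form an open set, in general not compact, and near the diagonals bump
  functions cannot shift the q values independently; this forces the localisation to separated
  pieces. Nullity of the image in R^q comes from counting: a grid of mesh 1/N cuts the pairs of
  parameters into O(N^(2r)) cells, each mapped into a box of volume O(N^(-q)). Only finitely many
  continuous coordinates on the model space of X enter, so its norm is arbitrary and r = 0 is
  included. Compact support of the bumps is essential as well: on a non-compact manifold, t g tends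
  to 0 with t in the Whitney topology only if g has compact support.\<close>

lemma ck_on_subset: "ck_on k S f \<Longrightarrow> T \<subseteq> S \<Longrightarrow> ck_on k T f"
  by (induction k arbitrary: f) (auto intro: continuous_on_subset)

text \<open>The derivative at a point sees the values nearby, hence the open set. This is how a
  function read in a chart is replaced by an explicit formula.\<close>

lemma ck_on_cong:
  assumes "open S" "\<And>x. x \<in> S \<Longrightarrow> f x = g x"
  shows "ck_on k S f \<longleftrightarrow> ck_on k S g"
  using assms(2)
proof (induction k arbitrary: f g)
  case 0
  then show ?case by (simp cong: continuous_on_cong)
next
  case (Suc k)
  have d: "(f has_derivative D) (at x) \<longleftrightarrow> (g has_derivative D) (at x)" if "x \<in> S" for x D
    using that Suc.prems assms(1) by (metis has_derivative_transform_within_open)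
  have "f differentiable (at x) \<longleftrightarrow> g differentiable (at x)" if "x \<in> S" for x
    using d[OF that] by (simp add: differentiable_def)
  moreover have "frechet_derivative f (at x) = frechet_derivative g (at x)" if "x \<in> S" for x
    using d[OF that] by (simp add: frechet_derivative_def)
  ultimately show ?case
    using Suc.IH[of "\<lambda>x. frechet_derivative f (at x) v" "\<lambda>x. frechet_derivative g (at x) v" for v]
    by simp
qed

text \<open>\<open>ck_on\<close> speaks about the chosen value \<open>frechet_derivative\<close>;
  uniqueness of the derivative lets an explicit formula stand in for it, and the closure rules
  become inductions on the order driven by the usual calculus rules.\<close>

lemma ck_on_SucI:
  assumes "open S" "\<And>x. x \<in> S \<Longrightarrow> (f has_derivative f' x) (at x)"
    and "\<And>v. ck_on k S (\<lambda>x. f' x v)"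
  shows "ck_on (Suc k) S f"
proof -
  have "frechet_derivative f (at x) = f' x" if "x \<in> S" for x
    using assms(2)[OF that] frechet_derivative_at by metis
  then have "ck_on k S (\<lambda>x. frechet_derivative f (at x) v)" for v
    using ck_on_cong[OF assms(1), of "\<lambda>x. frechet_derivative f (at x) v" "\<lambda>x. f' x v"] assms(3)
    by simp
  then show ?thesis
    using assms(2) by (auto simp: differentiable_def)
qed

lemma ck_on_has_derivative:
  "ck_on (Suc k) S f \<Longrightarrow> x \<in> S \<Longrightarrow> (f has_derivative frechet_derivative f (at x)) (at x)"
  by (simp add: frechet_derivative_works)

lemma ck_on_continuous_on: "ck_on k S f \<Longrightarrow> continuous_on S f"
  by (cases k)
    (auto intro!: continuous_at_imp_continuous_on differentiable_imp_continuous_within)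

lemma ck_on_Suc_imp: "ck_on (Suc k) S f \<Longrightarrow> ck_on k S f"
proof (induction k arbitrary: f)
  case 0
  then show ?case using ck_on_continuous_on ck_on.simps(1) by blast
qed auto

text \<open>Both continuity and differentiability on an open set are tested near each point. A bump
  function has one formula in its chart and is 0 away from its support; this joins the two
  descriptions.\<close>

lemma ck_on_local:
  assumes "\<And>x. x \<in> S \<Longrightarrow> \<exists>T. open T \<and> x \<in> T \<and> ck_on k T f"
  shows "ck_on k S f"
proof -
  obtain T where T: "\<And>x. x \<in> S \<Longrightarrow> open (T x) \<and> x \<in> T x \<and> ck_on k (T x) f"
    using assms by metis
  have "ck_on k (\<Union>x\<in>S. T x) f"
    using conjunct2[OF conjunct2[OF T]]
  proof (induction k arbitrary: f)
    case 0
    then show ?case using T by (auto intro!: continuous_on_open_UN)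
  next
    case (Suc k)
    then show ?case by fastforce
  qed
  then show ?thesis by (rule ck_on_subset) (use T in auto)
qed

lemma ck_on_const: "ck_on k S (\<lambda>x. c)"
proof (induction k arbitrary: c)
  case (Suc k)
  then show ?case by (simp)
qed simp

lemma ck_on_add:
  assumes "open S"
  shows "ck_on k S f \<Longrightarrow> ck_on k S g \<Longrightarrow> ck_on k S (\<lambda>x. f x + g x)"
proof (induction k arbitrary: f g)
  case 0
  then show ?case by (auto intro: continuous_intros)
next
  case (Suc k)
  show ?case
    by (rule ck_on_SucI[OF assms, where f' = "\<lambda>x v. frechet_derivative f (at x) v + frechet_derivative g (at x) v"])
      (use Suc in \<open>auto intro!: has_derivative_add ck_on_has_derivative\<close>)
qed

lemma ck_on_sum:
  assumes "open S" "\<And>i. i \<in> I \<Longrightarrow> ck_on k S (f i)"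
  shows "ck_on k S (\<lambda>x. \<Sum>i\<in>I. f i x)"
  using assms(2) by (induction I rule: infinite_finite_induct) (auto intro: ck_on_const ck_on_add assms)

lemma ck_on_linear:
  assumes L: "bounded_linear L" and S: "open S"
  shows "ck_on k S f \<Longrightarrow> ck_on k S (\<lambda>x. L (f x))"
proof (induction k arbitrary: f)
  case 0
  then show ?case using L by (auto intro: bounded_linear.continuous_on)
next
  case (Suc k)
  show ?case
    by (rule ck_on_SucI[OF S, where f' = "\<lambda>x v. L (frechet_derivative f (at x) v)"])
      (use Suc in \<open>auto intro!: bounded_linear.has_derivative[OF L] ck_on_has_derivative\<close>)
qed

lemma ck_on_mult:
  fixes f g :: "'a::real_normed_vector \<Rightarrow> real"
  assumes "open S"
  shows "ck_on k S f \<Longrightarrow> ck_on k S g \<Longrightarrow> ck_on k S (\<lambda>x. f x * g x)"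
proof (induction k arbitrary: f g)
  case 0
  then show ?case by (auto intro: continuous_intros)
next
  case (Suc k)
  \<comment> \<open>The product rule also contains the undifferentiated factors, which enter with
    the order lowered by one.\<close>
  note fg = ck_on_Suc_imp[OF Suc.prems(1)] ck_on_Suc_imp[OF Suc.prems(2)]
  have ck: "ck_on k S (\<lambda>x. f x * frechet_derivative g (at x) v + frechet_derivative f (at x) v * g x)" for v
    using Suc fg by (intro ck_on_add assms) auto
  show ?case
    by (rule ck_on_SucI[OF assms _ ck])
      (rule has_derivative_mult[OF ck_on_has_derivative[OF Suc.prems(1)] ck_on_has_derivative[OF Suc.prems(2)]])
qed

lemma ck_on_prod:
  fixes f :: "'i \<Rightarrow> 'a::real_normed_vector \<Rightarrow> real"
  assumes "open S" "\<And>i. i \<in> I \<Longrightarrow> ck_on k S (f i)"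
  shows "ck_on k S (\<lambda>x. \<Prod>i\<in>I. f i x)"
  using assms(2) by (induction I rule: infinite_finite_induct) (auto intro: ck_on_const ck_on_mult assms)

lemma ck_on_inverse:
  fixes f :: "'a::real_normed_vector \<Rightarrow> real"
  assumes "open S" "\<And>x. x \<in> S \<Longrightarrow> f x \<noteq> 0"
  shows "ck_on k S f \<Longrightarrow> ck_on k S (\<lambda>x. inverse (f x))"
proof (induction k)
  case 0
  then show ?case using assms by (auto intro: continuous_intros)
next
  case (Suc k)
  then have "ck_on k S (\<lambda>x. inverse (f x))" using ck_on_Suc_imp by blast
  then have "ck_on k S (\<lambda>x. -1 * (inverse (f x) * frechet_derivative f (at x) v * inverse (f x)))" for v
    using Suc.prems by (intro ck_on_mult ck_on_const assms(1)) auto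
  then have ck: "ck_on k S (\<lambda>x. - (inverse (f x) * frechet_derivative f (at x) v * inverse (f x)))" for v
    by simp
  show ?case
    by (rule ck_on_SucI[OF assms(1) _ ck])
      (rule Deriv.has_derivative_inverse[OF assms(2) ck_on_has_derivative[OF Suc.prems]])
qed

text \<open>The derivative of a product map in a fixed direction is again a product map, of the two
  directional derivatives, so the induction closes. It yields smooth transitions between product
  charts.\<close>

lemma ck_on_map_prod:
  assumes "open S" "open T"
  shows "ck_on k S f \<Longrightarrow> ck_on k T g \<Longrightarrow> ck_on k (S \<times> T) (map_prod f g)"
proof (induction k arbitrary: f g)
  case 0
  then have "continuous_on S f" "continuous_on T g" by simp_all
  then have "continuous_on (S \<times> T) (\<lambda>z. f (fst z))" "continuous_on (S \<times> T) (\<lambda>z. g (snd z))"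
    using continuous_on_compose2[OF _ continuous_on_fst[OF continuous_on_id], of S f "S \<times> T"]
      continuous_on_compose2[OF _ continuous_on_snd[OF continuous_on_id], of T g "S \<times> T"] by auto
  then have "continuous_on (S \<times> T) (\<lambda>z. (f (fst z), g (snd z)))"
    by (rule continuous_on_Pair)
  then show ?case by (simp add: map_prod_def case_prod_beta)
next
  case (Suc k)
  let ?D = "\<lambda>z v. (frechet_derivative f (at (fst z)) (fst v), frechet_derivative g (at (snd z)) (snd v))"
  have "((\<lambda>z. (f (fst z), g (snd z))) has_derivative ?D z) (at z)" if "z \<in> S \<times> T" for z
  proof (rule has_derivative_Pair)
    have "fst z \<in> S" "snd z \<in> T" using that by auto
    then show "((\<lambda>z. f (fst z)) has_derivative (\<lambda>v. frechet_derivative f (at (fst z)) (fst v))) (at z)"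
      "((\<lambda>z. g (snd z)) has_derivative (\<lambda>v. frechet_derivative g (at (snd z)) (snd v))) (at z)"
      using has_derivative_compose[OF bounded_linear_imp_has_derivative[OF bounded_linear_fst] ck_on_has_derivative[OF Suc.prems(1)], of z]
        has_derivative_compose[OF bounded_linear_imp_has_derivative[OF bounded_linear_snd] ck_on_has_derivative[OF Suc.prems(2)], of z]
      by simp_all
  qed
  moreover have "map_prod f g = (\<lambda>z. (f (fst z), g (snd z)))" by auto
  moreover have "ck_on k (S \<times> T) (\<lambda>z. ?D z v)" for v
  proof -
    have "(\<lambda>z. ?D z v) = map_prod (\<lambda>x. frechet_derivative f (at x) (fst v)) (\<lambda>x. frechet_derivative g (at x) (snd v))"
      by auto
    then show ?thesis using Suc by simp
  qed
  ultimately show ?case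
    by (intro ck_on_SucI[where f' = ?D] open_Times assms) auto
qed

lemma smooth_on_frechet: "smooth_on S f \<Longrightarrow> smooth_on S (\<lambda>x. frechet_derivative f (at x) v)"
  unfolding smooth_on_def using ck_on.simps(2) by blast

lemma smooth_on_continuous_on: "smooth_on S f \<Longrightarrow> continuous_on S f"
  unfolding smooth_on_def using ck_on.simps(1) by blast

lemma smooth_on_has_derivative:
  "smooth_on S f \<Longrightarrow> x \<in> S \<Longrightarrow> (f has_derivative frechet_derivative f (at x)) (at x)"
  unfolding smooth_on_def using ck_on_has_derivative by blast

section \<open>Iterated directional derivatives\<close>

lemma iterated_deriv_cong:
  assumes "open S" "x \<in> S" "\<And>x. x \<in> S \<Longrightarrow> f x = g x"
  shows "iterated_deriv vs f x = iterated_deriv vs g x"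
  using assms(3)
proof (induction vs arbitrary: f g)
  case (Cons v vs)
  have "frechet_derivative f (at x) = frechet_derivative g (at x)" if "x \<in> S" for x
  proof -
    have "(f has_derivative D) (at x) \<longleftrightarrow> (g has_derivative D) (at x)" for D
      using that Cons.prems assms(1) by (metis has_derivative_transform_within_open)
    then show ?thesis by (simp add: frechet_derivative_def)
  qed
  then show ?case
    using Cons.IH[of "\<lambda>x. frechet_derivative f (at x) v" "\<lambda>x. frechet_derivative g (at x) v"] by simp
qed (use assms in simp)

text \<open>Differentiating once turns the family \<open>f\<close> into the family of its
  directional derivatives, still smooth and with the same coefficients; the induction therefore
  ranges over all families.\<close>

lemma iterated_deriv_lincomb:
  fixes f :: "'i \<Rightarrow> 'a::real_normed_vector \<Rightarrow> real"
  assumes "open S" "x \<in> S" "\<And>i. i \<in> I \<Longrightarrow> smooth_on S (f i)"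
  shows "iterated_deriv vs (\<lambda>x. \<Sum>i\<in>I. c i * f i x) x = (\<Sum>i\<in>I. c i * iterated_deriv vs (f i) x)"
  using assms(3)
proof (induction vs arbitrary: f)
  case (Cons v vs)
  have "frechet_derivative (\<lambda>x. \<Sum>i\<in>I. c i * f i x) (at x) v = (\<Sum>i\<in>I. c i * frechet_derivative (f i) (at x) v)"
    if "x \<in> S" for x
  proof -
    have "((\<lambda>x. \<Sum>i\<in>I. c i * f i x) has_derivative (\<lambda>v. \<Sum>i\<in>I. c i * frechet_derivative (f i) (at x) v)) (at x)"
      using Cons.prems that
      by (intro has_derivative_sum has_derivative_mult_right smooth_on_has_derivative) auto
    from frechet_derivative_at[OF this, symmetric] show ?thesis by (rule fun_cong)
  qed
  then have "iterated_deriv (v # vs) (\<lambda>x. \<Sum>i\<in>I. c i * f i x) x =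
      iterated_deriv vs (\<lambda>x. \<Sum>i\<in>I. c i * frechet_derivative (f i) (at x) v) x"
    using assms by (auto intro: iterated_deriv_cong)
  also have "\<dots> = (\<Sum>i\<in>I. c i * iterated_deriv (v # vs) (f i) x)"
    using Cons by (simp add: smooth_on_frechet)
  finally show ?case .
qed simp

subsection \<open>Coordinates in finite-dimensional normed spaces\<close>

lemma compact_closed_subset: "compact A \<Longrightarrow> closed B \<Longrightarrow> B \<subseteq> A \<Longrightarrow> compact B"
  using compact_Int_closed[of A B] by (simp add: Int_absorb1)

text \<open>The form in which finite dimension is used: a finite expansion with continuous
  coefficients. It involves no inner product, passes to products of spaces, and makes sense for n =
  0.\<close>

definition coordinates :: "nat \<Rightarrow> (nat \<Rightarrow> 'e::real_normed_vector) \<Rightarrow> (nat \<Rightarrow> 'e \<Rightarrow> real) \<Rightarrow> bool" where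
  "coordinates n b \<xi> \<longleftrightarrow> (\<forall>i<n. bounded_linear (\<xi> i)) \<and> (\<forall>x. x = (\<Sum>i<n. \<xi> i x *\<^sub>R b i))"

lemma coordinates_sum: "coordinates n b \<xi> \<Longrightarrow> (\<Sum>i<n. \<xi> i x *\<^sub>R b i) = x"
  by (simp add: coordinates_def)

lemma coordinates_linear: "coordinates n b \<xi> \<Longrightarrow> i < n \<Longrightarrow> bounded_linear (\<xi> i)"
  by (simp add: coordinates_def)

lemma coordinates_Pair:
  assumes "coordinates n b \<xi>" "coordinates m c \<zeta>"
  shows "coordinates (n + m) (\<lambda>i. if i < n then (b i, 0) else (0, c (i - n)))
     (\<lambda>i z. if i < n then \<xi> i (fst z) else \<zeta> (i - n) (snd z))"
proof -
  have split: "(\<Sum>i<n+m. F i) = (\<Sum>i<n. F i) + (\<Sum>i<m. F (n + i))" for F :: "nat \<Rightarrow> 'a \<times> 'b"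
    by (induction m) (auto simp: add.assoc)
  have "(\<Sum>i<n+m. (if i < n then \<xi> i (fst z) else \<zeta> (i - n) (snd z)) *\<^sub>R (if i < n then (b i, 0) else (0, c (i - n)))) = z" for z
    unfolding split using coordinates_sum[OF assms(1), of "fst z"] coordinates_sum[OF assms(2), of "snd z"]
    by (simp add: prod_eq_iff fst_sum snd_sum)
  moreover have "bounded_linear (\<lambda>z. if i < n then \<xi> i (fst z) else \<zeta> (i - n) (snd z))" if "i < n + m" for i
    using assms that unfolding coordinates_def
    by (cases "i < n") (auto intro: bounded_linear_compose bounded_linear_fst bounded_linear_snd)
  ultimately show ?thesis by (simp add: coordinates_def)
qed

text \<open>The box is a closed subset of the image of a compact set of coefficient sequences under
  the expansion map.\<close>

lemma coordinates_cube_compact: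
  assumes "coordinates n b \<xi>"
  shows "compact {x. \<forall>i<n. \<bar>\<xi> i (x - a)\<bar> \<le> d}"
proof -
  \<comment> \<open>Coefficients beyond n are frozen at 0, so that a product over all indices is
    compact.\<close>
  let ?T = "PiE UNIV (\<lambda>i. if i < n then {-d..d} else {0})"
  let ?F = "\<lambda>c::nat\<Rightarrow>real. a + (\<Sum>i<n. c i *\<^sub>R b i)"
  have "compactin (product_topology (\<lambda>_. euclidean) UNIV) ?T"
    by (subst compactin_PiE) auto
  then have "compact ?T" by (simp add: euclidean_product_topology)
  moreover have "continuous_on ?T ?F"
    by (intro continuous_intros continuous_on_subset[OF continuous_on_product_coordinates]) auto
  ultimately have "compact (?F ` ?T)" by (rule compact_continuous_image[rotated])
  moreover have "closed {x. \<forall>i<n. \<bar>\<xi> i (x - a)\<bar> \<le> d}"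
  proof -
    have "closed {x. \<bar>\<xi> i (x - a)\<bar> \<le> d}" if "i < n" for i
    proof -
      have "continuous_on UNIV (\<lambda>x. \<xi> i (x - a))"
        by (rule bounded_linear.continuous_on[OF coordinates_linear[OF assms that]]) (intro continuous_intros)
      then show ?thesis
        by (intro closed_Collect_le continuous_on_rabs continuous_on_const)
    qed
    then have "closed (\<Inter>i\<in>{..<n}. {x. \<bar>\<xi> i (x - a)\<bar> \<le> d})" by auto
    also have "(\<Inter>i\<in>{..<n}. {x. \<bar>\<xi> i (x - a)\<bar> \<le> d}) = {x. \<forall>i<n. \<bar>\<xi> i (x - a)\<bar> \<le> d}" by auto
    finally show ?thesis .
  qed
  moreover have "{x. \<forall>i<n. \<bar>\<xi> i (x - a)\<bar> \<le> d} \<subseteq> ?F ` ?T"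
  proof
    fix x assume x: "x \<in> {x. \<forall>i<n. \<bar>\<xi> i (x - a)\<bar> \<le> d}"
    let ?c = "\<lambda>i. if i < n then \<xi> i (x - a) else 0"
    have "(\<Sum>i<n. ?c i *\<^sub>R b i) = (\<Sum>i<n. \<xi> i (x - a) *\<^sub>R b i)" by (intro sum.cong) auto
    then have "x = ?F ?c" using coordinates_sum[OF assms, of "x - a"] by simp
    moreover have "?c \<in> ?T" using x by (auto simp: abs_le_iff minus_le_iff split: if_splits)
    ultimately show "x \<in> ?F ` ?T" by (rule image_eqI)
  qed
  ultimately show ?thesis by (rule compact_closed_subset)
qed

lemma coordinates_cube_small:
  assumes "coordinates n b \<xi>" "e > 0"
  obtains d where "d > 0" "{x. \<forall>i<n. \<bar>\<xi> i (x - a)\<bar> \<le> d} \<subseteq> ball a e"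
proof -
  \<comment> \<open>The summand 1 keeps s positive also when n = 0; \<open>d * s = e / 2\<close>
    leaves room for the strict inequality.\<close>
  define s where "s = 1 + (\<Sum>i<n. norm (b i))"
  have s: "s \<ge> 1" by (simp add: s_def sum_nonneg)
  define d where "d = e / (2 * s)"
  have d: "d > 0" using assms s by (simp add: d_def)
  have "norm (x - a) < e" if "\<forall>i<n. \<bar>\<xi> i (x - a)\<bar> \<le> d" for x
  proof -
    have "norm (x - a) \<le> (\<Sum>i<n. norm (\<xi> i (x - a) *\<^sub>R b i))"
      using coordinates_sum[OF assms(1), of "x - a"] norm_sum by metis
    also have "\<dots> \<le> (\<Sum>i<n. d * norm (b i))"
      using that by (intro sum_mono) (auto intro: mult_right_mono)
    also have "\<dots> \<le> d * s" using d by (simp add: s_def sum_distrib_left ring_distribs)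
    also have "\<dots> < e" using s assms(2) by (simp add: d_def field_simps)
    finally show ?thesis .
  qed
  then have "{x. \<forall>i<n. \<bar>\<xi> i (x - a)\<bar> \<le> d} \<subseteq> ball a e"
    by (auto simp: dist_norm norm_minus_commute)
  then show ?thesis using d that by blast
qed

lemma coordinates_compact_cball:
  fixes b :: "nat \<Rightarrow> 'e::real_normed_vector"
  assumes "coordinates n b \<xi>"
  shows "compact (cball (0::'e) R)"
proof -
  obtain d where d: "d > 0" "{x. \<forall>i<n. \<bar>\<xi> i (x - 0)\<bar> \<le> d} \<subseteq> ball 0 1"
    using coordinates_cube_small[OF assms, of 1 0] by auto
  have "\<exists>K. \<forall>i<n. \<forall>x. \<bar>\<xi> i x\<bar> \<le> norm x * K"
  proof -
    have "\<exists>K. \<forall>x. \<bar>\<xi> i x\<bar> \<le> norm x * K" if "i < n" for i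
      using bounded_linear.bounded[OF coordinates_linear[OF assms that]] by auto
    then obtain K where K: "\<And>i x. i < n \<Longrightarrow> \<bar>\<xi> i x\<bar> \<le> norm x * K i" by metis
    have "\<bar>\<xi> i x\<bar> \<le> norm x * (\<Sum>i<n. \<bar>K i\<bar>)" if "i < n" for i x
    proof -
      have "K i \<le> \<bar>K i\<bar>" by simp
      also have "\<dots> \<le> (\<Sum>i<n. \<bar>K i\<bar>)" using that by (intro member_le_sum) auto
      finally show ?thesis using K[OF that, of x] by (meson mult_left_mono norm_ge_zero order_trans)
    qed
    then show ?thesis by blast
  qed
  then obtain K where K: "\<And>i x. i < n \<Longrightarrow> \<bar>\<xi> i x\<bar> \<le> norm x * K" by blast
  have "cball 0 R \<subseteq> {x. \<forall>i<n. \<bar>\<xi> i (x - 0)\<bar> \<le> \<bar>R\<bar> * \<bar>K\<bar>}"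
  proof clarsimp
    fix x :: 'e and i assume "norm x \<le> R" "i < n"
    then have "norm x * K \<le> norm x * \<bar>K\<bar>" "norm x * \<bar>K\<bar> \<le> \<bar>R\<bar> * \<bar>K\<bar>"
      by (auto intro: mult_left_mono mult_right_mono)
    then show "\<bar>\<xi> i x\<bar> \<le> \<bar>R\<bar> * \<bar>K\<bar>" using K[OF \<open>i < n\<close>, of x] by linarith
  qed
  then show ?thesis
    by (rule compact_closed_subset[OF coordinates_cube_compact[OF assms] closed_cball])
qed

text \<open>Algebraic coordinates come from the basis; their continuity is the equivalence of norms.
  On the unit sphere of the maximum norm the given norm has a positive minimum m, and rescaling by
  the largest coordinate bounds all coordinates by \<open>norm x / m\<close>.\<close>

lemma coordinates_exists:
  assumes "finite_dimensional_vector_space (*\<^sub>R) (B :: 'e::real_normed_vector set)" "card B = r"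
  shows "\<exists>(b :: nat \<Rightarrow> 'e) \<xi>. coordinates r b \<xi>"
proof -
  interpret fd: finite_dimensional_vector_space "(*\<^sub>R)" B by (rule assms(1))
  have ind: "independent B" and sp: "span B = UNIV"
    using fd.independent_Basis fd.span_Basis by (simp_all add: dependent_raw_def span_raw_def)
  obtain b where b: "bij_betw b {..<r} B"
    using ex_bij_betw_nat_finite[OF fd.finite_Basis] assms(2) by (auto simp: atLeast0LessThan)
  define \<xi> where "\<xi> i x = representation B x (b i)" for i x
  have sum: "(\<Sum>i<r. \<xi> i x *\<^sub>R b i) = x" for x
    using sum.reindex_bij_betw[OF b, of "\<lambda>v. representation B x v *\<^sub>R v"]
      real_vector.sum_representation_eq[OF ind _ fd.finite_Basis order_refl, of x]
    by (simp add: \<xi>_def sp)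
  have add: "\<xi> i (x + y) = \<xi> i x + \<xi> i y" for i x y
    unfolding \<xi>_def by (subst real_vector.representation_add) (auto simp: ind sp)
  have scale: "\<xi> i (t *\<^sub>R x) = t * \<xi> i x" for i t x
    unfolding \<xi>_def by (subst real_vector.representation_scale) (auto simp: ind sp)
  have basis: "\<xi> i (b j) = (if i = j then 1 else 0)" if "i < r" "j < r" for i j
    using that b real_vector.representation_basis[OF ind, of "b j"]
    by (auto simp: \<xi>_def bij_betw_def inj_on_eq_iff)
  have zero: "\<xi> i 0 = 0" for i using scale[of i 0 0] by simp
  have \<xi>_sum: "\<xi> i (\<Sum>j\<in>J. F j) = (\<Sum>j\<in>J. \<xi> i (F j))" if "finite J" for i F and J :: "nat set"
    using that by induction (simp_all add: add zero)
  define S where "S = PiE UNIV (\<lambda>i. if i < r then {-1..1::real} else {0}) \<inter> (\<Union>i\<in>{..<r}. {c. \<bar>c i\<bar> = 1})"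
  have "compactin (product_topology (\<lambda>_. euclidean) UNIV) (PiE UNIV (\<lambda>i::nat. if i < r then {-1..1::real} else {0}))"
    by (subst compactin_PiE) auto
  then have "compact (PiE UNIV (\<lambda>i::nat. if i < r then {-1..1::real} else {0}))"
    by (simp add: euclidean_product_topology)
  moreover have "closed {c :: nat \<Rightarrow> real. \<bar>c i\<bar> = 1}" for i
    by (intro closed_Collect_eq continuous_on_rabs continuous_on_product_coordinates continuous_on_const)
  ultimately have "compact S" unfolding S_def by (intro compact_Int_closed closed_UN) auto
  moreover have "continuous_on S (\<lambda>c. norm (\<Sum>i<r. c i *\<^sub>R b i))"
    by (intro continuous_on_norm continuous_on_sum continuous_on_scaleR continuous_on_const
          continuous_on_subset[OF continuous_on_product_coordinates]) auto
  moreover have pos: "norm (\<Sum>i<r. c i *\<^sub>R b i) > 0" if "c \<in> S" for c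
  proof -
    obtain i where i: "i < r" "\<bar>c i\<bar> = 1" using \<open>c \<in> S\<close> by (auto simp: S_def)
    have "\<xi> i (\<Sum>j<r. c j *\<^sub>R b j) = (\<Sum>j<r. if i = j then c j else 0)"
      unfolding \<xi>_sum[OF finite_lessThan] scale by (intro sum.cong refl) (auto simp: basis i)
    also have "\<dots> = c i" using i by simp
    finally show ?thesis using i zero by auto
  qed
  \<comment> \<open>The sphere is empty for r = 0, where any positive m will do.\<close>
  ultimately obtain m where m: "m > 0" "\<And>c. c \<in> S \<Longrightarrow> m \<le> norm (\<Sum>i<r. c i *\<^sub>R b i)"
  proof (cases "S = {}")
    case True
    then show ?thesis using that[of 1] by simp
  next
    case False
    then obtain c where "c \<in> S" "\<forall>d\<in>S. norm (\<Sum>i<r. c i *\<^sub>R b i) \<le> norm (\<Sum>i<r. d i *\<^sub>R b i)"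
      using continuous_attains_inf[OF \<open>compact S\<close> _ \<open>continuous_on S _\<close>] by blast
    then show ?thesis using that pos by blast
  qed
  have bound: "\<bar>\<xi> i x\<bar> \<le> norm x * (1 / m)" if i: "i < r" for i x
  proof (cases "\<forall>i<r. \<xi> i x = 0")
    case True
    then show ?thesis using i m by simp
  next
    case False
    define M where "M = Max ((\<lambda>i. \<bar>\<xi> i x\<bar>) ` {..<r})"
    have le: "\<bar>\<xi> j x\<bar> \<le> M" if "j < r" for j
      using that by (auto simp: M_def)
    have "M \<in> (\<lambda>i. \<bar>\<xi> i x\<bar>) ` {..<r}" unfolding M_def using i by (intro Max_in) auto
    then obtain k where k: "k < r" "\<bar>\<xi> k x\<bar> = M" by auto
    have Mpos: "M > 0"
    proof -
      obtain j where "j < r" "\<xi> j x \<noteq> 0" using False by blast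
      then show ?thesis using le[of j] by simp
    qed
    define c where "c j = (if j < r then \<xi> j x / M else 0)" for j
    have "\<bar>c j\<bar> \<le> 1" if "j < r" for j using le[OF that] Mpos that by (simp add: c_def)
    then have "c j \<in> (if j < r then {-1..1} else {0})" for j
      by (cases "j < r") (force simp: abs_le_iff, simp add: c_def)
    moreover have "\<bar>c k\<bar> = 1" using k Mpos by (simp add: c_def)
    ultimately have "c \<in> S" using k(1) by (auto simp: S_def)
    moreover have "(\<Sum>i<r. c i *\<^sub>R b i) = (1 / M) *\<^sub>R x"
      using arg_cong[OF sum[of x], of "\<lambda>y. (1 / M) *\<^sub>R y"] by (simp add: c_def scaleR_sum_right)
    ultimately have "m \<le> norm x / M" using m(2)[of c] Mpos by simp
    then have "M \<le> norm x / m" using Mpos m(1) by (simp add: field_simps)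
    then show ?thesis using le[OF i] by simp
  qed
  have "bounded_linear (\<xi> i)" if "i < r" for i
    by (rule bounded_linear_intro[where K = "1 / m"]) (use bound[OF that] in \<open>auto simp: add scale\<close>)
  then have "coordinates r b \<xi>" by (simp add: coordinates_def sum)
  then show ?thesis by blast
qed

text \<open>Expanding the first direction in coordinates reduces the order by one; this makes the
  iterated derivative jointly continuous in the point and the directions.\<close>

lemma iterated_deriv_continuous:
  fixes h :: "'e::real_normed_vector \<Rightarrow> real" and b :: "nat \<Rightarrow> 'e"
  assumes co: "coordinates n b \<xi>" and S: "open S" and h: "smooth_on S h"
  shows "continuous_on (S \<times> UNIV) (\<lambda>(p, v). iterated_deriv (map v [0..<l]) h p)"
  using h
proof (induction l arbitrary: h)
  case 0
  then have "continuous_on (S \<times> (UNIV :: (nat \<Rightarrow> 'e) set)) (\<lambda>z. h (fst z))"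
    using continuous_on_compose2[OF smooth_on_continuous_on continuous_on_fst[OF continuous_on_id], of S h "S \<times> UNIV"] by auto
  then show ?case by (simp add: case_prod_beta)
next
  case (Suc l)
  let ?D = "\<lambda>i x. frechet_derivative h (at x) (b i)"
  have D: "frechet_derivative h (at x) v = (\<Sum>i<n. \<xi> i v * ?D i x)" if "x \<in> S" for x v
  proof -
    interpret L: bounded_linear "frechet_derivative h (at x)"
      using smooth_on_has_derivative[OF Suc.prems that] by (rule has_derivative_bounded_linear)
    have "frechet_derivative h (at x) v = frechet_derivative h (at x) (\<Sum>i<n. \<xi> i v *\<^sub>R b i)"
      using coordinates_sum[OF co] by simp
    then show ?thesis by (simp add: L.sum L.scaleR)
  qed
  have eq: "iterated_deriv (map v [0..<Suc l]) h p =
      (\<Sum>i<n. \<xi> i (v 0) * iterated_deriv (map (\<lambda>j. v (Suc j)) [0..<l]) (?D i) p)" if "p \<in> S" for p v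
  proof -
    have "map v [0..<Suc l] = v 0 # map (\<lambda>j. v (Suc j)) [0..<l]"
      by (subst upt_conv_Cons) (auto simp: map_Suc_upt[symmetric] simp del: upt_Suc)
    then have "iterated_deriv (map v [0..<Suc l]) h p =
        iterated_deriv (map (\<lambda>j. v (Suc j)) [0..<l]) (\<lambda>x. frechet_derivative h (at x) (v 0)) p" by simp
    also have "\<dots> = iterated_deriv (map (\<lambda>j. v (Suc j)) [0..<l]) (\<lambda>x. \<Sum>i<n. \<xi> i (v 0) * ?D i x) p"
      by (rule iterated_deriv_cong[OF S that]) (rule D)
    also have "\<dots> = (\<Sum>i<n. \<xi> i (v 0) * iterated_deriv (map (\<lambda>j. v (Suc j)) [0..<l]) (?D i) p)"
      by (rule iterated_deriv_lincomb[OF S that]) (rule smooth_on_frechet[OF Suc.prems])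
    finally show ?thesis .
  qed
  have sh: "continuous_on (S \<times> UNIV) (\<lambda>z :: 'e \<times> (nat \<Rightarrow> 'e). (fst z, \<lambda>j. snd z (Suc j)))"
    by (intro continuous_on_Pair continuous_on_fst continuous_on_id continuous_on_coordinatewise_then_product
        continuous_on_product_then_coordinatewise[OF continuous_on_snd[OF continuous_on_id]])
  have "continuous_on (S \<times> UNIV) (\<lambda>z. iterated_deriv (map (\<lambda>j. snd z (Suc j)) [0..<l]) (?D i) (fst z))" for i
    using continuous_on_compose2[OF Suc.IH[OF smooth_on_frechet[OF Suc.prems, of "b i"]] sh]
    by (simp add: image_subset_iff)
  moreover have "continuous_on (S \<times> UNIV) (\<lambda>z :: 'e \<times> (nat \<Rightarrow> 'e). \<xi> i (snd z 0))" if "i < n" for i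
    by (rule bounded_linear.continuous_on[OF coordinates_linear[OF co that]])
      (intro continuous_on_product_then_coordinatewise[OF continuous_on_snd[OF continuous_on_id]])
  ultimately have "continuous_on (S \<times> UNIV) (\<lambda>z. \<Sum>i<n. \<xi> i (snd z 0) * iterated_deriv (map (\<lambda>j. snd z (Suc j)) [0..<l]) (?D i) (fst z))"
    by (intro continuous_on_sum continuous_on_mult) auto
  then show ?case
    by (rule continuous_on_eq) (auto simp: eq simp del: upt_Suc)
qed

text \<open>Whitney neighbourhoods are cut out by strict inequalities, one for each point and each
  list of directions. Compactness of K times a power of the unit ball condenses them into one
  inequality for an attained maximum, which leaves a positive margin.\<close>

lemma iterated_deriv_attains_sup:
  fixes h :: "'e::real_normed_vector \<Rightarrow> real" and b :: "nat \<Rightarrow> 'e"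
  assumes co: "coordinates n b \<xi>" and S: "open S" and h: "smooth_on S h"
    and K: "compact K" "K \<subseteq> S" "K \<noteq> {}"
  obtains p vs where "p \<in> K" "length vs = l" "\<forall>v\<in>set vs. norm v \<le> 1"
    and "\<And>p' vs'. p' \<in> K \<Longrightarrow> length vs' = l \<Longrightarrow> \<forall>v\<in>set vs'. norm v \<le> 1 \<Longrightarrow>
      \<bar>iterated_deriv vs' h p'\<bar> \<le> \<bar>iterated_deriv vs h p\<bar>"
proof -
  let ?T = "PiE UNIV (\<lambda>_::nat. cball (0::'e) 1)"
  let ?F = "\<lambda>z. \<bar>(\<lambda>(p, v). iterated_deriv (map v [0..<l]) h p) z\<bar>"
  have "compactin (product_topology (\<lambda>_. euclidean) UNIV) ?T"
    by (subst compactin_PiE) (auto intro: coordinates_compact_cball[OF co])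
  then have "compact ?T" by (simp add: euclidean_product_topology)
  then have "compact (K \<times> ?T)" using K by (intro compact_Times)
  moreover have "continuous_on (K \<times> ?T) ?F"
    by (intro continuous_on_rabs continuous_on_subset[OF iterated_deriv_continuous[OF co S h]]) (use K in auto)
  moreover have "K \<times> ?T \<noteq> {}" using K by (auto simp: PiE_eq_empty_iff)
  ultimately obtain z where z: "z \<in> K \<times> ?T" "\<forall>y\<in>K \<times> ?T. ?F y \<le> ?F z"
    using continuous_attains_sup by meson
  obtain p v where zz: "z = (p, v)" by (cases z)
  show ?thesis
  proof (rule that[of p "map v [0..<l]"])
    fix p' and vs' :: "'e list" assume *: "p' \<in> K" "length vs' = l" "\<forall>v\<in>set vs'. norm v \<le> 1"
    \<comment> \<open>A list of length l is padded by 0, which lies in the unit ball, to become a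
      point of the compact product.\<close>
    let ?v = "\<lambda>j::nat. if j < l then vs' ! j else (0::'e)"
    have "vs' = map ?v [0..<l]" using *(2) by (intro nth_equalityI) auto
    moreover have "(p', ?v) \<in> K \<times> ?T" using * by (auto simp: PiE_iff)
    ultimately show "\<bar>iterated_deriv vs' h p'\<bar> \<le> \<bar>iterated_deriv (map v [0..<l]) h p\<bar>"
      using z(2) zz by (metis (no_types, lifting) case_prod_conv)
  qed (use z zz in \<open>auto simp: PiE_iff\<close>)
qed

subsection \<open>Smooth bump functions\<close>

text \<open>The functions p(1/t) exp(-1/t), extended by 0 to t \<le> 0; the polynomial parameter
  makes the class closed under differentiation.\<close>

definition flat :: "real poly \<Rightarrow> real \<Rightarrow> real" where
  "flat p t = (if t > 0 then poly p (inverse t) * exp (- inverse t) else 0)"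

lemma poly_times_exp_tendsto_0:
  "((\<lambda>s. poly p s * exp (- s)) \<longlongrightarrow> (0::real)) at_top"
proof -
  have "((\<lambda>s. \<Sum>i\<le>degree p. coeff p i * (s ^ i / exp s)) \<longlongrightarrow> (\<Sum>i\<le>degree p. coeff p i * 0)) at_top"
    by (intro tendsto_sum tendsto_mult tendsto_const tendsto_power_div_exp_0)
  moreover have "poly p s * exp (- s) = (\<Sum>i\<le>degree p. coeff p i * (s ^ i / exp s))" for s :: real
    by (simp add: poly_altdef sum_distrib_right exp_minus divide_inverse mult.assoc)
  ultimately show ?thesis by simp
qed

text \<open>With s = 1/t one has ds/dt = -s^2, so p(s) exp(-s) has derivative s^2 (p(s) - p'(s))
  exp(-s). At 0 the right difference quotient is s p(s) exp(-s), which tends to 0 as s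
  grows.\<close>

lemma flat_deriv:
  "(flat p has_real_derivative flat (monom 1 2 * (p - pderiv p)) t) (at t)"
proof -
  consider "t > 0" | "t < 0" | "t = 0" by linarith
  then show ?thesis
  proof cases
    case 1
    have "((\<lambda>t. poly p (inverse t) * exp (- inverse t)) has_real_derivative flat (monom 1 2 * (p - pderiv p)) t) (at t)"
      using 1 by (auto intro!: derivative_eq_intros DERIV_chain2[OF poly_DERIV]
          simp: flat_def poly_monom power2_eq_square algebra_simps)
    then show ?thesis
      by (rule DERIV_cong_ev[THEN iffD1, rotated -1, OF _ refl _ refl])
        (use 1 in \<open>auto simp: flat_def eventually_nhds intro!: exI[of _ "{0<..}"]\<close>)
  next
    case 2
    have "((\<lambda>t. 0) has_real_derivative flat (monom 1 2 * (p - pderiv p)) t) (at t)"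
      using 2 by (auto simp: flat_def)
    then show ?thesis
      by (rule DERIV_cong_ev[THEN iffD1, rotated -1, OF _ refl _ refl])
        (use 2 in \<open>auto simp: flat_def eventually_nhds intro!: exI[of _ "{..<0}"]\<close>)
  next
    case 3
    have "((\<lambda>y. flat p y / y) \<longlongrightarrow> 0) (at_left 0)"
      by (rule tendsto_eventually) (auto simp: flat_def eventually_at_filter)
    moreover have "((\<lambda>y. flat p y / y) \<longlongrightarrow> 0) (at_right 0)"
    proof (rule Lim_transform_eventually)
      show "((\<lambda>y. poly (p * [:0, 1:]) (inverse y) * exp (- inverse y)) \<longlongrightarrow> (0::real)) (at_right 0)"
        by (rule filterlim_compose[OF poly_times_exp_tendsto_0 filterlim_inverse_at_top_right])
      show "\<forall>\<^sub>F y in at_right 0. poly (p * [:0, 1:]) (inverse y) * exp (- inverse y) = flat p y / y"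
        by (auto simp: flat_def eventually_at_filter field_simps)
    qed
    ultimately have "((\<lambda>y. flat p y / y) \<longlongrightarrow> 0) (at 0)" by (simp add: filterlim_split_at)
    then show ?thesis using 3 by (simp add: has_field_derivative_iff flat_def)
  qed
qed

text \<open>Each differentiation changes the polynomial, so the induction on the order runs over all
  p at once.\<close>

lemma ck_on_flat:
  assumes "open S"
  shows "ck_on k S h \<Longrightarrow> ck_on k S (\<lambda>x. flat p (h x))"
proof (induction k arbitrary: p)
  case 0
  have "continuous_on UNIV (flat p)"
    using flat_deriv by (intro continuous_at_imp_continuous_on ballI) (rule DERIV_isCont)
  then show ?case using 0 by (auto intro: continuous_on_compose2)
next
  case (Suc k)
  let ?q = "monom 1 2 * (p - pderiv p)"
  have ck: "ck_on k S (\<lambda>x. frechet_derivative h (at x) v * flat ?q (h x))" for v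
    using Suc.prems by (intro ck_on_mult assms Suc.IH ck_on_Suc_imp[OF Suc.prems]) auto
  show ?case
    by (rule ck_on_SucI[OF assms _ ck])
      (rule DERIV_compose_FDERIV[OF flat_deriv ck_on_has_derivative[OF Suc.prems]])
qed

text \<open>A cutoff f / (f + g), where f is positive exactly on |s| < 2 and g exactly on |s| > 1,
  so that they never vanish together. Squares replace absolute values to keep the arguments smooth
  at 0.\<close>

definition plateau :: "real \<Rightarrow> real" where
  "plateau s = flat 1 (4 - s * s) * inverse (flat 1 (4 - s * s) + flat 1 (s * s - 1))"

lemma flat_1_pos: "flat 1 t \<ge> 0" "t > 0 \<Longrightarrow> flat 1 t > 0" "t \<le> 0 \<Longrightarrow> flat 1 t = 0"
  by (auto simp: flat_def)

lemma plateau_denominator: "flat 1 (4 - s * s) + flat 1 (s * s - 1) > 0"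
proof (cases "s * s < 4")
  case True
  then show ?thesis using flat_1_pos(1)[of "s * s - 1"] flat_1_pos(2)[of "4 - s * s"] by linarith
next
  case False
  then show ?thesis using flat_1_pos(2)[of "s * s - 1"] flat_1_pos(1)[of "4 - s * s"] by linarith
qed

lemma plateau_1: "\<bar>s\<bar> \<le> 1 \<Longrightarrow> plateau s = 1"
proof -
  assume "\<bar>s\<bar> \<le> 1"
  then have "s * s \<le> 1" by (metis abs_square_le_1 power2_eq_square)
  then show ?thesis using plateau_denominator[of s] flat_1_pos(3)[of "s * s - 1"] by (simp add: plateau_def)
qed

lemma plateau_0: "\<bar>s\<bar> \<ge> 2 \<Longrightarrow> plateau s = 0"
proof -
  assume "\<bar>s\<bar> \<ge> 2"
  then have "2\<^sup>2 \<le> \<bar>s\<bar>\<^sup>2" by (intro power_mono) auto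
  then have "s * s \<ge> 4" by (simp add: power2_eq_square)
  then show ?thesis using flat_1_pos(3)[of "4 - s * s"] by (simp add: plateau_def)
qed

lemma ck_on_plateau:
  assumes "open S" "ck_on k S h"
  shows "ck_on k S (\<lambda>x. plateau (h x))"
proof -
  have "ck_on k S (\<lambda>x. 4 + (-1) * (h x * h x))" "ck_on k S (\<lambda>x. h x * h x + (-1))"
    by (intro ck_on_add ck_on_mult ck_on_const assms)+
  then have "ck_on k S (\<lambda>x. flat 1 (4 - h x * h x))" "ck_on k S (\<lambda>x. flat 1 (h x * h x - 1))"
    using ck_on_flat[OF assms(1), of k _ 1] by fastforce+
  then show ?thesis
    unfolding plateau_def using plateau_denominator assms
    by (intro ck_on_mult ck_on_inverse ck_on_add) (auto simp: less_imp_neq[symmetric])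
qed

text \<open>Boxes rather than balls: an arbitrary norm need not be smooth, whereas a product of
  cutoffs of linear coordinates is.\<close>

definition cube :: "nat \<Rightarrow> (nat \<Rightarrow> 'e::real_normed_vector \<Rightarrow> real) \<Rightarrow> 'e \<Rightarrow> real \<Rightarrow> 'e set" where
  "cube n \<xi> a d = {x. \<forall>i<n. \<bar>\<xi> i (x - a)\<bar> \<le> d}"

definition cube_plateau :: "nat \<Rightarrow> (nat \<Rightarrow> 'e::real_normed_vector \<Rightarrow> real) \<Rightarrow> 'e \<Rightarrow> real \<Rightarrow> 'e \<Rightarrow> real" where
  "cube_plateau n \<xi> a d x = (\<Prod>i<n. plateau (\<xi> i (x - a) / d))"

lemma cube_plateau_1: "d > 0 \<Longrightarrow> x \<in> cube n \<xi> a d \<Longrightarrow> cube_plateau n \<xi> a d x = 1"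
  unfolding cube_plateau_def by (rule prod.neutral) (auto simp: cube_def plateau_1)

lemma cube_plateau_0:
  assumes "d > 0" "x \<notin> cube n \<xi> a (2 * d)"
  shows "cube_plateau n \<xi> a d x = 0"
proof -
  obtain i where "i < n" "\<not> \<bar>\<xi> i (x - a)\<bar> \<le> 2 * d" using assms(2) by (auto simp: cube_def)
  moreover from this have "2 \<le> \<bar>\<xi> i (x - a) / d\<bar>"
    using assms(1) by (simp add: field_simps)
  then have "plateau (\<xi> i (x - a) / d) = 0" by (rule plateau_0)
  ultimately show ?thesis
    unfolding cube_plateau_def by (intro prod_zero) auto
qed

lemma ck_on_cube_plateau:
  assumes co: "coordinates n b \<xi>" and "open S" "ck_on k S f"
  shows "ck_on k S (\<lambda>x. cube_plateau n \<xi> a d (f x))"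
proof -
  have shift: "ck_on k S (\<lambda>x. f x + (- a))" by (intro ck_on_add ck_on_const assms)
  have "ck_on k S (\<lambda>x. plateau (inverse d * \<xi> i (f x + (- a))))" if "i < n" for i
    by (rule ck_on_plateau[OF assms(2) ck_on_mult[OF assms(2) ck_on_const
          ck_on_linear[OF coordinates_linear[OF co that] assms(2) shift]]])
  then have "ck_on k S (\<lambda>x. \<Prod>i<n. plateau (inverse d * \<xi> i (f x + (- a))))"
    by (intro ck_on_prod assms(2)) simp
  then show ?thesis by (simp add: cube_plateau_def divide_inverse mult.commute)
qed

subsection \<open>Charts and smooth functions\<close>

lemma is_chartD:
  assumes "is_chart c"
  shows "open (fst c)" "open (snd c ` fst c)" "continuous_on (fst c) (snd c)"
    "continuous_on (snd c ` fst c) (inv_into (fst c) (snd c))"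
    "x \<in> fst c \<Longrightarrow> inv_into (fst c) (snd c) (snd c x) = x"
    "inj_on (snd c) (fst c)"
proof -
  obtain D \<phi> where c: "c = (D, \<phi>)" by (cases c)
  have h: "homeomorphism D (\<phi> ` D) \<phi> (inv_into D \<phi>)" and o: "open D" "open (\<phi> ` D)"
    using assms by (auto simp: is_chart_def c)
  show "open (fst c)" "open (snd c ` fst c)" "continuous_on (fst c) (snd c)"
    "continuous_on (snd c ` fst c) (inv_into (fst c) (snd c))"
    using h o by (auto simp: c homeomorphism_def)
  have i: "inv_into D \<phi> (\<phi> y) = y" if "y \<in> D" for y using h that by (auto simp: homeomorphism_def)
  then show "x \<in> fst c \<Longrightarrow> inv_into (fst c) (snd c) (snd c x) = x" by (auto simp: c)
  show "inj_on (snd c) (fst c)" unfolding c using i by (metis fst_conv snd_conv inj_onI)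
qed

lemma in_chart_eq: "in_chart c f = f \<circ> inv_into (fst c) (snd c)"
  by (cases c) (simp add: in_chart_def)

lemma in_chart_apply: "is_chart c \<Longrightarrow> x \<in> fst c \<Longrightarrow> in_chart c f (snd c x) = f x"
  by (simp add: in_chart_eq is_chartD(5))

lemma chart_image_open:
  assumes "is_chart c" "open W" "W \<subseteq> fst c"
  shows "open (snd c ` W)"
proof -
  let ?g = "inv_into (fst c) (snd c)"
  have "snd c ` W = snd c ` fst c \<inter> ?g -` W"
    using assms is_chartD(5)[OF assms(1)] by force
  then show ?thesis
    using continuous_on_open_vimage[OF is_chartD(2)[OF assms(1)], THEN iffD1, OF is_chartD(4)[OF assms(1)]] assms(2)
    by (metis Int_commute)
qed

lemma chart_preimage_open:
  assumes "is_chart c" "open V"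
  shows "open {x \<in> fst c. snd c x \<in> V}"
proof -
  have "open (snd c -` V \<inter> fst c)"
    using continuous_on_open_vimage[OF is_chartD(1)[OF assms(1)]] is_chartD(3)[OF assms(1)] assms(2) by blast
  moreover have "snd c -` V \<inter> fst c = {x \<in> fst c. snd c x \<in> V}" by auto
  ultimately show ?thesis by simp
qed

lemma max_atlas_is_chart: "c \<in> max_atlas A \<Longrightarrow> is_chart c"
  by (simp add: max_atlas_def)

lemma atlas_subset_max_atlas: "smooth_atlas A \<Longrightarrow> A \<subseteq> max_atlas A"
  by (auto simp: smooth_atlas_def max_atlas_def)

lemma atlas_covers: "smooth_atlas A \<Longrightarrow> \<exists>c\<in>A. x \<in> fst c"
  by (auto simp: smooth_atlas_def)

section \<open>Product charts and the product atlas\<close>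

lemma prod_chart:
  assumes c: "is_chart c" and d: "is_chart d"
  defines "e \<equiv> (fst c \<times> fst d, map_prod (snd c) (snd d))"
  shows "is_chart e"
    and "z \<in> snd c ` fst c \<times> snd d ` fst d \<Longrightarrow> inv_into (fst e) (snd e) z =
      (inv_into (fst c) (snd c) (fst z), inv_into (fst d) (snd d) (snd z))"
proof -
  let ?gc = "inv_into (fst c) (snd c)" and ?gd = "inv_into (fst d) (snd d)"
  have im: "snd e ` fst e = snd c ` fst c \<times> snd d ` fst d"
    by (auto simp: e_def map_prod_surj_on image_iff)
  have inj: "inj_on (snd e) (fst e)"
    using is_chartD(6)[OF c] is_chartD(6)[OF d] by (simp add: e_def map_prod_inj_on)
  have inv: "inv_into (fst e) (snd e) z = (?gc (fst z), ?gd (snd z))"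
    if z: "z \<in> snd c ` fst c \<times> snd d ` fst d" for z
  proof -
    obtain x y where xy: "x \<in> fst c" "y \<in> fst d" "z = (snd c x, snd d y)" using z by auto
    then have "inv_into (fst e) (snd e) (snd e (x, y)) = (x, y)"
      by (intro inv_into_f_f inj) (simp add: e_def)
    then show ?thesis using xy is_chartD(5)[OF c] is_chartD(5)[OF d] by (simp add: e_def)
  qed
  show "z \<in> snd c ` fst c \<times> snd d ` fst d \<Longrightarrow> inv_into (fst e) (snd e) z = (?gc (fst z), ?gd (snd z))"
    by (rule inv)
  have "continuous_on (fst c \<times> fst d) (\<lambda>z. snd c (fst z))" "continuous_on (fst c \<times> fst d) (\<lambda>z. snd d (snd z))"
    using continuous_on_compose2[OF is_chartD(3)[OF c] continuous_on_fst[OF continuous_on_id], of "fst c \<times> fst d"]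
      continuous_on_compose2[OF is_chartD(3)[OF d] continuous_on_snd[OF continuous_on_id], of "fst c \<times> fst d"] by auto
  then have "continuous_on (fst c \<times> fst d) (\<lambda>z. (snd c (fst z), snd d (snd z)))" by (rule continuous_on_Pair)
  then have cont: "continuous_on (fst e) (snd e)" by (simp add: e_def map_prod_def case_prod_beta)
  let ?R = "snd c ` fst c \<times> snd d ` fst d"
  have "continuous_on ?R (\<lambda>z. ?gc (fst z))" "continuous_on ?R (\<lambda>z. ?gd (snd z))"
    using continuous_on_compose2[OF is_chartD(4)[OF c] continuous_on_fst[OF continuous_on_id], of ?R]
      continuous_on_compose2[OF is_chartD(4)[OF d] continuous_on_snd[OF continuous_on_id], of ?R] by auto
  then have "continuous_on ?R (\<lambda>z. (?gc (fst z), ?gd (snd z)))" by (rule continuous_on_Pair)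
  then have cont': "continuous_on (snd e ` fst e) (inv_into (fst e) (snd e))"
    unfolding im by (rule continuous_on_eq) (simp add: inv)
  have "inv_into (fst e) (snd e) ` (snd e ` fst e) = fst e"
    by (rule inv_into_image_cancel[OF inj order_refl])
  then have "homeomorphism (fst e) (snd e ` fst e) (snd e) (inv_into (fst e) (snd e))"
    using cont cont' inj by (auto simp: homeomorphism_def f_inv_into_f)
  moreover have "open (fst e)" using is_chartD(1)[OF c] is_chartD(1)[OF d] by (simp add: e_def open_Times)
  moreover have "open (snd e ` fst e)" unfolding im using is_chartD(2)[OF c] is_chartD(2)[OF d] by (rule open_Times)
  ultimately show "is_chart e" by (cases e) (simp add: is_chart_def)
qed

lemma smooth_transition_prod:
  assumes c: "is_chart c" "is_chart c'" and d: "is_chart d" "is_chart d'"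
    and t: "smooth_transition c c'" "smooth_transition d d'"
  shows "smooth_transition (fst c \<times> fst d, map_prod (snd c) (snd d)) (fst c' \<times> fst d', map_prod (snd c') (snd d'))"
    (is "smooth_transition ?e ?e'")
proof -
  let ?S = "snd c ` (fst c \<inter> fst c')" and ?T = "snd d ` (fst d \<inter> fst d')"
  have im: "snd ?e ` (fst ?e \<inter> fst ?e') = ?S \<times> ?T"
    by (auto simp: image_iff)
  have o: "open ?S" "open ?T"
    by (intro chart_image_open c d open_Int is_chartD(1) Int_lower1)+
  have "ck_on k (?S \<times> ?T) (map_prod (in_chart c (snd c')) (in_chart d (snd d')))" for k
    using t by (intro ck_on_map_prod o) (simp_all add: smooth_transition_def smooth_on_def)
  moreover have "map_prod (in_chart c (snd c')) (in_chart d (snd d')) z = in_chart ?e (snd ?e') z" if "z \<in> ?S \<times> ?T" for z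
    using prod_chart(2)[OF c(1) d(1), of z] that by (auto simp: in_chart_eq)
  ultimately have "ck_on k (?S \<times> ?T) (in_chart ?e (snd ?e'))" for k
    using ck_on_cong[OF open_Times[OF o]] by blast
  then show ?thesis unfolding smooth_transition_def im smooth_on_def by blast
qed

lemma prod_atlasI:
  "c \<in> A \<Longrightarrow> d \<in> B \<Longrightarrow> (fst c \<times> fst d, map_prod (snd c) (snd d)) \<in> prod_atlas A B"
  by (cases c; cases d) (auto simp: prod_atlas_def)

lemma prod_atlasE:
  assumes "e \<in> prod_atlas A B"
  obtains c d where "c \<in> A" "d \<in> B" "e = (fst c \<times> fst d, map_prod (snd c) (snd d))"
  using assms by (fastforce simp: prod_atlas_def)

lemma smooth_atlas_prod:
  assumes "smooth_atlas A" "smooth_atlas B"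
  shows "smooth_atlas (prod_atlas A B)"
proof -
  have ch: "is_chart c" if "c \<in> A" for c using assms(1) that by (simp add: smooth_atlas_def)
  have dh: "is_chart d" if "d \<in> B" for d using assms(2) that by (simp add: smooth_atlas_def)
  have "is_chart e" if "e \<in> prod_atlas A B" for e
    using that ch dh by (auto elim!: prod_atlasE intro!: prod_chart(1))
  moreover have "smooth_transition e e'" if "e \<in> prod_atlas A B" "e' \<in> prod_atlas A B" for e e'
    using that ch dh assms by (elim prod_atlasE) (auto simp: smooth_atlas_def intro!: smooth_transition_prod)
  moreover have "\<exists>e\<in>prod_atlas A B. z \<in> fst e" for z
  proof -
    obtain c d where "c \<in> A" "fst z \<in> fst c" "d \<in> B" "snd z \<in> fst d"
      using atlas_covers[OF assms(1)] atlas_covers[OF assms(2)] by metis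
    then show ?thesis
      by (intro bexI[OF _ prod_atlasI[of c A d B]]) (auto simp: mem_Times_iff)
  qed
  ultimately show ?thesis unfolding smooth_atlas_def by auto
qed

lemma smooth_function_in_chart:
  "f \<in> smooth_functions A \<Longrightarrow> c \<in> max_atlas A \<Longrightarrow> smooth_on (snd c ` fst c) (in_chart c f)"
  by (simp add: smooth_functions_def)

lemma smooth_function_continuous:
  fixes A :: "('x::t2_space, 'e::real_normed_vector) chart set"
  assumes "smooth_atlas A" "f \<in> smooth_functions A"
  shows "continuous_on UNIV f"
  unfolding continuous_on_eq_continuous_at[OF open_UNIV]
proof
  fix x
  obtain c where c: "c \<in> A" "x \<in> fst c" using atlas_covers[OF assms(1)] by blast
  have ch: "is_chart c" and m: "c \<in> max_atlas A"
    using assms(1) c(1) atlas_subset_max_atlas[OF assms(1)] by (auto simp: smooth_atlas_def)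
  have "continuous_on (fst c) (\<lambda>y. in_chart c f (snd c y))"
    using smooth_on_continuous_on[OF smooth_function_in_chart[OF assms(2) m]] is_chartD(3)[OF ch]
    by (rule continuous_on_compose2) simp
  then have "continuous_on (fst c) f"
    by (rule continuous_on_eq) (simp add: in_chart_apply[OF ch])
  then show "isCont f x" using continuous_on_eq_continuous_at is_chartD(1)[OF ch] c(2) by blast
qed

lemma smooth_functions_lincomb:
  assumes "smooth_atlas A" "f \<in> smooth_functions A" "\<And>j. j \<in> J \<Longrightarrow> g j \<in> smooth_functions A"
  shows "(\<lambda>p. f p + (\<Sum>j\<in>J. t j * g j p)) \<in> smooth_functions A"
  unfolding smooth_functions_def
proof (intro CollectI ballI)
  fix c assume c: "c \<in> max_atlas A"
  have o: "open (snd c ` fst c)" using is_chartD(2)[OF max_atlas_is_chart[OF c]] .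
  have "in_chart c (\<lambda>p. f p + (\<Sum>j\<in>J. t j * g j p)) =
      (\<lambda>y. in_chart c f y + (\<Sum>j\<in>J. t j * in_chart c (g j) y))"
    by (auto simp: in_chart_eq)
  then show "smooth_on (snd c ` fst c) (in_chart c (\<lambda>p. f p + (\<Sum>j\<in>J. t j * g j p)))"
    using smooth_function_in_chart[OF assms(2) c] smooth_function_in_chart[OF assms(3) c] o
    by (auto simp: smooth_on_def intro!: ck_on_add ck_on_sum ck_on_mult ck_on_const)
qed

section \<open>Bump functions on a manifold\<close>

definition core where
  "core c n \<xi> a d = {x \<in> fst c. snd c x \<in> cube n \<xi> a d}"

definition bump where
  "bump c n \<xi> a d x = (if x \<in> fst c then cube_plateau n \<xi> a d (snd c x) else 0)"

lemma bump_1: "d > 0 \<Longrightarrow> x \<in> core c n \<xi> a d \<Longrightarrow> bump c n \<xi> a d x = 1"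
  by (simp add: bump_def core_def cube_plateau_1)

lemma bump_0: "d > 0 \<Longrightarrow> x \<notin> core c n \<xi> a (2 * d) \<Longrightarrow> bump c n \<xi> a d x = 0"
  by (auto simp: bump_def core_def cube_plateau_0)

lemma cube_mono: "d \<le> d' \<Longrightarrow> cube n \<xi> a d \<subseteq> cube n \<xi> a d'"
  by (auto simp: cube_def)

lemma core_mono: "d \<le> d' \<Longrightarrow> core c n \<xi> a d \<subseteq> core c n \<xi> a d'"
  using cube_mono[of d d' n \<xi> a] by (auto simp: core_def)

lemma core_compact:
  assumes "is_chart c" "coordinates n b \<xi>" "cube n \<xi> a d \<subseteq> snd c ` fst c"
  shows "compact (core c n \<xi> a d)" "core c n \<xi> a d \<subseteq> fst c" "snd c ` core c n \<xi> a d = cube n \<xi> a d"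
proof -
  let ?g = "inv_into (fst c) (snd c)"
  show im: "snd c ` core c n \<xi> a d = cube n \<xi> a d" using assms(3) by (auto simp: core_def)
  have "compact (?g ` cube n \<xi> a d)"
    using coordinates_cube_compact[OF assms(2)] continuous_on_subset[OF is_chartD(4)[OF assms(1)] assms(3)]
    by (intro compact_continuous_image) (auto simp: cube_def)
  moreover have "?g ` cube n \<xi> a d = core c n \<xi> a d"
    unfolding im[symmetric] image_image
    using is_chartD(5)[OF assms(1)] by (auto simp: core_def image_iff)
  ultimately show "compact (core c n \<xi> a d)" by simp
qed (auto simp: core_def)

text \<open>Three nested sets around x: the open N, from which countable covers are extracted, the
  middle one, where the bump is 1, and the doubled one, outside which the bump is 0 and which must
  stay inside V.\<close>

lemma core_exists:
  assumes "smooth_atlas A" "coordinates n b \<xi>" "open V" "x \<in> V"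
  obtains c a d N where "c \<in> A" "d > 0" "cube n \<xi> a (2 * d) \<subseteq> snd c ` fst c" "core c n \<xi> a (2 * d) \<subseteq> V"
    "open N" "x \<in> N" "N \<subseteq> core c n \<xi> a d"
proof -
  obtain c where c: "c \<in> A" "x \<in> fst c" using atlas_covers[OF assms(1)] by blast
  have ch: "is_chart c" using assms(1) c(1) by (auto simp: smooth_atlas_def)
  let ?a = "snd c x"
  have "open (snd c ` (fst c \<inter> V))"
    by (intro chart_image_open ch open_Int is_chartD(1) assms) auto
  then obtain e where e: "e > 0" "ball ?a e \<subseteq> snd c ` (fst c \<inter> V)"
    using c assms(4) by (meson IntI image_eqI openE)
  obtain d where d: "d > 0" "{y. \<forall>i<n. \<bar>\<xi> i (y - ?a)\<bar> \<le> d} \<subseteq> ball ?a e"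
    using coordinates_cube_small[OF assms(2) e(1)] by blast
  \<comment> \<open>Halving the radius makes the doubled box the one that fits into the
    chart.\<close>
  then have cu: "cube n \<xi> ?a (2 * (d / 2)) \<subseteq> snd c ` (fst c \<inter> V)" using e by (simp add: cube_def)
  have op: "open {y. \<bar>\<xi> i (y - ?a)\<bar> < d / 2}" if "i < n" for i
  proof -
    have "continuous_on UNIV (\<lambda>x. \<xi> i (x - ?a))"
      by (rule bounded_linear.continuous_on[OF coordinates_linear[OF assms(2) that]]) (intro continuous_intros)
    then show ?thesis
      by (intro open_Collect_less continuous_on_rabs continuous_on_const)
  qed
  \<comment> \<open>Strict inequalities give an open set; the box itself is closed.\<close>
  let ?N = "{z \<in> fst c. snd c z \<in> (\<Inter>i\<in>{..<n}. {y. \<bar>\<xi> i (y - ?a)\<bar> < d / 2})}"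
  have "open (\<Inter>i\<in>{..<n}. {y. \<bar>\<xi> i (y - ?a)\<bar> < d / 2})"
    using op by auto
  then have o: "open ?N"
    by (rule chart_preimage_open[OF ch])
  have zero: "\<xi> i 0 = 0" if "i < n" for i
    using coordinates_linear[OF assms(2) that] by (rule linear_simps)
  show ?thesis
  proof (rule that[OF c(1) _ _ _ o])
    show "0 < d / 2" using d by simp
    show "cube n \<xi> ?a (2 * (d / 2)) \<subseteq> snd c ` fst c" using cu by blast
    show "core c n \<xi> ?a (2 * (d / 2)) \<subseteq> V"
    proof
      fix z assume "z \<in> core c n \<xi> ?a (2 * (d / 2))"
      then have z: "z \<in> fst c" "snd c z \<in> snd c ` (fst c \<inter> V)" using cu by (auto simp: core_def)
      then obtain w where "w \<in> fst c" "w \<in> V" "snd c z = snd c w" by auto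
      then show "z \<in> V" using inj_onD[OF is_chartD(6)[OF ch], of z w] z by auto
    qed
    show "x \<in> ?N"
      using c d zero by simp
    show "?N \<subseteq> core c n \<xi> ?a (d / 2)"
      by (auto simp: core_def cube_def less_imp_le)
  qed
qed

text \<open>Where a chart \<eta> of the maximal atlas meets the product chart, the function is an
  explicit smooth formula composed with the transition. The remaining points lie off the compact set
  \<open>?C\<close>, which is closed by the Hausdorff property, and there the function is locally
  0.\<close>

lemma bump_prod_smooth:
  fixes A :: "('x::t2_space, 'e::real_normed_vector) chart set"
    and B :: "('u::t2_space, 'f::real_normed_vector) chart set"
  assumes A: "smooth_atlas A" and B: "smooth_atlas B" and c: "c \<in> A" and e: "e \<in> B"
    and co: "coordinates n b \<xi>" "coordinates m b' \<zeta>" and d: "d > 0" "d' > 0"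
    and cu: "cube n \<xi> a (2 * d) \<subseteq> snd c ` fst c" "cube m \<zeta> a' (2 * d') \<subseteq> snd e ` fst e"
  shows "(\<lambda>(x, u). bump c n \<xi> a d x * bump e m \<zeta> a' d' u) \<in> smooth_functions (prod_atlas A B)"
    (is "?f \<in> _")
  unfolding smooth_functions_def smooth_on_def
proof (intro CollectI ballI allI)
  fix \<eta> :: "('x \<times> 'u, 'e \<times> 'f) chart" and k
  assume \<eta>: "\<eta> \<in> max_atlas (prod_atlas A B)"
  have ch: "is_chart \<eta>" using \<eta> by (rule max_atlas_is_chart)
  have chc: "is_chart c" "is_chart e" using A B c e by (auto simp: smooth_atlas_def)
  let ?ce = "(fst c \<times> fst e, map_prod (snd c) (snd e))"
  let ?C = "core c n \<xi> a (2 * d) \<times> core e m \<zeta> a' (2 * d')"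
  have C: "compact ?C"
    by (intro compact_Times core_compact(1)[OF chc(1) co(1) cu(1)] core_compact(1)[OF chc(2) co(2) cu(2)])
  have tr: "smooth_transition \<eta> ?ce"
    using \<eta> prod_atlasI[OF c e] by (auto simp: max_atlas_def)
  show "ck_on k (snd \<eta> ` fst \<eta>) (in_chart \<eta> ?f)"
  proof (rule ck_on_local)
    fix y assume "y \<in> snd \<eta> ` fst \<eta>"
    then obtain p where p: "p \<in> fst \<eta>" "y = snd \<eta> p" by auto
    show "\<exists>T. open T \<and> y \<in> T \<and> ck_on k T (in_chart \<eta> ?f)"
    proof (cases "p \<in> fst ?ce")
      case True
      let ?T = "snd \<eta> ` (fst \<eta> \<inter> fst ?ce)"
      let ?\<tau> = "in_chart \<eta> (snd ?ce)"
      have o: "open ?T"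
        using is_chartD(1)[OF prod_chart(1)[OF chc]] is_chartD(1)[OF ch]
        by (intro chart_image_open[OF ch] open_Int) auto
      have "ck_on k ?T ?\<tau>" using tr by (simp add: smooth_transition_def smooth_on_def)
      then have fs: "ck_on k ?T (\<lambda>z. fst (?\<tau> z))" "ck_on k ?T (\<lambda>z. snd (?\<tau> z))"
        by (rule ck_on_linear[OF bounded_linear_fst o], rule ck_on_linear[OF bounded_linear_snd o])
      have cks: "ck_on k ?T (\<lambda>z. cube_plateau n \<xi> a d (fst (?\<tau> z)) * cube_plateau m \<zeta> a' d' (snd (?\<tau> z)))"
        by (rule ck_on_mult[OF o ck_on_cube_plateau[OF co(1) o fs(1)] ck_on_cube_plateau[OF co(2) o fs(2)]])
      have eqs: "cube_plateau n \<xi> a d (fst (?\<tau> z)) * cube_plateau m \<zeta> a' d' (snd (?\<tau> z)) = in_chart \<eta> ?f z"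
        if z: "z \<in> ?T" for z
      proof -
        obtain q where q: "q \<in> fst \<eta>" "q \<in> fst ?ce" "z = snd \<eta> q" using z by blast
        obtain x u where xu: "q = (x, u)" by (cases q)
        have "?\<tau> z = (snd c x, snd e u)" "in_chart \<eta> ?f z = ?f (x, u)"
          unfolding q(3) in_chart_apply[OF ch q(1)] by (simp_all add: xu)
        then show ?thesis using q(2) xu by (simp add: bump_def)
      qed
      have "ck_on k ?T (in_chart \<eta> ?f)" by (rule iffD1[OF ck_on_cong[OF o eqs] cks])
      moreover have "y \<in> ?T" using p True by blast
      ultimately show ?thesis using o by blast
    next
      case False
      let ?T = "snd \<eta> ` (fst \<eta> - ?C)"
      have o: "open ?T"
        by (rule chart_image_open[OF ch]) (auto intro!: open_Diff is_chartD(1) ch compact_imp_closed C)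
      have eqs: "in_chart \<eta> ?f z = 0" if z: "z \<in> ?T" for z
      proof -
        obtain x u where q: "(x, u) \<in> fst \<eta>" "(x, u) \<notin> ?C" "z = snd \<eta> (x, u)" using z by auto
        then have "bump c n \<xi> a d x * bump e m \<zeta> a' d' u = 0"
          using bump_0[OF d(1), of x c n \<xi> a] bump_0[OF d(2), of u e m \<zeta> a'] by auto
        then show ?thesis using in_chart_apply[OF ch q(1), of ?f] q(3) by simp
      qed
      have "ck_on k ?T (in_chart \<eta> ?f)"
        by (rule iffD2[OF ck_on_cong[OF o eqs] ck_on_const])
      moreover have "y \<in> ?T" using p False by (auto simp: core_def)
      ultimately show ?thesis using o by blast
    qed
  qed
qed

subsection \<open>Perturbations in the Whitney topology\<close>

lemma iterated_deriv_add_lincomb: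
  fixes F :: "'a::real_normed_vector \<Rightarrow> real" and G :: "'j \<Rightarrow> 'a \<Rightarrow> real"
  assumes "open S" "x \<in> S" "smooth_on S F" "\<And>j. j \<in> J \<Longrightarrow> smooth_on S (G j)" "finite J"
  shows "iterated_deriv vs (\<lambda>y. F y + (\<Sum>j\<in>J. t j * G j y)) x =
    iterated_deriv vs F x + (\<Sum>j\<in>J. t j * iterated_deriv vs (G j) x)"
proof -
  \<comment> \<open>The unperturbed function becomes the extra index \<open>None\<close> with
    coefficient 1, so that \<open>iterated_deriv_lincomb\<close> applies.\<close>
  let ?H = "case_option F G" and ?c = "case_option 1 t" and ?I = "insert None (Some ` J)"
  have split: "(\<Sum>i\<in>?I. Q i) = Q None + (\<Sum>j\<in>J. Q (Some j))" for Q :: "'j option \<Rightarrow> real"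
    using assms(5) by (subst sum.insert) (auto simp: sum.reindex)
  have "iterated_deriv vs (\<lambda>y. \<Sum>i\<in>?I. ?c i * ?H i y) x = (\<Sum>i\<in>?I. ?c i * iterated_deriv vs (?H i) x)"
    by (rule iterated_deriv_lincomb[OF assms(1,2)]) (use assms in \<open>auto\<close>)
  then show ?thesis by (simp only: split option.case mult_1)
qed

text \<open>H is the centre of a Whitney neighbourhood and F a point in it. The maximum \<mu> of the
  difference on K is attained, hence below \<epsilon>, and the slack \<epsilon> - \<mu> is shared
  among the perturbations, whose derivatives of order l are bounded on K.\<close>

lemma perturbation_in_chart:
  fixes F H :: "'e::real_normed_vector \<Rightarrow> real" and G :: "'j \<Rightarrow> 'e \<Rightarrow> real" and b :: "nat \<Rightarrow> 'e"
  assumes co: "coordinates n b \<xi>" and S: "open S" and sm: "smooth_on S H" "smooth_on S F" "\<And>j. j \<in> J \<Longrightarrow> smooth_on S (G j)"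
    and J: "finite J" and K: "compact K" "K \<subseteq> S"
    and less: "\<And>p vs. p \<in> K \<Longrightarrow> length vs = l \<Longrightarrow> \<forall>v\<in>set vs. norm v \<le> 1 \<Longrightarrow>
      \<bar>iterated_deriv vs H p - iterated_deriv vs F p\<bar> < \<epsilon>"
  shows "\<exists>\<delta>>0. \<forall>t. (\<forall>j\<in>J. \<bar>t j\<bar> < \<delta>) \<longrightarrow> (\<forall>p\<in>K. \<forall>vs. length vs = l \<and> (\<forall>v\<in>set vs. norm v \<le> 1) \<longrightarrow>
      \<bar>iterated_deriv vs H p - iterated_deriv vs (\<lambda>y. F y + (\<Sum>j\<in>J. t j * G j y)) p\<bar> < \<epsilon>)"
proof (cases "K = {}")
  case True
  then show ?thesis by (auto intro: exI[of _ 1])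
next
  case False
  \<comment> \<open>H - F is written as a sum with the single coefficient -1, the shape whose
    derivatives \<open>iterated_deriv_add_lincomb\<close> computes.\<close>
  define E where "E = (\<lambda>y. H y + (\<Sum>j\<in>{()}. (-1) * F y))"
  have E: "iterated_deriv vs E p = iterated_deriv vs H p - iterated_deriv vs F p" if "p \<in> S" for vs p
    unfolding E_def using iterated_deriv_add_lincomb[OF S that sm(1), of "{()}" "\<lambda>_. F" vs "\<lambda>_. -1"] sm(2) by simp
  have "smooth_on S E"
    unfolding E_def smooth_on_def
    by (intro allI ck_on_add ck_on_sum ck_on_mult ck_on_const S) (use sm in \<open>auto simp: smooth_on_def\<close>)
  then obtain p0 vs0 where
    p0: "p0 \<in> K" "length vs0 = l" "\<forall>v\<in>set vs0. norm v \<le> 1" and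
    sup: "\<And>p' vs'. p' \<in> K \<Longrightarrow> length vs' = l \<Longrightarrow> \<forall>v\<in>set vs'. norm v \<le> 1 \<Longrightarrow>
      \<bar>iterated_deriv vs' E p'\<bar> \<le> \<bar>iterated_deriv vs0 E p0\<bar>"
    by (rule iterated_deriv_attains_sup[OF co S _ K False, where l = l]) blast
  define \<mu> where "\<mu> = \<bar>iterated_deriv vs0 E p0\<bar>"
  have \<mu>: "\<mu> < \<epsilon>" using less[OF p0] E[of p0 vs0] p0(1) K(2) by (auto simp: \<mu>_def)
  have "\<exists>M. \<forall>p' vs'. p' \<in> K \<longrightarrow> length vs' = l \<longrightarrow> (\<forall>v\<in>set vs'. norm v \<le> 1) \<longrightarrow> \<bar>iterated_deriv vs' (G j) p'\<bar> \<le> M"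
    if "j \<in> J" for j
    by (rule iterated_deriv_attains_sup[OF co S sm(3)[OF that] K False, of l]) blast
  then obtain M where M: "\<And>j p' vs'. j \<in> J \<Longrightarrow> p' \<in> K \<Longrightarrow> length vs' = l \<Longrightarrow> \<forall>v\<in>set vs'. norm v \<le> 1 \<Longrightarrow>
      \<bar>iterated_deriv vs' (G j) p'\<bar> \<le> M j" by metis
  \<comment> \<open>The summand 1 makes T positive and the final estimate strict: the perturbation
    is at most \<open>\<delta> * (T - 1)\<close>.\<close>
  define T where "T = 1 + (\<Sum>j\<in>J. \<bar>M j\<bar>)"
  have T: "T \<ge> 1" by (simp add: T_def sum_nonneg)
  define \<delta> where "\<delta> = (\<epsilon> - \<mu>) / T"
  have \<delta>: "\<delta> > 0" using \<mu> T by (simp add: \<delta>_def)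
  show ?thesis
  proof (intro exI[of _ \<delta>] conjI \<delta> allI impI ballI; elim conjE)
    fix t p and vs :: "'e list"
    assume t: "\<forall>j\<in>J. \<bar>t j\<bar> < \<delta>" and p: "p \<in> K" and vs: "length vs = l" "\<forall>v\<in>set vs. norm v \<le> 1"
    have "\<bar>\<Sum>j\<in>J. t j * iterated_deriv vs (G j) p\<bar> \<le> (\<Sum>j\<in>J. \<bar>t j * iterated_deriv vs (G j) p\<bar>)"
      by (rule sum_abs)
    also have "\<dots> \<le> (\<Sum>j\<in>J. \<delta> * \<bar>M j\<bar>)"
    proof (rule sum_mono)
      fix j assume j: "j \<in> J"
      have "\<bar>t j\<bar> \<le> \<delta>" using t j by force
      moreover have "\<bar>iterated_deriv vs (G j) p\<bar> \<le> \<bar>M j\<bar>" using M[OF j p vs] by linarith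
      ultimately show "\<bar>t j * iterated_deriv vs (G j) p\<bar> \<le> \<delta> * \<bar>M j\<bar>"
        unfolding abs_mult using \<delta> by (intro mult_mono) auto
    qed
    also have "\<dots> = \<delta> * (T - 1)" by (simp add: T_def sum_distrib_left)
    also have "\<dots> < \<delta> * T" using \<delta> by simp
    also have "\<dots> = \<epsilon> - \<mu>" using T by (simp add: \<delta>_def)
    finally have "\<bar>\<Sum>j\<in>J. t j * iterated_deriv vs (G j) p\<bar> < \<epsilon> - \<mu>" .
    moreover have "\<bar>iterated_deriv vs H p - iterated_deriv vs F p\<bar> \<le> \<mu>"
      using sup[OF p vs] E[of p vs] p K(2) by (auto simp: \<mu>_def)
    moreover have "iterated_deriv vs (\<lambda>y. F y + (\<Sum>j\<in>J. t j * G j y)) p =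
        iterated_deriv vs F p + (\<Sum>j\<in>J. t j * iterated_deriv vs (G j) p)"
      using p K(2) by (intro iterated_deriv_add_lincomb[OF S] sm J) auto
    ultimately show "\<bar>iterated_deriv vs H p - iterated_deriv vs (\<lambda>y. F y + (\<Sum>j\<in>J. t j * G j y)) p\<bar> < \<epsilon>"
      by linarith
  qed
qed

lemma locally_finite_compact:
  assumes "locally_finite_family I D" "compact C"
  shows "finite {i\<in>I. D i \<inter> C \<noteq> {}}"
proof -
  obtain V where V: "\<And>p. open (V p) \<and> p \<in> V p \<and> finite {i\<in>I. D i \<inter> V p \<noteq> {}}"
    using assms(1) unfolding locally_finite_family_def by metis
  obtain P where P: "finite P" "C \<subseteq> (\<Union>p\<in>P. V p)"
    using compactE_image[OF assms(2), of C V] V by (metis UN_I subsetI)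
  have "{i\<in>I. D i \<inter> C \<noteq> {}} \<subseteq> (\<Union>p\<in>P. {i\<in>I. D i \<inter> V p \<noteq> {}})" using P(2) by blast
  then show ?thesis using P(1) V by (meson finite_UN_I finite_subset)
qed

lemma ex_common_delta:
  fixes P :: "'i \<Rightarrow> real \<Rightarrow> bool"
  assumes "finite I" "\<And>i. i \<in> I \<Longrightarrow> \<exists>\<delta>>0. P i \<delta>" "\<And>i \<delta> \<delta>'. P i \<delta> \<Longrightarrow> \<delta>' \<le> \<delta> \<Longrightarrow> P i \<delta>'"
  shows "\<exists>\<delta>>0. \<forall>i\<in>I. P i \<delta>"
  using assms(1,2)
proof (induction I)
  case (insert i I)
  have "\<exists>\<delta>>0. \<forall>i\<in>I. P i \<delta>" "\<exists>\<delta>>0. P i \<delta>" using insert.IH insert.prems by auto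
  then obtain \<delta> \<delta>' where "\<delta> > 0" "\<forall>i\<in>I. P i \<delta>" "\<delta>' > 0" "P i \<delta>'" by blast
  then show ?case using assms(3) by (intro exI[of _ "min \<delta> \<delta>'"]) (auto intro: min.cobounded1 min.cobounded2)
qed (auto intro: exI[of _ 1])

text \<open>All perturbations vanish outside one compact set, and a locally finite family of chart
  domains meets it only finitely often. Hence finitely many pairs of a chart and an order determine
  \<delta>; in the other charts f is unchanged.\<close>

lemma whitney_perturbation:
  fixes A :: "('x::t2_space, 'e::real_normed_vector) chart set" and b :: "nat \<Rightarrow> 'e"
  assumes co: "coordinates n b \<xi>" and A: "smooth_atlas A" and f: "f \<in> smooth_functions A"
    and J: "finite J" and g: "\<And>j. j \<in> J \<Longrightarrow> g j \<in> smooth_functions A"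
    and C: "compact C" "\<And>j p. j \<in> J \<Longrightarrow> p \<notin> C \<Longrightarrow> g j p = 0"
    and W: "openin (whitney_topology A) W" "f \<in> W"
  shows "\<exists>\<delta>>0. \<forall>t. (\<forall>j\<in>J. \<bar>t j\<bar> < \<delta>) \<longrightarrow> (\<lambda>p. f p + (\<Sum>j\<in>J. t j * g j p)) \<in> W"
proof -
  let ?S = "{whitney_nbhd A k I c K \<epsilon> f | k I c K \<epsilon> f.
        f \<in> smooth_functions A \<and> locally_finite_family I (\<lambda>i. fst (c i)) \<and>
        (\<forall>i\<in>I. c i \<in> max_atlas A \<and> compact (K i) \<and> K i \<subseteq> fst (c i) \<and> \<epsilon> i > 0)}"
  let ?f = "\<lambda>t p. f p + (\<Sum>j\<in>J. t j * g j p)"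
  have "generate_topology_on ?S W"
    using W(1) unfolding whitney_topology_def by (simp add: openin_topology_generated_by_iff)
  then show ?thesis using W(2)
  proof (induction W)
    case (Int V W)
    then obtain \<delta> \<delta>' where "\<delta> > 0" "\<delta>' > 0" "\<And>t. (\<forall>j\<in>J. \<bar>t j\<bar> < \<delta>) \<Longrightarrow> ?f t \<in> V"
      "\<And>t. (\<forall>j\<in>J. \<bar>t j\<bar> < \<delta>') \<Longrightarrow> ?f t \<in> W" by auto
    then show ?case by (intro exI[of _ "min \<delta> \<delta>'"]) auto
  next
    case (UN \<W>)
    then show ?case by (meson UnionE UnionI)
  next
    case (Basis W)
    then obtain k I c K \<epsilon> h where W: "W = whitney_nbhd A k I c K \<epsilon> h" and h: "h \<in> smooth_functions A"
      and lf: "locally_finite_family I (\<lambda>i. fst (c i))"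
      and c: "\<And>i. i \<in> I \<Longrightarrow> c i \<in> max_atlas A \<and> compact (K i) \<and> K i \<subseteq> fst (c i) \<and> \<epsilon> i > 0"
      by blast
    let ?I = "{i\<in>I. fst (c i) \<inter> C \<noteq> {}}"
    define P where "P = (\<lambda>i l t. \<forall>p\<in>K i. \<forall>vs. length vs = l \<and> (\<forall>v\<in>set vs. norm v \<le> 1) \<longrightarrow>
      \<bar>iterated_deriv vs (in_chart (c i) h) (snd (c i) p) - iterated_deriv vs (in_chart (c i) (?f t)) (snd (c i) p)\<bar> < \<epsilon> i)"
    have fW: "\<bar>iterated_deriv vs (in_chart (c i) h) (snd (c i) p) - iterated_deriv vs (in_chart (c i) f) (snd (c i) p)\<bar> < \<epsilon> i"
      if "i \<in> I" "p \<in> K i" "length vs \<le> k" "\<forall>v\<in>set vs. norm v \<le> 1" for i p vs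
      using Basis.prems that unfolding W whitney_nbhd_def by blast
    have ch: "is_chart (c i)" if "i \<in> I" for i using c[OF that] max_atlas_is_chart by blast
    have ex: "\<exists>\<delta>>0. \<forall>t. (\<forall>j\<in>J. \<bar>t j\<bar> < \<delta>) \<longrightarrow> P i l t" if i: "i \<in> I" and l: "l \<le> k" for i l
    proof -
      have ic: "in_chart (c i) (?f t) = (\<lambda>y. in_chart (c i) f y + (\<Sum>j\<in>J. t j * in_chart (c i) (g j) y))" for t
        by (auto simp: in_chart_eq)
      have K: "compact (snd (c i) ` K i)" "snd (c i) ` K i \<subseteq> snd (c i) ` fst (c i)"
        using c[OF i] is_chartD(3)[OF ch[OF i]] by (auto intro: compact_continuous_image continuous_on_subset)
      have m: "c i \<in> max_atlas A" using c[OF i] by blast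
      have gs: "smooth_on (snd (c i) ` fst (c i)) (in_chart (c i) (g j))" if "j \<in> J" for j
        by (rule smooth_function_in_chart[OF g[OF that] m])
      have less: "\<bar>iterated_deriv vs (in_chart (c i) h) p - iterated_deriv vs (in_chart (c i) f) p\<bar> < \<epsilon> i"
        if p: "p \<in> snd (c i) ` K i" and vs: "length vs = l" "\<forall>v\<in>set vs. norm v \<le> 1" for p vs
      proof -
        obtain q where "q \<in> K i" "p = snd (c i) q" using p by blast
        then show ?thesis using fW[OF i _ _ vs(2)] vs(1) l by simp
      qed
      show ?thesis
        using perturbation_in_chart[OF co is_chartD(2)[OF ch[OF i]] smooth_function_in_chart[OF h m]
            smooth_function_in_chart[OF f m] gs J K less]
        unfolding P_def ic ball_simps(9) .
    qed
    have "\<exists>\<delta>>0. \<forall>il\<in>?I \<times> {..k}. \<forall>t. (\<forall>j\<in>J. \<bar>t j\<bar> < \<delta>) \<longrightarrow> P (fst il) (snd il) t"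
    proof (rule ex_common_delta)
      show "finite (?I \<times> {..k})" using locally_finite_compact[OF lf C(1)] by blast
      show "\<exists>\<delta>>0. \<forall>t. (\<forall>j\<in>J. \<bar>t j\<bar> < \<delta>) \<longrightarrow> P (fst il) (snd il) t" if "il \<in> ?I \<times> {..k}" for il
        using that ex by auto
      show "\<forall>t. (\<forall>j\<in>J. \<bar>t j\<bar> < \<delta>') \<longrightarrow> P (fst il) (snd il) t"
        if "\<forall>t. (\<forall>j\<in>J. \<bar>t j\<bar> < \<delta>) \<longrightarrow> P (fst il) (snd il) t" "\<delta>' \<le> \<delta>" for il \<delta> \<delta>'
        using that by (meson less_le_trans)
    qed
    then obtain \<delta> where \<delta>: "\<delta> > 0" and P: "\<And>i l t. i \<in> ?I \<Longrightarrow> l \<le> k \<Longrightarrow> \<forall>j\<in>J. \<bar>t j\<bar> < \<delta> \<Longrightarrow> P i l t"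
      by fastforce
    have "?f t \<in> W" if t: "\<forall>j\<in>J. \<bar>t j\<bar> < \<delta>" for t
    proof -
      have "\<bar>iterated_deriv vs (in_chart (c i) h) (snd (c i) p) - iterated_deriv vs (in_chart (c i) (?f t)) (snd (c i) p)\<bar> < \<epsilon> i"
        if i: "i \<in> I" and p: "p \<in> K i" and vs: "length vs \<le> k" "\<forall>v\<in>set vs. norm v \<le> 1" for i p vs
      proof (cases "i \<in> ?I")
        case True
        then show ?thesis using P[OF True vs(1) t] p vs(2) by (simp add: P_def)
      next
        case False
        have eq: "in_chart (c i) (?f t) y = in_chart (c i) f y" if "y \<in> snd (c i) ` fst (c i)" for y
        proof -
          obtain q where q: "q \<in> fst (c i)" "y = snd (c i) q" using \<open>y \<in> _\<close> by blast
          then have "q \<notin> C" using False i by blast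
          then have "(\<Sum>j\<in>J. t j * g j q) = 0" using C(2) by (intro sum.neutral) auto
          then show ?thesis by (simp add: q(2) in_chart_apply[OF ch[OF i] q(1)])
        qed
        have "snd (c i) p \<in> snd (c i) ` fst (c i)" using c[OF i] p by blast
        then show ?thesis
          using iterated_deriv_cong[OF is_chartD(2)[OF ch[OF i]] _ eq] fW[OF i p vs] by simp
      qed
      moreover have "?f t \<in> smooth_functions A" by (rule smooth_functions_lincomb[OF A f g])
      ultimately show ?thesis unfolding W whitney_nbhd_def by blast
    qed
    then show ?case using \<delta> by blast
  qed simp
qed

text \<open>A neighbourhood of order 0 for a finite, hence locally finite, family of charts:
  openness of the measure condition is a matter of uniform closeness on compact sets.\<close>

lemma whitney_uniform_nbhd:
  fixes A :: "('x::t2_space, 'e::real_normed_vector) chart set"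
  assumes A: "smooth_atlas A" and f: "f \<in> smooth_functions A" and I: "finite I"
    and K: "\<And>i::nat. i \<in> I \<Longrightarrow> c i \<in> A \<and> compact (K i) \<and> K i \<subseteq> fst (c i)" and "\<eta> > 0"
  obtains W where "openin (whitney_topology A) W" "f \<in> W"
    "\<And>g i p. g \<in> W \<Longrightarrow> i \<in> I \<Longrightarrow> p \<in> K i \<Longrightarrow> \<bar>f p - g p\<bar> < \<eta>"
proof -
  let ?W = "whitney_nbhd A 0 I c K (\<lambda>_. \<eta>) f"
  have m: "c i \<in> max_atlas A" if "i \<in> I" for i
    using atlas_subset_max_atlas[OF A] K[OF that] by blast
  have "locally_finite_family I (\<lambda>i. fst (c i))"
    unfolding locally_finite_family_def using I by (auto intro!: exI[of _ UNIV])
  then have "openin (whitney_topology A) ?W"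
    unfolding whitney_topology_def using f K m \<open>\<eta> > 0\<close>
    by (intro topology_generated_by_Basis) blast
  moreover have "f \<in> ?W" using f \<open>\<eta> > 0\<close> by (simp add: whitney_nbhd_def)
  moreover have "\<bar>f p - g p\<bar> < \<eta>" if "g \<in> ?W" "i \<in> I" "p \<in> K i" for g i p
  proof -
    have "p \<in> fst (c i)" using K that by blast
    then have "in_chart (c i) f (snd (c i) p) = f p" "in_chart (c i) g (snd (c i) p) = g p"
      using in_chart_apply[OF max_atlas_is_chart[OF m[OF that(2)]]] by blast+
    then show ?thesis
      using that unfolding whitney_nbhd_def by force
  qed
  ultimately show ?thesis using that by blast
qed

subsection \<open>Null sets in powers of a Euclidean space\<close>

abbreviation lborel_power :: "nat set \<Rightarrow> (nat \<Rightarrow> 'f::euclidean_space) measure" where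
  "lborel_power I \<equiv> \<Pi>\<^sub>M i\<in>I. lborel"

lemma lborel_power_product: "product_sigma_finite (\<lambda>_::nat. lborel :: 'f::euclidean_space measure)"
  by (simp add: product_sigma_finite_def sigma_finite_lborel)

lemma sigma_finite_lborel_power:
  "finite I \<Longrightarrow> sigma_finite_measure (lborel_power I :: (nat \<Rightarrow> 'f::euclidean_space) measure)"
  by (rule product_sigma_finite.sigma_finite[OF lborel_power_product])

text \<open>Tonelli with one factor split off; it drives the induction on the number of factors and
  the treatment of the diagonals.\<close>

lemma null_sets_lborel_power_insert:
  fixes N :: "(nat \<Rightarrow> 'f::euclidean_space) set"
  assumes I: "finite I" "i \<notin> I" and N: "N \<in> sets (lborel_power (insert i I))"
  shows "N \<in> null_sets (lborel_power (insert i I)) \<longleftrightarrow>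
    (AE x in lborel. {y \<in> space (lborel_power I). y(i := x) \<in> N} \<in> null_sets (lborel_power I))"
proof -
  interpret product_sigma_finite "\<lambda>_::nat. lborel :: 'f measure" by (rule lborel_power_product)
  interpret PI: sigma_finite_measure "lborel_power I :: (nat \<Rightarrow> 'f) measure"
    by (rule sigma_finite_lborel_power[OF I(1)])
  note [measurable] = N
  have sec: "{y \<in> space (lborel_power I). y(i := x) \<in> N} \<in> sets (lborel_power I)" for x
    by measurable
  let ?m = "\<lambda>x. emeasure (lborel_power I) {y \<in> space (lborel_power I). y(i := x) \<in> N}"
  have fib: "(\<integral>\<^sup>+ y. indicator N (y(i := x)) \<partial>lborel_power I) = ?m x" for x
  proof -
    have "(\<integral>\<^sup>+ y. indicator N (y(i := x)) \<partial>lborel_power I) =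
        (\<integral>\<^sup>+ y. indicator {y \<in> space (lborel_power I). y(i := x) \<in> N} y \<partial>lborel_power I)"
      by (rule nn_integral_cong) (auto simp: indicator_def)
    then show ?thesis using sec by simp
  qed
  have eq: "emeasure (lborel_power (insert i I)) N = (\<integral>\<^sup>+ x. ?m x \<partial>lborel)"
    using product_nn_integral_insert_rev[OF I, of "indicator N"] by (simp add: fib)
  have "(\<lambda>x. \<integral>\<^sup>+ y. indicator N (y(i := x)) \<partial>lborel_power I) \<in> borel_measurable lborel"
    by measurable
  then have "?m \<in> borel_measurable lborel" unfolding fib .
  then have "emeasure (lborel_power (insert i I)) N = 0 \<longleftrightarrow>
      (AE x in lborel. emeasure (lborel_power I) {y \<in> space (lborel_power I). y(i := x) \<in> N} = 0)"
    unfolding eq by (rule nn_integral_0_iff_AE)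
  then show ?thesis using N sec by (simp add: null_sets_def)
qed

text \<open>Split off one coordinate x: the section of the preimage over x is the preimage of the
  section of A over \<open>g i x\<close>. The exceptional x form the preimage of a null set, null by
  assumption; the others fall under the induction hypothesis.\<close>

lemma null_sets_lborel_power_vimage:
  fixes g :: "nat \<Rightarrow> 'f::euclidean_space \<Rightarrow> 'f"
  assumes "finite I" and C: "\<And>i. i \<in> I \<Longrightarrow> open (C i)" and g: "\<And>i. i \<in> I \<Longrightarrow> continuous_on (C i) (g i)"
    and null: "\<And>i S. i \<in> I \<Longrightarrow> S \<in> null_sets lborel \<Longrightarrow> {w \<in> C i. g i w \<in> S} \<in> null_sets lborel"
    and A: "A \<in> null_sets (lborel_power I)"
  shows "{w \<in> Pi\<^sub>E I C. (\<lambda>i\<in>I. g i (w i)) \<in> A} \<in> null_sets (lborel_power I)"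
  using assms
proof (induction I arbitrary: A)
  case empty
  interpret product_sigma_finite "\<lambda>_::nat. lborel :: 'f measure" by (rule lborel_power_product)
  \<comment> \<open>The empty power is one point of mass 1, whose only null set is empty.\<close>
  have "A = {}"
    using empty.prems(4) by (auto simp: null_sets_def sets_PiM_empty emeasure_PiM_empty)
  then show ?case by simp
next
  case (insert i I)
  let ?A = "\<lambda>x. {y \<in> space (lborel_power I). y(i := x) \<in> A}"
  let ?T = "{w \<in> Pi\<^sub>E (insert i I) C. (\<lambda>i\<in>insert i I. g i (w i)) \<in> A}"
  have "A \<in> sets (lborel_power (insert i I))" using insert.prems(4) by auto
  from null_sets_lborel_power_insert[OF insert.hyps this] insert.prems(4)
  have "AE x in lborel. ?A x \<in> null_sets (lborel_power I)" by blast
  then obtain S where S: "S \<in> null_sets lborel" "\<And>x. x \<notin> S \<Longrightarrow> ?A x \<in> null_sets (lborel_power I)"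
    by (auto simp: eventually_ae_filter)
  \<comment> \<open>Extension by 0 off the open domain gives total Borel maps, from which the
    preimage is carved out by intersecting with the box of domains.\<close>
  have meas: "(\<lambda>w. if w \<in> C j then g j w else 0) \<in> borel \<rightarrow>\<^sub>M lborel" if "j \<in> insert i I" for j
    using insert.prems(1,2)[OF that] borel_measurable_continuous_on_if[of "C j" "g j" "\<lambda>_. 0"] by simp
  define F where "F = (\<lambda>w. \<lambda>j\<in>insert i I. if w j \<in> C j then g j (w j) else 0)"
  define P where "P = Pi\<^sub>E (insert i I) C"
  have "F \<in> lborel_power (insert i I) \<rightarrow>\<^sub>M lborel_power (insert i I)"
  unfolding F_def
  proof (rule measurable_restrict)
    fix j assume j: "j \<in> insert i I"
    have "(\<lambda>w. w j) \<in> lborel_power (insert i I) \<rightarrow>\<^sub>M (borel :: 'f measure)"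
      using measurable_component_singleton[OF j, of "\<lambda>_. lborel :: 'f measure"] by simp
    from measurable_compose[OF this meas[OF j]]
    show "(\<lambda>w. if w j \<in> C j then g j (w j) else 0) \<in> lborel_power (insert i I) \<rightarrow>\<^sub>M lborel" .
  qed
  then have "F -` A \<inter> space (lborel_power (insert i I)) \<in> sets (lborel_power (insert i I))"
    using \<open>A \<in> sets _\<close> by (rule measurable_sets)
  moreover have "P \<in> sets (lborel_power (insert i I))"
    unfolding P_def using insert.hyps insert.prems(1) by (intro sets_PiM_I_finite) auto
  moreover have "?T = P \<inter> (F -` A \<inter> space (lborel_power (insert i I)))"
  proof -
    have "F w = (\<lambda>j\<in>insert i I. g j (w j))" if "w \<in> P" for w
      using that unfolding F_def P_def by (intro restrict_ext) (auto simp: PiE_iff)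
    moreover have "P \<subseteq> space (lborel_power (insert i I))"
      unfolding P_def space_PiM by (rule PiE_mono) simp
    ultimately show ?thesis unfolding P_def[symmetric] by auto
  qed
  ultimately have T: "?T \<in> sets (lborel_power (insert i I))" by (metis sets.Int)
  have "{x \<in> C i. g i x \<in> S} \<in> null_sets lborel" using insert.prems(3)[OF insertI1 S(1)] .
  moreover have "{y \<in> space (lborel_power I). y(i := x) \<in> ?T} \<in> null_sets (lborel_power I)"
    if x: "x \<notin> {x \<in> C i. g i x \<in> S}" for x
  proof (cases "x \<in> C i")
    case False
    then have "{y \<in> space (lborel_power I). y(i := x) \<in> ?T} = {}" by (auto simp: PiE_iff)
    then show ?thesis by (metis null_sets.empty_sets)
  next
    case True
    then have "?A (g i x) \<in> null_sets (lborel_power I)" using S(2) x by blast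
    then have "{w \<in> Pi\<^sub>E I C. (\<lambda>i\<in>I. g i (w i)) \<in> ?A (g i x)} \<in> null_sets (lborel_power I)"
      using insert.prems by (intro insert.IH) auto
    moreover have "{y \<in> space (lborel_power I). y(i := x) \<in> ?T} = {w \<in> Pi\<^sub>E I C. (\<lambda>i\<in>I. g i (w i)) \<in> ?A (g i x)}"
    proof -
      have upd: "(\<lambda>j\<in>insert i I. g j ((y(i := x)) j)) = (\<lambda>i\<in>I. g i (y i))(i := g i x)" for y
        using insert.hyps(2) by (auto simp: fun_eq_iff)
      have mem: "y(i := x) \<in> Pi\<^sub>E (insert i I) C \<longleftrightarrow> y \<in> Pi\<^sub>E I C" if "y \<in> extensional I" for y
      proof -
        have "(\<forall>j\<in>insert i I. (y(i := x)) j \<in> C j) \<longleftrightarrow> (\<forall>j\<in>I. y j \<in> C j)"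
          using True insert.hyps(2) by (metis fun_upd_apply insert_iff)
        moreover have "y(i := x) \<in> extensional (insert i I)" using that by (simp add: extensional_def)
        ultimately show ?thesis using that by (simp only: PiE_iff)
      qed
      have sp: "space (lborel_power I :: (nat \<Rightarrow> 'f) measure) = extensional I"
        by (simp add: space_PiM PiE_def)
      have "w \<in> extensional I" if "w \<in> Pi\<^sub>E I C" for w using that by (simp add: PiE_iff)
      then show ?thesis
        unfolding sp mem_Collect_eq upd using mem by (intro Collect_cong) (auto simp del: PiE_iff fun_upd_apply PiE_E)
    qed
    ultimately show ?thesis by metis
  qed
  ultimately have "AE x in lborel. {y \<in> space (lborel_power I). y(i := x) \<in> ?T} \<in> null_sets (lborel_power I)"
    unfolding eventually_ae_filter by blast
  then show ?case using null_sets_lborel_power_insert[OF insert.hyps T] by blast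
qed

text \<open>Points of the power over I are functions on all natural numbers, equal to
  \<open>undefined\<close> outside I. In the full function space compact sets are Borel, and this
  map carries that over to the product \<sigma>-algebra.\<close>

lemma measurable_lborel_power_borel:
  "(\<lambda>w. w) \<in> lborel_power I \<rightarrow>\<^sub>M (borel :: (nat \<Rightarrow> 'f::euclidean_space) measure)"
proof -
  have "(\<lambda>w. w) \<in> lborel_power I \<rightarrow>\<^sub>M (\<Pi>\<^sub>M i\<in>(UNIV::nat set). (borel :: 'f measure))"
  proof (rule measurable_PiM_single')
    fix i :: nat
    show "(\<lambda>w. w i) \<in> lborel_power I \<rightarrow>\<^sub>M (borel :: 'f measure)"
    proof (cases "i \<in> I")
      case True
      then show ?thesis using measurable_component_singleton[OF True, of "\<lambda>_. lborel :: 'f measure"] by simp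
    next
      case False
      then have "(\<lambda>w. w i) \<in> lborel_power I \<rightarrow>\<^sub>M (borel :: 'f measure) \<longleftrightarrow>
        (\<lambda>w. undefined) \<in> (lborel_power I :: (nat \<Rightarrow> 'f) measure) \<rightarrow>\<^sub>M (borel :: 'f measure)"
        by (intro measurable_cong) (auto simp: space_PiM PiE_iff extensional_def)
      then show ?thesis by simp
    qed
  qed auto
  moreover have "sets (\<Pi>\<^sub>M i\<in>(UNIV::nat set). (borel :: 'f measure)) = sets borel"
    by (rule sets_PiM_equal_borel)
  ultimately show ?thesis using measurable_cong_sets by blast
qed

lemma compact_in_sets_lborel_power:
  fixes K :: "(nat \<Rightarrow> 'f::euclidean_space) set"
  assumes "compact K" "K \<subseteq> PiE I (\<lambda>_. UNIV)"
  shows "K \<in> sets (lborel_power I)"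
proof -
  have "K \<in> sets borel" using assms(1) by (rule borel_compact)
  from measurable_sets[OF measurable_lborel_power_borel this, of I]
  show ?thesis using assms(2) by (simp add: space_PiM Int_absorb2)
qed

lemma compact_in_sets_lborel_power_pair:
  fixes K :: "((nat \<Rightarrow> 'e::euclidean_space) \<times> (nat \<Rightarrow> 'f::euclidean_space)) set"
  assumes "compact K" "K \<subseteq> PiE I (\<lambda>_. UNIV) \<times> PiE J (\<lambda>_. UNIV)"
  shows "K \<in> sets (lborel_power I \<Otimes>\<^sub>M lborel_power J)"
proof -
  have "K \<in> sets (borel \<Otimes>\<^sub>M borel)" using borel_compact[OF assms(1)] by (simp only: borel_prod)
  moreover have "(\<lambda>z. (fst z, snd z)) \<in> lborel_power I \<Otimes>\<^sub>M lborel_power J \<rightarrow>\<^sub>M (borel \<Otimes>\<^sub>M borel :: ((nat \<Rightarrow> 'e) \<times> (nat \<Rightarrow> 'f)) measure)"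
    by (intro measurable_Pair measurable_compose[OF measurable_fst measurable_lborel_power_borel]
        measurable_compose[OF measurable_snd measurable_lborel_power_borel])
  ultimately have "(\<lambda>z. (fst z, snd z)) -` K \<inter> space (lborel_power I \<Otimes>\<^sub>M lborel_power J) \<in> sets (lborel_power I \<Otimes>\<^sub>M lborel_power J)"
    by (rule measurable_sets[rotated])
  moreover have "(\<lambda>z. (fst z, snd z)) -` K \<inter> space (lborel_power I \<Otimes>\<^sub>M lborel_power J) = K"
    using assms(2) by (auto simp: space_pair_measure space_PiM)
  ultimately show ?thesis by simp
qed

section \<open>Zero sets with tolerance and semicontinuity of their measure\<close>

lemma compact_PiE:
  fixes L :: "nat \<Rightarrow> 'f::topological_space set"
  assumes "\<And>i. i \<in> I \<Longrightarrow> compact (L i)"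
  shows "compact (PiE I L)"
proof -
  \<comment> \<open>Outside I the factor is the single point \<open>undefined\<close>, which
    identifies extensional functions with a product over all indices.\<close>
  let ?L = "\<lambda>i. if i \<in> I then L i else {undefined}"
  have "compactin (product_topology (\<lambda>_. euclidean) UNIV) (PiE UNIV ?L)"
    using assms by (subst compactin_PiE) auto
  moreover have "PiE UNIV ?L = PiE I L"
    by (auto simp: PiE_iff extensional_def split: if_splits)
  ultimately show ?thesis by (simp add: euclidean_product_topology)
qed

lemma continuous_on_eval_coordinate:
  assumes h: "continuous_on (K \<times> L i) (h :: 'a::topological_space \<times> 'f::topological_space \<Rightarrow> real)" and i: "i \<in> I"
  shows "continuous_on (K \<times> PiE I L) (\<lambda>z. h (fst z, snd z i))"
proof (rule continuous_on_compose2[OF h])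
  show "continuous_on (K \<times> PiE I L) (\<lambda>z. (fst z, snd z i))"
    by (intro continuous_on_Pair continuous_on_fst continuous_on_id
        continuous_on_product_then_coordinatewise[OF continuous_on_snd[OF continuous_on_id]])
  show "(\<lambda>z. (fst z, snd z i)) ` (K \<times> PiE I L) \<subseteq> K \<times> L i"
  proof (rule image_subsetI)
    fix z assume "z \<in> K \<times> PiE I L"
    then have z: "fst z \<in> K" "snd z \<in> PiE I L" by (simp_all only: mem_Times_iff)
    from z(1) PiE_mem[OF z(2) i] show "(fst z, snd z i) \<in> K \<times> L i" by (rule SigmaI)
  qed
qed

text \<open>With \<eta> = 0 these are the tuples that are bad for some x in K; a positive \<eta>
  absorbs a uniformly small change of h.\<close>

definition zeros :: "nat \<Rightarrow> 'a set \<Rightarrow> (nat \<Rightarrow> 'f set) \<Rightarrow> (nat \<Rightarrow> 'a \<times> 'f \<Rightarrow> real) \<Rightarrow> real \<Rightarrow> (nat \<Rightarrow> 'f) set" where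
  "zeros q K L h \<eta> = {w \<in> PiE {..<q} L. \<exists>x\<in>K. \<forall>i<q. \<bar>h i (x, w i)\<bar> \<le> \<eta>}"

lemma compact_zeros:
  fixes K :: "'a::topological_space set" and L :: "nat \<Rightarrow> 'f::topological_space set"
  assumes K: "compact K" and L: "\<And>i. i < q \<Longrightarrow> compact (L i)"
    and h: "\<And>i. i < q \<Longrightarrow> continuous_on (K \<times> L i) (h i)"
  shows "compact {z \<in> K \<times> PiE {..<q} L. \<forall>i<q. \<bar>h i (fst z, snd z i)\<bar> \<le> (\<eta>::real)}"
    and "compact (zeros q K L h \<eta>)"
proof -
  let ?P = "K \<times> PiE {..<q} L"
  have P: "compact ?P" using K L by (intro compact_Times compact_PiE) auto
  have cont: "continuous_on ?P (\<lambda>z. h i (fst z, snd z i))" if "i < q" for i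
    by (rule continuous_on_eval_coordinate[where L = L and i = i, OF h[OF that]]) (simp add: that)
  let ?S = "\<lambda>i. ?P \<inter> (\<lambda>z. \<bar>h i (fst z, snd z i)\<bar>) -` {..\<eta>}"
  \<comment> \<open>Inserting \<open>?P\<close> keeps the family of closed sets nonempty when q =
    0.\<close>
  have "closedin (top_of_set ?P) (\<Inter>(insert ?P (?S ` {..<q})))"
  proof (rule closedin_Inter)
    fix X assume "X \<in> insert ?P (?S ` {..<q})"
    then consider "X = ?P" | i where "i < q" "X = ?S i" by blast
    then show "closedin (top_of_set ?P) X"
    proof cases
      case 2
      then show ?thesis
        by (simp only:) (intro continuous_closedin_preimage continuous_on_rabs cont closed_atMost)
    qed simp
  qed simp
  then have "compact (\<Inter>(insert ?P (?S ` {..<q})))"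
    using P closedin_compact by blast
  moreover have "\<Inter>(insert ?P (?S ` {..<q})) = {z \<in> ?P. \<forall>i<q. \<bar>h i (fst z, snd z i)\<bar> \<le> \<eta>}"
    by auto
  ultimately show c: "compact {z \<in> ?P. \<forall>i<q. \<bar>h i (fst z, snd z i)\<bar> \<le> \<eta>}" by simp
  have "zeros q K L h \<eta> = snd ` {z \<in> ?P. \<forall>i<q. \<bar>h i (fst z, snd z i)\<bar> \<le> \<eta>}"
  proof (intro set_eqI iffI)
    fix w assume "w \<in> zeros q K L h \<eta>"
    then obtain x where "x \<in> K" "w \<in> PiE {..<q} L" "\<forall>i<q. \<bar>h i (x, w i)\<bar> \<le> \<eta>"
      unfolding zeros_def by blast
    then have "(x, w) \<in> {z \<in> ?P. \<forall>i<q. \<bar>h i (fst z, snd z i)\<bar> \<le> \<eta>}"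
      by (simp only: mem_Collect_eq mem_Times_iff fst_conv snd_conv simp_thms)
    then show "w \<in> snd ` {z \<in> ?P. \<forall>i<q. \<bar>h i (fst z, snd z i)\<bar> \<le> \<eta>}"
      by (rule rev_image_eqI) simp
  next
    fix w assume "w \<in> snd ` {z \<in> ?P. \<forall>i<q. \<bar>h i (fst z, snd z i)\<bar> \<le> \<eta>}"
    then show "w \<in> zeros q K L h \<eta>"
      unfolding zeros_def mem_Times_iff by blast
  qed
  then show "compact (zeros q K L h \<eta>)"
    using compact_continuous_image[OF continuous_on_snd[OF continuous_on_id] c] by simp
qed

lemma zeros_mono:
  assumes "\<And>i x w. i < q \<Longrightarrow> x \<in> K \<Longrightarrow> w \<in> L i \<Longrightarrow> \<bar>h i (x, w) - h' i (x, w)\<bar> \<le> \<eta>"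
  shows "zeros q K L h' 0 \<subseteq> zeros q K L h \<eta>"
proof
  fix w assume "w \<in> zeros q K L h' 0"
  then obtain x where w: "w \<in> PiE {..<q} L" and x: "x \<in> K" "\<forall>i<q. \<bar>h' i (x, w i)\<bar> \<le> 0"
    unfolding zeros_def by blast
  have "\<bar>h i (x, w i)\<bar> \<le> \<eta>" if "i < q" for i
  proof -
    have "w i \<in> L i" by (rule PiE_mem[OF w]) (simp add: that)
    then show ?thesis using assms[OF that x(1), of "w i"] x(2)[rule_format, OF that] by linarith
  qed
  then show "w \<in> zeros q K L h \<eta>" unfolding zeros_def using w x(1) by blast
qed

text \<open>The approximate zeros x depend on n. The sum of all |h i| attains its minimum on the
  compact K, and a minimum that is at most q/(n+1) for every n is 0, which yields one common
  zero.\<close>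

lemma zeros_0_eq_INT:
  fixes K :: "'a::topological_space set" and L :: "nat \<Rightarrow> 'f::topological_space set"
  assumes K: "compact K" and h: "\<And>i. i < q \<Longrightarrow> continuous_on (K \<times> L i) (h i)"
  shows "zeros q K L h 0 = (\<Inter>n. zeros q K L h (inverse (real (Suc n))))"
proof (intro set_eqI iffI)
  fix w assume "w \<in> zeros q K L h 0"
  then show "w \<in> (\<Inter>n. zeros q K L h (inverse (real (Suc n))))"
    using zeros_mono[of q K L h h] by (simp add: subset_iff)
next
  fix w assume w: "w \<in> (\<Inter>n. zeros q K L h (inverse (real (Suc n))))"
  then have wL: "w \<in> PiE {..<q} L" and
    ex: "\<And>n. \<exists>x\<in>K. \<forall>i<q. \<bar>h i (x, w i)\<bar> \<le> inverse (real (Suc n))"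
    unfolding zeros_def by blast+
  let ?m = "\<lambda>x. \<Sum>i<q. \<bar>h i (x, w i)\<bar>"
  have "continuous_on K (\<lambda>x. h i (x, w i))" if "i < q" for i
  proof (rule continuous_on_compose2[OF h[OF that]])
    show "continuous_on K (\<lambda>x. (x, w i))" by (intro continuous_on_Pair continuous_on_id continuous_on_const)
    have "w i \<in> L i" by (rule PiE_mem[OF wL]) (simp add: that)
    then show "(\<lambda>x. (x, w i)) ` K \<subseteq> K \<times> L i" by blast
  qed
  then have "continuous_on K ?m" by (intro continuous_on_sum continuous_on_rabs) simp
  moreover have "K \<noteq> {}" using ex by blast
  ultimately obtain x where x: "x \<in> K" "\<And>y. y \<in> K \<Longrightarrow> ?m x \<le> ?m y"
    using continuous_attains_inf[OF K] by blast
  have "?m x \<le> real q * inverse (real (Suc n))" for n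
  proof -
    obtain y where y: "y \<in> K" "\<forall>i<q. \<bar>h i (y, w i)\<bar> \<le> inverse (real (Suc n))" using ex by blast
    have "?m y \<le> (\<Sum>i<q. inverse (real (Suc n)))" using y(2) by (intro sum_mono) simp
    then show ?thesis using x(2)[OF y(1)] by simp
  qed
  moreover have "(\<lambda>n. real q * inverse (real (Suc n))) \<longlonglongrightarrow> real q * 0"
    by (intro tendsto_mult tendsto_const LIMSEQ_inverse_real_of_nat)
  ultimately have "?m x \<le> 0" using LIMSEQ_le_const[of _ "real q * 0" "?m x"] by auto
  then have "\<bar>h i (x, w i)\<bar> \<le> 0" if "i < q" for i
    using member_le_sum[of i "{..<q}" "\<lambda>i. \<bar>h i (x, w i)\<bar>"] that by force
  then show "w \<in> zeros q K L h 0" unfolding zeros_def using wL x(1) by blast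
qed

text \<open>The tolerant zero sets decrease to the exact one inside a compact box of finite measure,
  so their measures converge. A strict bound therefore survives a small tolerance, which being null
  would not.\<close>

lemma zeros_upper_semicontinuous:
  fixes K :: "'a::topological_space set" and L :: "nat \<Rightarrow> 'f::euclidean_space set"
  assumes K: "compact K" and L: "\<And>i. i < q \<Longrightarrow> compact (L i)"
    and h: "\<And>i. i < q \<Longrightarrow> continuous_on (K \<times> L i) (h i)"
    and less: "emeasure (lborel_power {..<q}) (zeros q K L h 0) < \<epsilon>"
  shows "\<exists>\<eta>>0. emeasure (lborel_power {..<q}) (zeros q K L h \<eta>) < \<epsilon>"
proof -
  interpret product_sigma_finite "\<lambda>_::nat. lborel :: 'f measure" by (rule lborel_power_product)
  let ?Z = "\<lambda>n. zeros q K L h (inverse (real (Suc n)))"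
  have sub: "zeros q K L h \<eta> \<subseteq> PiE {..<q} L" for \<eta> by (auto simp: zeros_def)
  have meas: "zeros q K L h \<eta> \<in> sets (lborel_power {..<q})" for \<eta>
    using sub[of \<eta>] by (intro compact_in_sets_lborel_power compact_zeros(2)[OF K L h]) (auto simp: PiE_iff)
  have Lb: "L i \<in> sets lborel" if "i < q" for i using borel_compact[OF L[OF that]] by simp
  have box: "PiE {..<q} L \<in> sets (lborel_power {..<q})"
    by (intro sets_PiM_I_finite) (use Lb in auto)
  have "emeasure (lborel_power {..<q}) (PiE {..<q} L) = (\<Prod>i<q. emeasure lborel (L i))"
    by (intro emeasure_PiM) (use Lb in auto)
  also have "\<dots> < \<infinity>"
    using emeasure_compact_finite[OF L] by (auto simp: ennreal_prod_eq_top less_top[symmetric])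
  finally have fin: "emeasure (lborel_power {..<q}) (PiE {..<q} L) < \<infinity>" .
  have "(\<lambda>n. emeasure (lborel_power {..<q}) (?Z n)) \<longlonglongrightarrow> emeasure (lborel_power {..<q}) (\<Inter>n. ?Z n)"
  proof (rule Lim_emeasure_decseq)
    show "decseq ?Z"
    proof (rule decseq_SucI)
      fix n
      have "inverse (real (Suc (Suc n))) \<le> inverse (real (Suc n))" by (simp add: field_simps)
      then show "?Z (Suc n) \<subseteq> ?Z n" unfolding zeros_def by (blast intro: order_trans)
    qed
    show "emeasure (lborel_power {..<q}) (?Z n) \<noteq> \<infinity>" for n
      using emeasure_mono[OF sub box, of "inverse (real (Suc n))"] fin by (auto simp: less_top top_unique)
  qed (use meas in auto)
  then have "\<forall>\<^sub>F n in sequentially. emeasure (lborel_power {..<q}) (?Z n) < \<epsilon>"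
    by (rule order_tendstoD(2)) (use less zeros_0_eq_INT[OF K h] in simp)
  then obtain n where "emeasure (lborel_power {..<q}) (?Z n) < \<epsilon>" by (auto simp: eventually_sequentially)
  then show ?thesis by (intro exI[of _ "inverse (real (Suc n))"]) simp
qed

text \<open>The metric content of having dimension at most \<open>d\<close>, relative to the Lipschitz functions \<open>H\<close>.\<close>

definition cell_cover :: "nat \<Rightarrow> nat \<Rightarrow> 'a set \<Rightarrow> (nat \<Rightarrow> 'a \<Rightarrow> real) \<Rightarrow> bool" where
  "cell_cover d q S H \<longleftrightarrow> (\<exists>(C::nat) L. \<forall>N\<ge>1. \<exists>\<P>. finite \<P> \<and> card \<P> \<le> C * N ^ d \<and> S \<subseteq> \<Union>\<P> \<and>
     (\<forall>P\<in>\<P>. \<forall>s\<in>P. \<forall>s'\<in>P. \<forall>i<q. \<bar>H i s - H i s'\<bar> \<le> L / real N))"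

lemma cell_cover_subset: "cell_cover d q S H \<Longrightarrow> T \<subseteq> S \<Longrightarrow> cell_cover d q T H"
  unfolding cell_cover_def by (meson subset_trans)

lemma cell_coverE:
  assumes "cell_cover d q S H"
  obtains C :: nat and L \<P> where "\<And>N. N \<ge> 1 \<Longrightarrow> finite (\<P> N)" "\<And>N. N \<ge> 1 \<Longrightarrow> card (\<P> N) \<le> C * N ^ d"
    "\<And>N. N \<ge> 1 \<Longrightarrow> S \<subseteq> \<Union>(\<P> N)"
    "\<And>N P s s' i. N \<ge> 1 \<Longrightarrow> P \<in> \<P> N \<Longrightarrow> s \<in> P \<Longrightarrow> s' \<in> P \<Longrightarrow> i < q \<Longrightarrow> \<bar>H i s - H i s'\<bar> \<le> L / real N"
proof -
  define Q where "Q C L N \<P> \<longleftrightarrow> finite \<P> \<and> card \<P> \<le> C * N ^ d \<and> S \<subseteq> \<Union>\<P> \<and>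
     (\<forall>P\<in>\<P>. \<forall>s\<in>P. \<forall>s'\<in>P. \<forall>i<q. \<bar>H i s - H i s'\<bar> \<le> L / real N)" for C :: nat and L N \<P>
  obtain C L where "\<forall>N\<ge>1. \<exists>\<P>. Q C L N \<P>"
    using assms unfolding cell_cover_def Q_def[symmetric] by (elim exE)
  then obtain \<P> where "\<And>N. N \<ge> 1 \<Longrightarrow> Q C L N (\<P> N)" by metis
  then show ?thesis unfolding Q_def by (intro that[of \<P> C L]) blast+
qed

lemma cell_coverI:
  assumes "\<And>N. N \<ge> 1 \<Longrightarrow> finite (\<P> N)" "\<And>N. N \<ge> 1 \<Longrightarrow> card (\<P> N) \<le> C * N ^ d"
    "\<And>N. N \<ge> 1 \<Longrightarrow> S \<subseteq> \<Union>(\<P> N)"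
    "\<And>N P s s' i. N \<ge> 1 \<Longrightarrow> P \<in> \<P> N \<Longrightarrow> s \<in> P \<Longrightarrow> s' \<in> P \<Longrightarrow> i < q \<Longrightarrow> \<bar>H i s - H i s'\<bar> \<le> L / real N"
  shows "cell_cover d q S H"
  unfolding cell_cover_def
proof (rule exI[of _ C], rule exI[of _ L], intro allI impI)
  fix N :: nat assume N: "N \<ge> 1"
  show "\<exists>\<P>. finite \<P> \<and> card \<P> \<le> C * N ^ d \<and> S \<subseteq> \<Union>\<P> \<and>
     (\<forall>P\<in>\<P>. \<forall>s\<in>P. \<forall>s'\<in>P. \<forall>i<q. \<bar>H i s - H i s'\<bar> \<le> L / real N)"
    by (intro exI[of _ "\<P> N"] conjI ballI allI impI assms(1-3)[OF N] assms(4)[OF N])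
qed

lemma cell_cover_Un:
  assumes "cell_cover d q S H" "cell_cover d q T H"
  shows "cell_cover d q (S \<union> T) H"
proof -
  obtain C L \<P> where P: "\<And>N. N \<ge> 1 \<Longrightarrow> finite (\<P> N)" "\<And>N. N \<ge> 1 \<Longrightarrow> card (\<P> N) \<le> C * N ^ d"
    "\<And>N. N \<ge> 1 \<Longrightarrow> S \<subseteq> \<Union>(\<P> N)"
    "\<And>N P s s' i. N \<ge> 1 \<Longrightarrow> P \<in> \<P> N \<Longrightarrow> s \<in> P \<Longrightarrow> s' \<in> P \<Longrightarrow> i < q \<Longrightarrow> \<bar>H i s - H i s'\<bar> \<le> L / real N"
    by (rule cell_coverE[OF assms(1)]) (rule that)
  obtain C' L' \<Q> where Q: "\<And>N. N \<ge> 1 \<Longrightarrow> finite (\<Q> N)" "\<And>N. N \<ge> 1 \<Longrightarrow> card (\<Q> N) \<le> C' * N ^ d"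
    "\<And>N. N \<ge> 1 \<Longrightarrow> T \<subseteq> \<Union>(\<Q> N)"
    "\<And>N P s s' i. N \<ge> 1 \<Longrightarrow> P \<in> \<Q> N \<Longrightarrow> s \<in> P \<Longrightarrow> s' \<in> P \<Longrightarrow> i < q \<Longrightarrow> \<bar>H i s - H i s'\<bar> \<le> L' / real N"
    by (rule cell_coverE[OF assms(2)]) (rule that)
  show ?thesis
  proof (rule cell_coverI[where \<P> = "\<lambda>N. \<P> N \<union> \<Q> N" and C = "C + C'" and L = "max L L'"])
    fix N :: nat assume N: "N \<ge> 1"
    show "finite (\<P> N \<union> \<Q> N)" using P(1)[OF N] Q(1)[OF N] by simp
    show "card (\<P> N \<union> \<Q> N) \<le> (C + C') * N ^ d"
      using card_Un_le[of "\<P> N" "\<Q> N"] P(2)[OF N] Q(2)[OF N] by (simp add: algebra_simps)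
    show "S \<union> T \<subseteq> \<Union>(\<P> N \<union> \<Q> N)" using P(3)[OF N] Q(3)[OF N] by blast
    have le: "L / real N \<le> max L L' / real N" "L' / real N \<le> max L L' / real N"
      by (simp_all add: divide_right_mono)
    show "\<bar>H i s - H i s'\<bar> \<le> max L L' / real N"
      if *: "P \<in> \<P> N \<union> \<Q> N" "s \<in> P" "s' \<in> P" "i < q" for P s s' i
      using *(1)
    proof
      assume "P \<in> \<P> N"
      then show ?thesis using P(4)[OF N _ *(2-4)] le(1) by linarith
    next
      assume "P \<in> \<Q> N"
      then show ?thesis using Q(4)[OF N _ *(2-4)] le(2) by linarith
    qed
  qed
qed

text \<open>Finitely many of the neighbourhoods cover K, and finitely many covers merge by adding
  the constants C and taking the larger L.\<close>

lemma cell_cover_compact: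
  assumes "compact K" "\<And>x. x \<in> K \<Longrightarrow> \<exists>V. open V \<and> x \<in> V \<and> cell_cover d q V H"
  shows "cell_cover d q K H"
proof -
  obtain V where V: "\<And>x. x \<in> K \<Longrightarrow> open (V x) \<and> x \<in> V x \<and> cell_cover d q (V x) H"
    using assms(2) by metis
  obtain X where X: "X \<subseteq> K" "finite X" "K \<subseteq> (\<Union>x\<in>X. V x)"
    using compactE_image[OF assms(1), of K V] V by (metis UN_I subsetI)
  have "cell_cover d q (\<Union>x\<in>X. V x) H"
    using X(2,1)
  proof (induction X)
    case empty
    have "cell_cover d q {} H"
      unfolding cell_cover_def by (intro exI[of _ 0] exI[of _ 0] allI impI exI[of _ "{}"]) simp
    then show ?case by simp
  next
    case (insert x X)
    then show ?case using V by (simp add: cell_cover_Un)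
  qed
  then show ?thesis using X(3) by (rule cell_cover_subset)
qed

text \<open>Products of cells: the exponents of N add, so two parameters with r coordinates each are
  counted by N^(2r).\<close>

lemma cell_cover_Times_diff:
  assumes "cell_cover d q S H" "cell_cover d' q T H'"
  shows "cell_cover (d + d') q (S \<times> T) (\<lambda>i z. H i (fst z) - H' i (snd z))"
proof -
  obtain C L \<P> where P: "\<And>N. N \<ge> 1 \<Longrightarrow> finite (\<P> N)" "\<And>N. N \<ge> 1 \<Longrightarrow> card (\<P> N) \<le> C * N ^ d"
    "\<And>N. N \<ge> 1 \<Longrightarrow> S \<subseteq> \<Union>(\<P> N)"
    "\<And>N P s s' i. N \<ge> 1 \<Longrightarrow> P \<in> \<P> N \<Longrightarrow> s \<in> P \<Longrightarrow> s' \<in> P \<Longrightarrow> i < q \<Longrightarrow> \<bar>H i s - H i s'\<bar> \<le> L / real N"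
    by (rule cell_coverE[OF assms(1)]) (rule that)
  obtain C' L' \<Q> where Q: "\<And>N. N \<ge> 1 \<Longrightarrow> finite (\<Q> N)" "\<And>N. N \<ge> 1 \<Longrightarrow> card (\<Q> N) \<le> C' * N ^ d'"
    "\<And>N. N \<ge> 1 \<Longrightarrow> T \<subseteq> \<Union>(\<Q> N)"
    "\<And>N P s s' i. N \<ge> 1 \<Longrightarrow> P \<in> \<Q> N \<Longrightarrow> s \<in> P \<Longrightarrow> s' \<in> P \<Longrightarrow> i < q \<Longrightarrow> \<bar>H' i s - H' i s'\<bar> \<le> L' / real N"
    by (rule cell_coverE[OF assms(2)]) (rule that)
  define R where "R N = (\<lambda>(P, Q). P \<times> Q) ` (\<P> N \<times> \<Q> N)" for N
  show ?thesis
  proof (rule cell_coverI[where \<P> = R and C = "C * C'" and L = "L + L'"])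
    fix N :: nat assume N: "N \<ge> 1"
    show "finite (R N)" using P(1)[OF N] Q(1)[OF N] by (simp add: R_def)
    have "card (R N) \<le> card (\<P> N \<times> \<Q> N)"
      unfolding R_def using P(1)[OF N] Q(1)[OF N] by (intro card_image_le) simp
    also have "\<dots> \<le> (C * N ^ d) * (C' * N ^ d')"
      using P(2)[OF N] Q(2)[OF N] unfolding card_cartesian_product by (rule mult_le_mono)
    finally show "card (R N) \<le> C * C' * N ^ (d + d')" by (simp add: power_add algebra_simps)
    show "S \<times> T \<subseteq> \<Union>(R N)"
    proof
      fix z assume "z \<in> S \<times> T"
      then obtain X Y where "X \<in> \<P> N" "fst z \<in> X" "Y \<in> \<Q> N" "snd z \<in> Y"
        using P(3)[OF N] Q(3)[OF N] unfolding mem_Times_iff by blast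
      then have "X \<times> Y \<in> R N" "z \<in> X \<times> Y" by (auto simp: R_def mem_Times_iff)
      then show "z \<in> \<Union>(R N)" by blast
    qed
    fix Z s s' i assume Z: "Z \<in> R N" and s: "s \<in> Z" "s' \<in> Z" and i: "i < q"
    obtain X Y where XY: "X \<in> \<P> N" "Y \<in> \<Q> N" "Z = X \<times> Y" using Z by (auto simp: R_def)
    then have "\<bar>H i (fst s) - H i (fst s')\<bar> \<le> L / real N" "\<bar>H' i (snd s) - H' i (snd s')\<bar> \<le> L' / real N"
      using P(4)[OF N XY(1) _ _ i] Q(4)[OF N XY(2) _ _ i] s by (simp_all add: mem_Times_iff)
    then show "\<bar>(H i (fst s) - H' i (snd s)) - (H i (fst s') - H' i (snd s'))\<bar> \<le> (L + L') / real N"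
      by (simp add: add_divide_distrib)
  qed
qed

text \<open>At most C N^d boxes of side 2|L|/N have total volume at most \<kappa> N^(d - q), which
  is at most \<kappa>/N since q exceeds d.\<close>

lemma cell_cover_null:
  assumes cc: "cell_cover d q S H" and "d < q"
    and T: "T \<in> sets (lborel_power {..<q})" "T \<subseteq> (\<lambda>s. \<lambda>i\<in>{..<q}. H i s) ` S"
  shows "T \<in> null_sets (lborel_power {..<q} :: (nat \<Rightarrow> real) measure)"
proof -
  interpret product_sigma_finite "\<lambda>_::nat. lborel :: real measure" by (rule lborel_power_product)
  let ?M = "lborel_power {..<q} :: (nat \<Rightarrow> real) measure"
  obtain C L \<P> where P: "\<And>N. N \<ge> 1 \<Longrightarrow> finite (\<P> N)" "\<And>N. N \<ge> 1 \<Longrightarrow> card (\<P> N) \<le> C * N ^ d"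
    "\<And>N. N \<ge> 1 \<Longrightarrow> S \<subseteq> \<Union>(\<P> N)"
    "\<And>N P s s' i. N \<ge> 1 \<Longrightarrow> P \<in> \<P> N \<Longrightarrow> s \<in> P \<Longrightarrow> s' \<in> P \<Longrightarrow> i < q \<Longrightarrow> \<bar>H i s - H i s'\<bar> \<le> L / real N"
    by (rule cell_coverE[OF cc]) (rule that)
  define \<kappa> where "\<kappa> = real C * (2 * \<bar>L\<bar>) ^ q"
  have bound: "emeasure ?M T \<le> ennreal (\<kappa> / real N)" if N: "N \<ge> 1" for N
  proof -
    let ?\<rho> = "\<bar>L\<bar> / real N"
    \<comment> \<open>The values on a cell lie in a box centred at the value of a sample point; for
      an empty cell the box is arbitrary but has the same volume.\<close>
    define box where "box P = (\<Pi>\<^sub>E i\<in>{..<q}. {H i (SOME s. s \<in> P) - ?\<rho> .. H i (SOME s. s \<in> P) + ?\<rho>})" for P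
    have meas: "box P \<in> sets ?M" for P unfolding box_def by (intro sets_PiM_I_finite) auto
    have "emeasure ?M (box P) = (\<Prod>i<q. emeasure lborel {H i (SOME s. s \<in> P) - ?\<rho> .. H i (SOME s. s \<in> P) + ?\<rho>})" for P
      unfolding box_def by (intro emeasure_PiM) auto
    then have em: "emeasure ?M (box P) = ennreal ((2 * ?\<rho>) ^ q)" for P
      by (simp add: ennreal_power)
    have "T \<subseteq> (\<Union>P\<in>\<P> N. box P)"
    proof
      fix t assume "t \<in> T"
      then obtain s where s: "s \<in> S" "t = (\<lambda>i\<in>{..<q}. H i s)" using T(2) by blast
      then obtain P' where P': "P' \<in> \<P> N" "s \<in> P'" using P(3)[OF N] by blast
      then have some: "(SOME s. s \<in> P') \<in> P'" by (metis someI)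
      have "\<bar>H i s - H i (SOME s. s \<in> P')\<bar> \<le> ?\<rho>" if "i < q" for i
        using P(4)[OF N P' some that] by (meson abs_ge_self divide_right_mono of_nat_0_le_iff order_trans)
      then have "H i s \<in> {H i (SOME s. s \<in> P') - ?\<rho> .. H i (SOME s. s \<in> P') + ?\<rho>}" if "i < q" for i
        using that unfolding atLeastAtMost_iff abs_le_iff by (smt (verit))
      then have "t \<in> box P'" unfolding box_def s(2) by (intro restrict_PiE_iff[THEN iffD2]) simp
      then show "t \<in> (\<Union>P\<in>\<P> N. box P)" using P'(1) by blast
    qed
    then have "emeasure ?M T \<le> emeasure ?M (\<Union>P\<in>\<P> N. box P)"
      using meas P(1)[OF N] by (intro emeasure_mono) auto
    also have "\<dots> \<le> (\<Sum>P\<in>\<P> N. emeasure ?M (box P))"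
      using meas P(1)[OF N] by (intro emeasure_subadditive_finite) auto
    also have "\<dots> = ennreal (real (card (\<P> N)) * (2 * ?\<rho>) ^ q)"
      by (simp add: em ennreal_mult ennreal_of_nat_eq_real_of_nat)
    also have "\<dots> \<le> ennreal (\<kappa> / real N)"
    proof (rule ennreal_leI)
      have "real (card (\<P> N)) \<le> real C * real N ^ d" using P(2)[OF N] by (metis of_nat_le_iff of_nat_mult of_nat_power)
      then have "real (card (\<P> N)) * (2 * ?\<rho>) ^ q \<le> real C * real N ^ d * (2 * ?\<rho>) ^ q"
        by (intro mult_right_mono) auto
      also have "\<dots> = \<kappa> * (real N ^ d / real N ^ q)" by (simp add: \<kappa>_def power_divide power_mult_distrib)
      also have "\<dots> \<le> \<kappa> * (1 / real N)"
      proof (rule mult_left_mono)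
        have "real N ^ d * real N \<le> real N ^ q"
          using power_increasing[of "Suc d" q "real N"] \<open>d < q\<close> N by (simp add: mult.commute)
        then show "real N ^ d / real N ^ q \<le> 1 / real N" using N by (simp add: field_simps)
      qed (simp add: \<kappa>_def)
      finally show "real (card (\<P> N)) * (2 * ?\<rho>) ^ q \<le> \<kappa> / real N" by simp
    qed
    finally show ?thesis .
  qed
  have "emeasure ?M T \<le> 0"
  proof (rule ennreal_le_epsilon)
    fix e :: real assume e: "e > 0"
    obtain N where N: "real N > \<kappa> / e" "N \<ge> 1"
      using reals_Archimedean2[of "max (\<kappa> / e) 1"] by auto
    then have "\<kappa> / real N \<le> e" using e by (simp add: field_simps)
    then show "emeasure ?M T \<le> 0 + ennreal e" using bound[OF N(2)] by (simp add: ennreal_leI order_trans)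
  qed
  then show ?thesis using T(1) by (simp add: null_sets_def)
qed

text \<open>Mean value theorem along the segment from y' to y, with the increment expanded in
  coordinates. The bound stays in coordinates because the cells of \<open>cell_cover_ball\<close>
  are coordinate grid cells.\<close>

lemma coordinate_lipschitz:
  fixes h :: "'e::real_normed_vector \<Rightarrow> real" and b :: "nat \<Rightarrow> 'e"
  assumes co: "coordinates n b \<xi>" and S: "convex S" and yy: "y \<in> S" "y' \<in> S"
    and D: "\<And>z. z \<in> S \<Longrightarrow> (h has_derivative D z) (at z)" and M: "\<And>z j. z \<in> S \<Longrightarrow> j < n \<Longrightarrow> \<bar>D z (b j)\<bar> \<le> M"
  shows "\<bar>h y - h y'\<bar> \<le> (\<Sum>j<n. \<bar>\<xi> j (y - y')\<bar> * M)"
proof -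
  let ?l = "\<lambda>s::real. y' + s *\<^sub>R (y - y')"
  have seg: "?l s \<in> S" if "s \<in> {0..1}" for s
  proof -
    have "(1 - s) *\<^sub>R y' + s *\<^sub>R y \<in> S" using convexD[OF S yy(2,1), of "1 - s" s] that by simp
    moreover have "(1 - s) *\<^sub>R y' + s *\<^sub>R y = ?l s" by (simp add: algebra_simps)
    ultimately show ?thesis by simp
  qed
  have "\<exists>s\<in>{0..1}. (h \<circ> ?l) 1 - (h \<circ> ?l) 0 = (D (?l s) \<circ> (\<lambda>t. t *\<^sub>R (y - y'))) (1 - 0)"
  proof (rule mvt_very_simple)
    fix s :: real assume s: "0 \<le> s" "s \<le> 1"
    have "(?l has_derivative (\<lambda>t. t *\<^sub>R (y - y'))) (at s within {0..1})"
      by (auto intro!: derivative_eq_intros)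
    then show "((h \<circ> ?l) has_derivative (D (?l s) \<circ> (\<lambda>t. t *\<^sub>R (y - y')))) (at s within {0..1})"
      using s by (intro diff_chain_within has_derivative_at_withinI[OF D[OF seg]]) auto
  qed simp
  then obtain s where s: "s \<in> {0..1}" "h y - h y' = D (?l s) (y - y')" by auto
  interpret L: bounded_linear "D (?l s)" using D[OF seg[OF s(1)]] by (rule has_derivative_bounded_linear)
  have "D (?l s) (y - y') = D (?l s) (\<Sum>j<n. \<xi> j (y - y') *\<^sub>R b j)" using coordinates_sum[OF co] by simp
  also have "\<dots> = (\<Sum>j<n. \<xi> j (y - y') * D (?l s) (b j))" by (simp add: L.sum L.scaleR)
  finally have "\<bar>h y - h y'\<bar> \<le> (\<Sum>j<n. \<bar>\<xi> j (y - y') * D (?l s) (b j)\<bar>)" using s(2) by simp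
  also have "\<dots> \<le> (\<Sum>j<n. \<bar>\<xi> j (y - y')\<bar> * M)"
  proof (rule sum_mono)
    fix j assume "j \<in> {..<n}"
    then show "\<bar>\<xi> j (y - y') * D (?l s) (b j)\<bar> \<le> \<bar>\<xi> j (y - y')\<bar> * M"
      using M[OF seg[OF s(1)], of j] by (simp add: abs_mult mult_left_mono)
  qed
  finally show ?thesis .
qed

text \<open>A grid of mesh 1/N: the integer parts of \<open>real N * \<xi> j y\<close> label the
  cells, points with equal labels differ by at most 1/N in each coordinate, and the bound M on the
  coordinate derivatives turns this into a Lipschitz estimate.\<close>

lemma cell_cover_ball:
  fixes h :: "nat \<Rightarrow> 'e::real_normed_vector \<Rightarrow> real" and b :: "nat \<Rightarrow> 'e"
  assumes co: "coordinates n b \<xi>"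
    and D: "\<And>i z. i < q \<Longrightarrow> z \<in> ball a \<rho> \<Longrightarrow> (h i has_derivative D i z) (at z)"
    and M: "\<And>i z j. i < q \<Longrightarrow> z \<in> ball a \<rho> \<Longrightarrow> j < n \<Longrightarrow> \<bar>D i z (b j)\<bar> \<le> M"
  shows "cell_cover n q (ball a \<rho>) h"
proof -
  have "bounded (\<Union>j\<in>{..<n}. \<xi> j ` ball a \<rho>)"
    by (intro bounded_UN ballI bounded_linear_image bounded_ball coordinates_linear[OF co]) auto
  then obtain R0 where R0: "\<And>j y. j < n \<Longrightarrow> y \<in> ball a \<rho> \<Longrightarrow> \<bar>\<xi> j y\<bar> \<le> R0"
    unfolding bounded_iff by (metis UN_I imageI lessThan_iff real_norm_def)
  obtain R :: nat where R: "R0 \<le> real R" using real_arch_simple by blast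
  define cell where "cell N k = {y \<in> ball a \<rho>. \<forall>j<n. \<lfloor>real N * \<xi> j y\<rfloor> = k j}" for N :: nat and k
  define I where "I N = (\<Pi>\<^sub>E j\<in>{..<n}. {- (int R * int N) .. int R * int N})" for N :: nat
  show ?thesis
  proof (rule cell_coverI[where \<P> = "\<lambda>N. cell N ` I N" and C = "(2 * R + 1) ^ n" and L = "real n * \<bar>M\<bar>"])
    fix N :: nat assume N: "N \<ge> 1"
    show fin: "finite (cell N ` I N)" unfolding I_def by (intro finite_imageI finite_PiE) auto
    have "card (cell N ` I N) \<le> card (I N)" unfolding I_def by (intro card_image_le finite_PiE) auto
    \<comment> \<open>There are 2RN + 1 labels for each coordinate, and N \<ge> 1 bounds this by (2R
      + 1) N.\<close>
    also have "card (I N) = (2 * R * N + 1) ^ n"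
      by (simp add: I_def card_PiE nat_add_distrib nat_mult_distrib algebra_simps)
    also have "\<dots> \<le> ((2 * R + 1) * N) ^ n" using N by (intro power_mono) auto
    finally show "card (cell N ` I N) \<le> (2 * R + 1) ^ n * N ^ n" by (simp only: power_mult_distrib)
    show "ball a \<rho> \<subseteq> \<Union>(cell N ` I N)"
    proof
      fix y assume y: "y \<in> ball a \<rho>"
      let ?k = "\<lambda>j\<in>{..<n}. \<lfloor>real N * \<xi> j y\<rfloor>"
      have "\<lfloor>real N * \<xi> j y\<rfloor> \<in> {- (int R * int N) .. int R * int N}" if "j < n" for j
      proof -
        have "\<bar>\<xi> j y\<bar> \<le> real R" using R0[OF that y] R by linarith
        then have "real N * \<bar>\<xi> j y\<bar> \<le> real N * real R" by (rule mult_left_mono) simp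
        then have "\<bar>real N * \<xi> j y\<bar> \<le> real_of_int (int R * int N)" by (simp add: abs_mult mult.commute)
        then show ?thesis by (simp add: abs_le_iff le_floor_iff floor_le_iff)
      qed
      then have "?k \<in> I N" unfolding I_def by (intro restrict_PiE_iff[THEN iffD2]) simp
      moreover have "y \<in> cell N ?k" using y by (simp add: cell_def)
      ultimately show "y \<in> \<Union>(cell N ` I N)" by blast
    qed
    fix P y y' i assume P: "P \<in> cell N ` I N" and yy: "y \<in> P" "y' \<in> P" and i: "i < q"
    obtain k where "P = cell N k" using P by blast
    then have y: "y \<in> ball a \<rho>" "y' \<in> ball a \<rho>" and eq: "\<And>j. j < n \<Longrightarrow> \<lfloor>real N * \<xi> j y\<rfloor> = \<lfloor>real N * \<xi> j y'\<rfloor>"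
      using yy by (simp_all add: cell_def)
    have small: "\<bar>\<xi> j (y - y')\<bar> \<le> 1 / real N" if "j < n" for j
    proof -
      have "\<bar>real N * \<xi> j y - real N * \<xi> j y'\<bar> < 1" using eq[OF that] by linarith
      moreover have "real N * \<xi> j (y - y') = real N * \<xi> j y - real N * \<xi> j y'"
        using coordinates_linear[OF co that] by (simp add: linear_simps algebra_simps)
      ultimately have "real N * \<bar>\<xi> j (y - y')\<bar> \<le> 1" by (simp add: abs_mult[symmetric])
      then show ?thesis using N by (simp add: field_simps)
    qed
    have "\<bar>h i y - h i y'\<bar> \<le> (\<Sum>j<n. \<bar>\<xi> j (y - y')\<bar> * M)"
      by (rule coordinate_lipschitz[OF co convex_ball y D[OF i] M[OF i]])
    also have "\<dots> \<le> (\<Sum>j<n. 1 / real N * \<bar>M\<bar>)"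
      using small by (intro sum_mono) (meson abs_ge_self abs_ge_zero lessThan_iff mult_mono' order_trans mult_left_mono mult_right_mono)
    finally show "\<bar>h i y - h i y'\<bar> \<le> real n * \<bar>M\<bar> / real N" by simp
  qed
qed

text \<open>Fubini on the pairs (t, w) for which w is bad after shifting by t. For fixed w these t
  form an image of K that is null by the cell count; hence almost every t has a null section, and
  the small cube around 0 has positive measure.\<close>

lemma exists_small_null_section:
  fixes K :: "'a::topological_space set" and L :: "nat \<Rightarrow> 'f::euclidean_space set"
  assumes K: "compact K" and L: "\<And>i. i < q \<Longrightarrow> compact (L i)"
    and h: "\<And>i. i < q \<Longrightarrow> continuous_on (K \<times> L i) (h i)"
    and cc: "\<And>w. w \<in> PiE {..<q} L \<Longrightarrow> cell_cover d q K (\<lambda>i x. h i (x, w i))" and "d < q" and "\<delta> > 0"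
  shows "\<exists>t. (\<forall>i<q. \<bar>t i\<bar> < \<delta>) \<and> zeros q K L (\<lambda>i z. h i z + t i) 0 \<in> null_sets (lborel_power {..<q})"
proof -
  interpret R: product_sigma_finite "\<lambda>_::nat. lborel :: real measure" by (rule lborel_power_product)
  let ?M = "lborel_power {..<q} :: (nat \<Rightarrow> real) measure" and ?N = "lborel_power {..<q} :: (nat \<Rightarrow> 'f) measure"
  interpret pair_sigma_finite ?M ?N
    by (intro pair_sigma_finite.intro sigma_finite_lborel_power) auto
  \<comment> \<open>w is bad for the shift t exactly when \<open>t = G x w\<close> for some x in K;
    the bad pairs are thus a continuous image of a compact set, and so measurable.\<close>
  define G where "G x w = (\<lambda>i\<in>{..<q}. - h i (x, w i))" for x and w :: "nat \<Rightarrow> 'f"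
  let ?P = "K \<times> PiE {..<q} L"
  define X where "X = (\<lambda>z. (G (fst z) (snd z), snd z)) ` ?P"
  have X_iff: "(t, w) \<in> X \<longleftrightarrow> w \<in> PiE {..<q} L \<and> t \<in> (\<lambda>x. G x w) ` K" for t w
    unfolding X_def by (force simp: image_iff)
  have P: "compact ?P" using K L by (intro compact_Times compact_PiE) auto
  have cont: "continuous_on ?P (\<lambda>z. h i (fst z, snd z i))" if "i < q" for i
    by (rule continuous_on_eval_coordinate[where L = L and i = i, OF h[OF that]]) (simp add: that)
  have contG: "continuous_on ?P (\<lambda>z. G (fst z) (snd z))"
  proof (rule continuous_on_coordinatewise_then_product)
    fix i show "continuous_on ?P (\<lambda>z. G (fst z) (snd z) i)"
      by (cases "i < q") (auto simp: G_def intro!: continuous_on_minus cont)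
  qed
  have XP: "X \<subseteq> PiE {..<q} (\<lambda>_. UNIV) \<times> PiE {..<q} (\<lambda>_. UNIV)"
  proof (rule subsetI)
    fix z assume "z \<in> X"
    then have "snd z \<in> PiE {..<q} L" "fst z \<in> (\<lambda>x. G x (snd z)) ` K"
      using X_iff[of "fst z" "snd z"] by simp_all
    then obtain x where "fst z = G x (snd z)" "snd z \<in> PiE {..<q} L" by blast
    then have "fst z \<in> extensional {..<q}" "snd z \<in> extensional {..<q}"
      by (simp add: G_def, simp add: PiE_def)
    then show "z \<in> PiE {..<q} (\<lambda>_. UNIV) \<times> PiE {..<q} (\<lambda>_. UNIV)"
      unfolding mem_Times_iff PiE_iff by simp
  qed
  have "compact X"
    unfolding X_def by (intro compact_continuous_image P continuous_on_Pair contG continuous_on_snd continuous_on_id)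
  then have X: "X \<in> sets (?M \<Otimes>\<^sub>M ?N)" using XP by (rule compact_in_sets_lborel_power_pair)
  have sec: "emeasure ?M ((\<lambda>t. (t, w)) -` X) = 0" for w
  proof (cases "w \<in> PiE {..<q} L")
    case False
    then have "(\<lambda>t. (t, w)) -` X = {}" using X_iff by blast
    then show ?thesis by simp
  next
    case True
    have eq: "(\<lambda>t. (t, w)) -` X = (\<lambda>x. \<lambda>i\<in>{..<q}. - h i (x, w i)) ` K"
      using X_iff True unfolding G_def by blast
    have "cell_cover d q K (\<lambda>i x. - h i (x, w i))"
      using cc[OF True] unfolding cell_cover_def by (simp add: abs_minus_commute)
    moreover have "(\<lambda>t. (t, w)) -` X \<in> sets ?M" by (rule sets_Pair2[OF X])
    ultimately have "(\<lambda>t. (t, w)) -` X \<in> null_sets ?M"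
      using eq by (intro cell_cover_null[OF _ \<open>d < q\<close>]) auto
    then show ?thesis by auto
  qed
  have "emeasure (?M \<Otimes>\<^sub>M ?N) X = 0"
    unfolding emeasure_pair_measure_alt2[OF X] sec by simp
  then have "(\<integral>\<^sup>+ t. emeasure ?N (Pair t -` X) \<partial>?M) = 0"
    using M2.emeasure_pair_measure_alt[OF X] by simp
  then have ae: "AE t in ?M. emeasure ?N (Pair t -` X) = 0"
    using nn_integral_0_iff_AE[OF M2.measurable_emeasure_Pair[OF X]] by blast
  let ?B = "\<Pi>\<^sub>E i\<in>{..<q}. {-\<delta><..<\<delta>}"
  have B: "?B \<in> sets ?M" by (intro sets_PiM_I_finite) auto
  have "emeasure ?M ?B = (\<Prod>i<q. emeasure lborel {-\<delta><..<\<delta>})" by (intro R.emeasure_PiM) auto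
  also have "\<dots> = ennreal (2 * \<delta>) ^ q" using \<open>\<delta> > 0\<close> by simp
  also have "\<dots> \<noteq> 0" using \<open>\<delta> > 0\<close> by simp
  finally have "?B \<notin> null_sets ?M" by (simp add: null_sets_def)
  then have not_ae: "\<not> (AE t in ?M. t \<notin> ?B)" by (simp only: AE_iff_null_sets[OF B] not_False_eq_True)
  have "\<exists>t\<in>?B. emeasure ?N (Pair t -` X) = 0"
  proof (rule ccontr)
    assume "\<not> (\<exists>t\<in>?B. emeasure ?N (Pair t -` X) = 0)"
    then have "AE t in ?M. t \<notin> ?B" using ae by (elim eventually_mono) blast
    then show False using not_ae by contradiction
  qed
  then obtain t where t: "t \<in> ?B" "emeasure ?N (Pair t -` X) = 0" by blast
  have "zeros q K L (\<lambda>i z. h i z + t i) 0 = Pair t -` X"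
  proof (rule set_eqI)
    fix w
    have "t = G x w \<longleftrightarrow> (\<forall>i<q. \<bar>h i (x, w i) + t i\<bar> \<le> 0)" for x
    proof -
      have "t = G x w \<longleftrightarrow> (\<forall>i<q. t i = - h i (x, w i))"
        using t(1) unfolding G_def by (auto simp: fun_eq_iff PiE_iff extensional_def)
      also have "\<dots> \<longleftrightarrow> (\<forall>i<q. \<bar>h i (x, w i) + t i\<bar> \<le> 0)" by (auto simp: eq_neg_iff_add_eq_0 add.commute)
      finally show ?thesis .
    qed
    then show "w \<in> zeros q K L (\<lambda>i z. h i z + t i) 0 \<longleftrightarrow> w \<in> Pair t -` X"
      unfolding zeros_def vimage_def mem_Collect_eq X_iff image_iff by simp
  qed
  moreover have "Pair t -` X \<in> sets ?N" by (rule sets_Pair1[OF X])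
  ultimately have "zeros q K L (\<lambda>i z. h i z + t i) 0 \<in> null_sets ?N" using t(2) by (simp add: null_sets_def)
  moreover have "\<bar>t i\<bar> < \<delta>" if "i < q" for i
    using PiE_mem[OF t(1), of i] that by (simp add: abs_less_iff)
  ultimately show ?thesis by blast
qed

subsection \<open>Closed sets of measure zero in powers of a manifold\<close>

lemma measure_zero_subset:
  assumes "measure_zero B q S" "T \<subseteq> S"
  shows "measure_zero B q T"
  unfolding measure_zero_def
proof (intro allI impI)
  fix c :: "nat \<Rightarrow> ('a, 'b) chart" assume c: "\<forall>i<q. c i \<in> max_atlas B"
  let ?F = "\<lambda>u. \<lambda>i\<in>{..<q}. snd (c i) (u i)"
    and ?D = "\<Pi>\<^sub>E i\<in>{..<q}. fst (c i)"
  have "?F ` (S \<inter> ?D) \<in> null_sets (completion (lborel_power {..<q}))"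
    using assms(1) c unfolding measure_zero_def by blast
  then show "?F ` (T \<inter> ?D) \<in> null_sets (completion (lborel_power {..<q}))"
    by (rule null_sets_completion_subset[rotated]) (use assms(2) in blast)
qed

lemma measure_zero_Union:
  assumes "countable \<Z>" "\<And>Z. Z \<in> \<Z> \<Longrightarrow> measure_zero B q Z"
  shows "measure_zero B q (\<Union>\<Z>)"
  unfolding measure_zero_def
proof (intro allI impI)
  fix c :: "nat \<Rightarrow> ('a, 'b) chart" assume c: "\<forall>i<q. c i \<in> max_atlas B"
  let ?F = "\<lambda>u. \<lambda>i\<in>{..<q}. snd (c i) (u i)"
    and ?D = "\<Pi>\<^sub>E i\<in>{..<q}. fst (c i)"
  have "?F ` (\<Union>\<Z> \<inter> ?D) = (\<Union>Z\<in>\<Z>. ?F ` (Z \<inter> ?D))" by blast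
  moreover have "\<dots> \<in> null_sets (completion (lborel_power {..<q}))"
    using assms c by (intro null_sets_UN') (auto simp: measure_zero_def)
  ultimately show "?F ` (\<Union>\<Z> \<inter> ?D) \<in> null_sets (completion (lborel_power {..<q}))" by simp
qed

lemma open_pos_emeasure:
  fixes S :: "'f::euclidean_space set"
  assumes "open S" "S \<noteq> {}"
  shows "emeasure lborel S \<noteq> 0"
proof
  assume "emeasure lborel S = 0"
  then have "S \<in> null_sets lborel" using assms(1) by (simp add: null_sets_def)
  then have "S \<in> null_sets lebesgue" by (rule null_sets_completionI)
  then show False using open_not_negligible[OF assms] negligible_iff_null_sets by blast
qed

text \<open>A nonempty open subset of Z would contain a box, and after shrinking it to chart domains
  its image is a nonempty open box, of positive measure.\<close>

lemma closed_measure_zero_complement: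
  fixes B :: "('u::topological_space, 'f::euclidean_space) chart set"
  assumes B: "smooth_atlas B" and Z: "closedin (power_topology q) Z" "measure_zero B q Z"
  shows "openin (power_topology q) (topspace (power_topology q) - Z)"
    and "power_topology q closure_of (topspace (power_topology q) - Z) = topspace (power_topology q)"
proof -
  show "openin (power_topology q) (topspace (power_topology q) - Z)" using Z(1) by blast
  show "power_topology q closure_of (topspace (power_topology q) - Z) = topspace (power_topology q)"
    unfolding dense_intersects_open
  proof (intro allI impI notI)
    fix V :: "(nat \<Rightarrow> 'u) set"
    assume V: "openin (power_topology q) V \<and> V \<noteq> {}" and "(topspace (power_topology q) - Z) \<inter> V = {}"
    then have VZ: "V \<subseteq> Z" using openin_subset by blast
    obtain u where u: "u \<in> V" using V by blast
    obtain X where X: "u \<in> PiE {..<q} X" "\<And>i. open (X i)" "PiE {..<q} X \<subseteq> V"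
      using product_topology_open_contains_basis[OF conjunct1[OF V] u] by auto
    have "\<exists>c\<in>B. u i \<in> fst c" for i by (rule atlas_covers[OF B])
    then obtain c where c: "\<And>i. c i \<in> B" "\<And>i. u i \<in> fst (c i)" by metis
    have m: "c i \<in> max_atlas B" for i using c(1) atlas_subset_max_atlas[OF B] by blast
    note ch = max_atlas_is_chart[OF m]
    let ?F = "\<lambda>u. \<lambda>i\<in>{..<q}. snd (c i) (u i)"
    and ?D = "\<Pi>\<^sub>E i\<in>{..<q}. fst (c i)"
    define W where "W i = snd (c i) ` (X i \<inter> fst (c i))" for i
    have W: "open (W i)" for i
      unfolding W_def by (intro chart_image_open ch open_Int X is_chartD(1)[OF ch]) simp
    have Wne: "W i \<noteq> {}" if "i < q" for i
      using PiE_mem[OF X(1), of i] c(2)[of i] that unfolding W_def by auto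
    have "PiE {..<q} W \<subseteq> ?F ` (Z \<inter> ?D)"
    proof
      fix w assume w: "w \<in> PiE {..<q} W"
      have "\<exists>v. v \<in> X i \<inter> fst (c i) \<and> w i = snd (c i) v" if "i < q" for i
        using PiE_mem[OF w, of i] that unfolding W_def by auto
      then obtain v where v: "\<And>i. i < q \<Longrightarrow> v i \<in> X i \<inter> fst (c i) \<and> w i = snd (c i) (v i)" by metis
      let ?v = "restrict v {..<q}"
      have "?v \<in> PiE {..<q} X" "?v \<in> ?D"
        using v by (auto simp: restrict_PiE_iff)
      then have vZ: "?v \<in> Z \<inter> ?D" using X(3) VZ by blast
      have "w = ?F ?v"
        using v PiE_arb[OF w] by (auto simp: fun_eq_iff)
      then show "w \<in> ?F ` (Z \<inter> ?D)" by (rule image_eqI[OF _ vZ])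
    qed
    moreover have "?F ` (Z \<inter> ?D) \<in> null_sets (completion (lborel_power {..<q}))"
      using Z(2) m unfolding measure_zero_def by blast
    ultimately have "PiE {..<q} W \<in> null_sets (completion (lborel_power {..<q}))"
      by (rule null_sets_completion_subset)
    moreover have box: "PiE {..<q} W \<in> sets (lborel_power {..<q})"
      using W by (intro sets_PiM_I_finite) auto
    ultimately have "emeasure (lborel_power {..<q}) (PiE {..<q} W) = 0"
      by (simp add: null_sets_completion_iff null_sets_def)
    moreover have "emeasure (lborel_power {..<q}) (PiE {..<q} W) = (\<Prod>i<q. emeasure lborel (W i))"
      using W by (intro product_sigma_finite.emeasure_PiM[OF lborel_power_product]) auto
    ultimately obtain i where "i < q" "emeasure lborel (W i) = 0" by (auto simp: prod_zero_iff)
    then show False using open_pos_emeasure[OF W Wne] by blast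
  qed
qed

lemma Hausdorff_space_t2: "Hausdorff_space (euclidean :: 'u::t2_space topology)"
  unfolding Hausdorff_space_def using hausdorff by (auto simp: disjnt_def)

lemma closedin_diagonal:
  fixes i j :: nat
  assumes "i < q" "j < q"
  shows "closedin (power_topology q) {u \<in> PiE {..<q} (\<lambda>_. UNIV :: 'u::t2_space set). u i = u j}"
  using closedin_continuous_maps_eq[OF Hausdorff_space_t2, of "power_topology q" "\<lambda>u. u i" "\<lambda>u. u j"]
    continuous_map_product_projection[of i "{..<q}" "\<lambda>_. euclidean :: 'u topology"]
    continuous_map_product_projection[of j "{..<q}" "\<lambda>_. euclidean :: 'u topology"] assms
  by simp

text \<open>Fixing the j-th coordinate leaves at most one value for the i-th, so every section lies
  in a box with a one-point side. The equation reads \<open>?g i (w i) = ?g j (w j)\<close> since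
  the two coordinates may use different charts.\<close>

lemma diagonal_measure_zero:
  fixes B :: "('u::t2_space, 'f::euclidean_space) chart set"
  assumes ij: "i < q" "j < q" "i \<noteq> j"
  shows "measure_zero B q {u \<in> PiE {..<q} (\<lambda>_. UNIV). u i = u j}" (is "measure_zero B q ?\<Delta>")
  unfolding measure_zero_def
proof (intro allI impI)
  fix c :: "nat \<Rightarrow> ('u, 'f) chart" assume c: "\<forall>i<q. c i \<in> max_atlas B"
  then have ch: "is_chart (c k)" if "k < q" for k using max_atlas_is_chart that by blast
  let ?g = "\<lambda>k. inv_into (fst (c k)) (snd (c k))"
  let ?C = "\<lambda>k. snd (c k) ` fst (c k)"
  let ?F = "\<lambda>u. \<lambda>i\<in>{..<q}. snd (c i) (u i)"
    and ?D = "\<Pi>\<^sub>E i\<in>{..<q}. fst (c i)"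
  define E where "E = {w :: nat \<Rightarrow> 'f. w i \<in> ?C i \<and> w j \<in> ?C j}"
  define N where "N = {w \<in> PiE {..<q} (\<lambda>_. UNIV). w \<in> E \<and> ?g i (w i) = ?g j (w j)}"
  have proj: "continuous_on S (\<lambda>w :: nat \<Rightarrow> 'f. w k)" for k S
    by (rule continuous_on_subset[OF continuous_on_product_coordinates]) simp
  have E: "open E"
  proof -
    have "open ((\<lambda>w. w k) -` ?C k :: (nat \<Rightarrow> 'f) set)" if "k < q" for k
      by (rule open_vimage[OF is_chartD(2)[OF ch[OF that]] proj])
    from open_Int[OF this[OF ij(1)] this[OF ij(2)]] show ?thesis
      by (simp add: E_def vimage_def Collect_conj_eq)
  qed
  have gc: "continuous_on E (\<lambda>w. ?g k (w k))" if "k < q" "\<And>w. w \<in> E \<Longrightarrow> w k \<in> ?C k" for k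
    by (rule continuous_on_compose2[OF is_chartD(4)[OF ch[OF that(1)]] proj]) (use that(2) in blast)
  \<comment> \<open>Both chart inverses are continuous on the open set E and the manifold is
    Hausdorff, so the solution set is relatively closed in E and hence Borel.\<close>
  have "closedin (top_of_set E) {w \<in> topspace (top_of_set E). ?g i (w i) = ?g j (w j)}"
    using gc[OF ij(1)] gc[OF ij(2)] by (intro closedin_continuous_maps_eq[OF Hausdorff_space_t2]) (auto simp: E_def)
  then obtain T where T: "closed T" "{w \<in> E. ?g i (w i) = ?g j (w j)} = E \<inter> T"
    by (auto simp: closedin_closed)
  then have borel: "{w \<in> E. ?g i (w i) = ?g j (w j)} \<in> sets borel" using E by simp
  have "N = (\<lambda>w. w) -` {w \<in> E. ?g i (w i) = ?g j (w j)} \<inter> space (lborel_power {..<q})"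
    by (auto simp: N_def space_PiM)
  then have N: "N \<in> sets (lborel_power {..<q})"
    using measurable_sets[OF measurable_lborel_power_borel borel, of "{..<q}"] by simp
  let ?I = "{..<q} - {j}"
  have I: "insert j ?I = {..<q}" using ij by auto
  have "{y \<in> space (lborel_power ?I). y(j := x) \<in> N} \<in> null_sets (lborel_power ?I)" for x
  proof (rule null_sets_subset)
    let ?H = "PiE ?I (\<lambda>k. if k = i then {snd (c i) (?g j x)} else UNIV) :: (nat \<Rightarrow> 'f) set"
    have "emeasure (lborel_power ?I) ?H = (\<Prod>k\<in>?I. emeasure lborel (if k = i then {snd (c i) (?g j x)} else UNIV))"
      by (intro product_sigma_finite.emeasure_PiM[OF lborel_power_product]) auto
    also have "\<dots> = 0" using ij by (intro prod_zero bexI[of _ i]) auto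
    finally show "?H \<in> null_sets (lborel_power ?I)"
      by (auto simp: null_sets_def intro!: sets_PiM_I_finite)
    have [measurable]: "N \<in> sets (lborel_power (insert j ?I))" by (simp only: I N)
    show "{y \<in> space (lborel_power ?I). y(j := x) \<in> N} \<in> sets (lborel_power ?I)" by measurable
    show "{y \<in> space (lborel_power ?I). y(j := x) \<in> N} \<subseteq> ?H"
    proof
      fix y assume y: "y \<in> {y \<in> space (lborel_power ?I). y(j := x) \<in> N}"
      then have *: "y i \<in> ?C i" "?g i (y i) = ?g j x" using ij by (auto simp: N_def E_def)
      then have "y i = snd (c i) (?g j x)" by (metis f_inv_into_f)
      moreover have "y \<in> extensional ?I" using y by (simp add: space_PiM PiE_def)
      ultimately show "y \<in> ?H" by (simp add: PiE_iff)
    qed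
  qed
  then have null: "N \<in> null_sets (lborel_power {..<q})"
    using null_sets_lborel_power_insert[of ?I j N] N unfolding I by simp
  have "?F ` (?\<Delta> \<inter> ?D) \<subseteq> N"
  proof
    fix w assume "w \<in> ?F ` (?\<Delta> \<inter> ?D)"
    then obtain u where u: "u i = u j" "u \<in> ?D" "w = ?F u" by blast
    have "u k \<in> fst (c k)" if "k < q" for k using PiE_mem[OF u(2), of k] that by simp
    then have wk: "w k \<in> ?C k" "?g k (w k) = u k" if "k < q" for k
      using is_chartD(5)[OF ch[OF that], of "u k"] that by (simp_all add: u(3))
    have "w \<in> PiE {..<q} (\<lambda>_. UNIV)" unfolding u(3) restrict_PiE_iff by simp
    moreover have "?g i (w i) = ?g j (w j)" unfolding wk(2)[OF ij(1)] wk(2)[OF ij(2)] by (rule u(1))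
    ultimately show "w \<in> N" unfolding N_def E_def using wk(1)[OF ij(1)] wk(1)[OF ij(2)] by blast
  qed
  then show "?F ` (?\<Delta> \<inter> ?D) \<in> null_sets (completion (lborel_power {..<q}))"
    by (rule null_sets_completion_subset[OF _ null_sets_completionI[OF null]])
qed

text \<open>The preimage under one transition is contained in the image under the opposite one, and
  a differentiable map between spaces of equal dimension sends null sets to null sets.\<close>

lemma transition_null_vimage:
  fixes c \<psi> :: "('u::topological_space, 'f::euclidean_space) chart"
  assumes c: "is_chart c" "is_chart \<psi>" and t: "smooth_transition c \<psi>" "smooth_transition \<psi> c"
    and S: "S \<in> null_sets lborel"
  shows "{w \<in> snd c ` (fst c \<inter> fst \<psi>). in_chart c (snd \<psi>) w \<in> S} \<in> null_sets lborel"
proof -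
  let ?C = "snd c ` (fst c \<inter> fst \<psi>)" and ?P = "snd \<psi> ` (fst \<psi> \<inter> fst c)"
  let ?T = "{w \<in> ?C. in_chart c (snd \<psi>) w \<in> S}"
  have o: "open ?C" by (intro chart_image_open c open_Int is_chartD(1)) auto
  have cont: "continuous_on ?C (in_chart c (snd \<psi>))"
    using t(1) smooth_on_continuous_on by (auto simp: smooth_transition_def)
  have "(\<lambda>w. if w \<in> ?C then in_chart c (snd \<psi>) w else 0) \<in> borel_measurable borel"
    using o cont by (intro borel_measurable_continuous_on_if continuous_on_const) auto
  then have "(\<lambda>w. if w \<in> ?C then in_chart c (snd \<psi>) w else 0) -` S \<inter> space borel \<in> sets borel"
    using S by (intro measurable_sets) auto
  then have "?C \<inter> ((\<lambda>w. if w \<in> ?C then in_chart c (snd \<psi>) w else 0) -` S \<inter> space borel) \<in> sets borel"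
    using o by (intro sets.Int) auto
  moreover have "?C \<inter> ((\<lambda>w. if w \<in> ?C then in_chart c (snd \<psi>) w else 0) -` S \<inter> space borel) = ?T" by auto
  ultimately have meas: "?T \<in> sets borel" by simp
  have "negligible (S \<inter> ?P)"
    using S null_sets_completionI[OF S] negligible_iff_null_sets negligible_subset[of S "S \<inter> ?P"] by auto
  moreover have "in_chart \<psi> (snd c) differentiable_on (S \<inter> ?P)"
    unfolding differentiable_on_def
  proof
    fix w assume "w \<in> S \<inter> ?P"
    then have "(in_chart \<psi> (snd c) has_derivative frechet_derivative (in_chart \<psi> (snd c)) (at w)) (at w)"
      using t(2) smooth_on_has_derivative by (auto simp: smooth_transition_def)
    then show "in_chart \<psi> (snd c) differentiable (at w within S \<inter> ?P)"
      using differentiableI differentiable_at_withinI by blast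
  qed
  ultimately have "negligible (in_chart \<psi> (snd c) ` (S \<inter> ?P))"
    by (rule negligible_differentiable_image_negligible[OF order_refl])
  moreover have "?T \<subseteq> in_chart \<psi> (snd c) ` (S \<inter> ?P)"
  proof
    fix w assume "w \<in> ?T"
    then obtain u where u: "u \<in> fst c" "u \<in> fst \<psi>" "w = snd c u" "in_chart c (snd \<psi>) w \<in> S" by auto
    then have "snd \<psi> u \<in> S \<inter> ?P" using in_chart_apply[OF c(1) u(1), of "snd \<psi>"] by auto
    moreover have "w = in_chart \<psi> (snd c) (snd \<psi> u)" using in_chart_apply[OF c(2) u(2), of "snd c"] u(3) by simp
    ultimately show "w \<in> in_chart \<psi> (snd c) ` (S \<inter> ?P)" by blast
  qed
  ultimately have "negligible ?T" by (rule negligible_subset)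
  then have "?T \<in> null_sets (completion lborel)" by (simp add: negligible_iff_null_sets)
  then show ?thesis using meas by (simp add: null_sets_completion_iff)
qed

text \<open>\<open>measure_zero\<close> tests all product charts, but coordinatewise transitions
  pull null sets back, so the one product chart containing Z decides.\<close>

lemma measure_zero_chart_independent:
  fixes B :: "('u::t2_space, 'f::euclidean_space) chart set"
  assumes B: "smooth_atlas B" and \<psi>: "\<And>i. i < q \<Longrightarrow> \<psi> i \<in> B" and Z: "Z \<subseteq> (\<Pi>\<^sub>E i\<in>{..<q}. fst (\<psi> i))"
    and null: "(\<lambda>u. \<lambda>i\<in>{..<q}. snd (\<psi> i) (u i)) ` Z \<in> null_sets (lborel_power {..<q})"
  shows "measure_zero B q Z"
  unfolding measure_zero_def
proof (intro allI impI)
  fix c :: "nat \<Rightarrow> ('u, 'f) chart" assume c: "\<forall>i<q. c i \<in> max_atlas B"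
  then have ch: "is_chart (c k)" if "k < q" for k using max_atlas_is_chart that by blast
  have ch': "is_chart (\<psi> k)" if "k < q" for k using B \<psi>[OF that] by (simp add: smooth_atlas_def)
  have tr: "smooth_transition (c k) (\<psi> k)" "smooth_transition (\<psi> k) (c k)" if "k < q" for k
    using c \<psi>[OF that] that by (auto simp: max_atlas_def)
  let ?C = "\<lambda>k. snd (c k) ` (fst (c k) \<inter> fst (\<psi> k))" and ?g = "\<lambda>k. in_chart (c k) (snd (\<psi> k))"
  let ?A = "(\<lambda>u. \<lambda>i\<in>{..<q}. snd (\<psi> i) (u i)) ` Z"
  let ?F = "\<lambda>u. \<lambda>i\<in>{..<q}. snd (c i) (u i)"
    and ?D = "\<Pi>\<^sub>E i\<in>{..<q}. fst (c i)"
  have "{w \<in> Pi\<^sub>E {..<q} ?C. (\<lambda>i\<in>{..<q}. ?g i (w i)) \<in> ?A} \<in> null_sets (lborel_power {..<q})"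
  proof (rule null_sets_lborel_power_vimage)
    show "finite {..<q}" by simp
    show "?A \<in> null_sets (lborel_power {..<q})" by (rule null)
    fix i assume "i \<in> {..<q}"
    then have i: "i < q" by simp
    show "open (?C i)" by (intro chart_image_open ch i open_Int is_chartD(1)[OF ch[OF i]] is_chartD(1)[OF ch'[OF i]]) auto
    show "continuous_on (?C i) (?g i)"
      using tr(1)[OF i] smooth_on_continuous_on by (auto simp: smooth_transition_def)
    show "{w \<in> ?C i. ?g i w \<in> S} \<in> null_sets lborel" if "S \<in> null_sets lborel" for S
      by (rule transition_null_vimage[OF ch[OF i] ch'[OF i] tr(1)[OF i] tr(2)[OF i] that])
  qed
  moreover have "?F ` (Z \<inter> ?D) \<subseteq> {w \<in> Pi\<^sub>E {..<q} ?C. (\<lambda>i\<in>{..<q}. ?g i (w i)) \<in> ?A}"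
  proof
    fix w assume "w \<in> ?F ` (Z \<inter> ?D)"
    then obtain u where u: "u \<in> Z" "u \<in> ?D" "w = ?F u" by blast
    have uk: "u k \<in> fst (c k) \<inter> fst (\<psi> k)" if "k < q" for k
      using PiE_mem[OF u(2), of k] PiE_mem[OF subsetD[OF Z u(1)], of k] that by simp
    have "?g k (w k) = snd (\<psi> k) (u k)" if "k < q" for k
      using in_chart_apply[OF ch[OF that], of "u k" "snd (\<psi> k)"] uk[OF that] that u(3) by simp
    then have "(\<lambda>i\<in>{..<q}. ?g i (w i)) = (\<lambda>i\<in>{..<q}. snd (\<psi> i) (u i))" by (intro restrict_ext) simp
    then have "(\<lambda>i\<in>{..<q}. ?g i (w i)) \<in> ?A" using u(1) by blast
    moreover have "w \<in> Pi\<^sub>E {..<q} ?C" unfolding u(3) restrict_PiE_iff using uk by blast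
    ultimately show "w \<in> {w \<in> Pi\<^sub>E {..<q} ?C. (\<lambda>i\<in>{..<q}. ?g i (w i)) \<in> ?A}" by blast
  qed
  ultimately show "?F ` (Z \<inter> ?D) \<in> null_sets (completion (lborel_power {..<q}))"
    using null_sets_completion_subset null_sets_completionI by blast
qed

text \<open>\<open>compact\<close> refers to the space of all functions on the naturals, the
  conclusion to the power over \<open>{..<q}\<close>; the identity is continuous from Z into the
  power, which is Hausdorff.\<close>

lemma closedin_power_compact:
  fixes Z :: "(nat \<Rightarrow> 'u::t2_space) set"
  assumes "compact Z" "Z \<subseteq> PiE {..<q} (\<lambda>_. UNIV)"
  shows "closedin (power_topology q) Z"
proof (rule compactin_imp_closedin)
  show "Hausdorff_space (power_topology q :: (nat \<Rightarrow> 'u) topology)"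
    by (simp add: Hausdorff_space_product_topology Hausdorff_space_t2)
  have "continuous_map (top_of_set Z) (power_topology q) (\<lambda>z. z)"
    unfolding continuous_map_componentwise
  proof (intro conjI ballI)
    show "(\<lambda>z. z) ` topspace (top_of_set Z) \<subseteq> extensional {..<q}" using assms(2) by (auto simp: PiE_def)
    fix k show "continuous_map (top_of_set Z) euclidean (\<lambda>z. z k)"
      by (simp add: continuous_on_subset[OF continuous_on_product_coordinates])
  qed
  moreover have "compactin (top_of_set Z) Z" using assms(1) by (simp add: compactin_subtopology)
  ultimately show "compactin (power_topology q) Z" using image_compactin by fastforce
qed

subsection \<open>Coincidences of two parameters\<close>

text \<open>Cells are pulled back along f; with f a chart, this carries the grid from the model
  space to the manifold.\<close>

lemma cell_cover_vimage:
  assumes "cell_cover d q S h" "\<And>x. x \<in> T \<Longrightarrow> f x \<in> S" "\<And>i x. i < q \<Longrightarrow> x \<in> T \<Longrightarrow> H i x = h i (f x)"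
  shows "cell_cover d q T H"
proof -
  obtain C L \<P> where P: "\<And>N. N \<ge> 1 \<Longrightarrow> finite (\<P> N)" "\<And>N. N \<ge> 1 \<Longrightarrow> card (\<P> N) \<le> C * N ^ d"
    "\<And>N. N \<ge> 1 \<Longrightarrow> S \<subseteq> \<Union>(\<P> N)"
    "\<And>N P s s' i. N \<ge> 1 \<Longrightarrow> P \<in> \<P> N \<Longrightarrow> s \<in> P \<Longrightarrow> s' \<in> P \<Longrightarrow> i < q \<Longrightarrow> \<bar>h i s - h i s'\<bar> \<le> L / real N"
    by (rule cell_coverE[OF assms(1)]) (rule that)
  let ?Q = "\<lambda>P. {x \<in> T. f x \<in> P}"
  show ?thesis
  proof (rule cell_coverI[where \<P> = "\<lambda>N. ?Q ` \<P> N" and C = C and L = L])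
    fix N :: nat assume N: "N \<ge> 1"
    show "finite (?Q ` \<P> N)" using P(1)[OF N] by simp
    show "card (?Q ` \<P> N) \<le> C * N ^ d"
      using card_image_le[OF P(1)[OF N], of ?Q] P(2)[OF N] by simp
    show "T \<subseteq> \<Union>(?Q ` \<P> N)" using assms(2) P(3)[OF N] by blast
    fix X x y i assume "X \<in> ?Q ` \<P> N" "x \<in> X" "y \<in> X" and i: "i < q"
    then obtain P where "P \<in> \<P> N" "x \<in> T" "y \<in> T" "f x \<in> P" "f y \<in> P" by blast
    then show "\<bar>H i x - H i y\<bar> \<le> L / real N" using P(4)[OF N _ _ _ i] assms(3)[OF i] by simp
  qed
qed

lemma disjoint_neighbourhoods:
  fixes u :: "nat \<Rightarrow> 'u::t2_space"
  assumes "inj_on u {..<q}"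
  obtains V where "\<And>i. i < q \<Longrightarrow> open (V i)" "\<And>i. i < q \<Longrightarrow> u i \<in> V i"
    "\<And>i j. i < q \<Longrightarrow> j < q \<Longrightarrow> i \<noteq> j \<Longrightarrow> V i \<inter> V j = {}"
proof -
  have "\<exists>P Q. u i \<noteq> u j \<longrightarrow> open P \<and> open Q \<and> u i \<in> P \<and> u j \<in> Q \<and> P \<inter> Q = {}" for i j
  proof (cases "u i = u j")
    case False
    from hausdorff[OF this] obtain P Q where "open P" "open Q" "u i \<in> P" "u j \<in> Q" "P \<inter> Q = {}" by blast
    then show ?thesis by (intro exI[of _ P] exI[of _ Q]) simp
  qed simp
  then obtain P where "\<forall>i j. \<exists>Q. u i \<noteq> u j \<longrightarrow> open (P i j) \<and> open Q \<and> u i \<in> P i j \<and> u j \<in> Q \<and> P i j \<inter> Q = {}"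
    by metis
  then obtain Q where PQ: "\<And>i j. u i \<noteq> u j \<Longrightarrow> open (P i j) \<and> open (Q i j) \<and> u i \<in> P i j \<and> u j \<in> Q i j \<and> P i j \<inter> Q i j = {}"
    by metis
  have ne: "u i \<noteq> u j" if "i < q" "j < q" "i \<noteq> j" for i j
    using assms that by (auto dest: inj_onD)
  \<comment> \<open>The separating pairs are chosen independently for (i, j) and (j, i). Taking both
    \<open>P i j\<close> and \<open>Q j i\<close> puts \<open>V i\<close> and \<open>V j\<close> on
    the two sides of the same pair.\<close>
  define V where "V i = (\<Inter>j\<in>{..<q} - {i}. P i j \<inter> Q j i)" for i
  show ?thesis
  proof (rule that)
    show "open (V i)" if "i < q" for i
      unfolding V_def using PQ ne that by (intro open_INT) auto
    show "u i \<in> V i" if "i < q" for i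
      unfolding V_def using PQ ne that by auto
    show "V i \<inter> V j = {}" if "i < q" "j < q" "i \<noteq> j" for i j
    proof -
      have "V i \<subseteq> P i j" "V j \<subseteq> Q i j" unfolding V_def using that by auto
      then show ?thesis using PQ[OF ne[OF that]] by blast
    qed
  qed
qed

definition gap :: "('x \<times> 'u \<Rightarrow> real) \<Rightarrow> ('x \<times> 'x) \<times> 'u \<Rightarrow> real" where
  "gap \<beta> z = \<beta> (fst (fst z), snd z) - \<beta> (snd (fst z), snd z)"

text \<open>Only the U-variable is read in a chart, one for each index i, because Lebesgue measure
  is taken there; the two parameters stay on the manifold.\<close>

definition chart_gap :: "(nat \<Rightarrow> ('u, 'f) chart) \<Rightarrow> ('x \<times> 'u \<Rightarrow> real) \<Rightarrow> nat \<Rightarrow> ('x \<times> 'x) \<times> 'f \<Rightarrow> real" where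
  "chart_gap \<psi> \<beta> i z = gap \<beta> (fst z, inv_into (fst (\<psi> i)) (snd (\<psi> i)) (snd z))"

locale manifold_pair =
  fixes A :: "('x::{t2_space, second_countable_topology}, 'e::real_normed_vector) chart set"
    and B :: "('u::{t2_space, second_countable_topology}, 'f::euclidean_space) chart set"
    and r m :: nat and b :: "nat \<Rightarrow> 'e" and \<xi> and b' :: "nat \<Rightarrow> 'f" and \<zeta>
  assumes A: "smooth_atlas A" and B: "smooth_atlas B"
    and coX: "coordinates r b \<xi>" and coU: "coordinates m b' \<zeta>"
begin

abbreviation "AB \<equiv> prod_atlas A B"

lemma AB: "smooth_atlas AB" by (rule smooth_atlas_prod[OF A B])

lemma continuous_AB: "\<beta> \<in> smooth_functions AB \<Longrightarrow> continuous_on UNIV \<beta>"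
  by (rule smooth_function_continuous[OF AB])

lemma chart_A: "c \<in> A \<Longrightarrow> is_chart c" using A by (simp add: smooth_atlas_def)
lemma chart_B: "c \<in> B \<Longrightarrow> is_chart c" using B by (simp add: smooth_atlas_def)

text \<open>Pieces on which the \<open>q\<close> values \<open>\<beta>(x\<^sub>1, u\<^sub>j) - \<beta>(x\<^sub>2, u\<^sub>j)\<close> can be translated independently, by adding
  multiples of the \<open>g\<^sub>j\<close> to \<open>\<beta>\<close>.\<close>

definition separated :: "nat \<Rightarrow> 'x set \<Rightarrow> 'x set \<Rightarrow> (nat \<Rightarrow> ('u, 'f) chart) \<Rightarrow> (nat \<Rightarrow> 'u set) \<Rightarrow>
    (nat \<Rightarrow> 'x \<times> 'u \<Rightarrow> real) \<Rightarrow> bool" where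
  "separated q K\<^sub>1 K\<^sub>2 \<psi> L g \<longleftrightarrow>
     compact K\<^sub>1 \<and> compact K\<^sub>2 \<and> (\<exists>c\<in>A. K\<^sub>1 \<subseteq> fst c) \<and> (\<exists>c\<in>A. K\<^sub>2 \<subseteq> fst c) \<and>
     (\<forall>i<q. \<psi> i \<in> B \<and> compact (L i) \<and> L i \<subseteq> fst (\<psi> i)) \<and>
     (\<forall>j<q. g j \<in> smooth_functions AB) \<and> (\<exists>C. compact C \<and> (\<forall>j<q. \<forall>p. p \<notin> C \<longrightarrow> g j p = 0)) \<and>
     (\<forall>i<q. \<forall>j<q. \<forall>u\<in>L i. (\<forall>x\<in>K\<^sub>1. g j (x, u) = (if i = j then 1 else 0)) \<and> (\<forall>x\<in>K\<^sub>2. g j (x, u) = 0))"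

abbreviation (input) coincidence :: "nat \<Rightarrow> 'x set \<Rightarrow> 'x set \<Rightarrow> (nat \<Rightarrow> ('u, 'f) chart) \<Rightarrow> (nat \<Rightarrow> 'u set) \<Rightarrow>
    ('x \<times> 'u \<Rightarrow> real) \<Rightarrow> (nat \<Rightarrow> 'f) set" where
  "coincidence q K\<^sub>1 K\<^sub>2 \<psi> L \<beta> \<equiv> zeros q (K\<^sub>1 \<times> K\<^sub>2) (\<lambda>i. snd (\<psi> i) ` L i) (chart_gap \<psi> \<beta>) 0"

lemma continuous_gap:
  assumes "\<beta> \<in> smooth_functions AB"
  shows "continuous_on UNIV (gap \<beta>)"
proof -
  note c = continuous_on_compose2[OF continuous_AB[OF assms] _ subset_UNIV]
  show ?thesis
    unfolding gap_def
    by (intro continuous_on_diff c continuous_on_Pair continuous_on_fst continuous_on_snd continuous_on_id)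
qed

lemma continuous_chart_gap:
  assumes \<beta>: "\<beta> \<in> smooth_functions AB" and \<psi>: "\<psi> i \<in> B" "L \<subseteq> fst (\<psi> i)"
  shows "continuous_on (K \<times> snd (\<psi> i) ` L) (chart_gap \<psi> \<beta> i)"
  unfolding chart_gap_def
proof (rule continuous_on_compose2[OF continuous_gap[OF \<beta>] _ subset_UNIV])
  let ?S = "K \<times> snd (\<psi> i) ` L"
  have "continuous_on ?S (\<lambda>z. inv_into (fst (\<psi> i)) (snd (\<psi> i)) (snd z))"
    by (rule continuous_on_compose2[OF is_chartD(4)[OF chart_B[OF \<psi>(1)]] continuous_on_snd[OF continuous_on_id]])
      (use \<psi>(2) in auto)
  then show "continuous_on ?S (\<lambda>z. (fst z, inv_into (fst (\<psi> i)) (snd (\<psi> i)) (snd z)))"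
    by (intro continuous_on_Pair continuous_on_fst continuous_on_id)
qed

lemma separatedD:
  assumes "separated q K\<^sub>1 K\<^sub>2 \<psi> L g"
  shows "compact (K\<^sub>1 \<times> K\<^sub>2)" "i < q \<Longrightarrow> \<psi> i \<in> B" "i < q \<Longrightarrow> compact (L i)" "i < q \<Longrightarrow> L i \<subseteq> fst (\<psi> i)"
    "i < q \<Longrightarrow> compact (snd (\<psi> i) ` L i)"
    "i < q \<Longrightarrow> v \<in> L i \<Longrightarrow> inv_into (fst (\<psi> i)) (snd (\<psi> i)) (snd (\<psi> i) v) = v"
proof -
  show "compact (K\<^sub>1 \<times> K\<^sub>2)" using assms by (auto simp: separated_def intro: compact_Times)
  show i: "\<psi> i \<in> B" "compact (L i)" "L i \<subseteq> fst (\<psi> i)" if "i < q" for i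
    using assms that by (auto simp: separated_def)
  show "compact (snd (\<psi> i) ` L i)" if "i < q"
    by (rule compact_continuous_image[OF continuous_on_subset[OF is_chartD(3)[OF chart_B]]])
      (use i[OF that] in auto)
  show "inv_into (fst (\<psi> i)) (snd (\<psi> i)) (snd (\<psi> i) v) = v" if "i < q" "v \<in> L i"
    using is_chartD(5)[OF chart_B[OF i(1)[OF that(1)]]] i(3)[OF that(1)] that(2) by blast
qed

text \<open>Closeness up to \<eta>/2 at both parameters moves a gap by at most \<eta>, so the
  coincidences of a nearby function lie in the tolerant zero set of \<beta>, whose measure is still
  below \<epsilon>.\<close>

lemma coincidence_open:
  assumes sep: "separated q K\<^sub>1 K\<^sub>2 \<psi> L g"
  shows "openin (whitney_topology AB)
    {\<beta> \<in> smooth_functions AB. emeasure (lborel_power {..<q}) (coincidence q K\<^sub>1 K\<^sub>2 \<psi> L \<beta>) < \<epsilon>}"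
    (is "openin _ ?O")
proof (subst openin_subopen, intro ballI)
  fix \<beta> assume "\<beta> \<in> ?O"
  then have \<beta>: "\<beta> \<in> smooth_functions AB" and less: "emeasure (lborel_power {..<q}) (coincidence q K\<^sub>1 K\<^sub>2 \<psi> L \<beta>) < \<epsilon>"
    by auto
  note D = separatedD[OF sep]
  obtain \<eta> where \<eta>: "\<eta> > 0" "emeasure (lborel_power {..<q})
      (zeros q (K\<^sub>1 \<times> K\<^sub>2) (\<lambda>i. snd (\<psi> i) ` L i) (chart_gap \<psi> \<beta>) \<eta>) < \<epsilon>"
    using zeros_upper_semicontinuous[OF D(1) D(5) continuous_chart_gap[OF \<beta> D(2) D(4)] less] by blast
  obtain c\<^sub>1 c\<^sub>2 where c: "c\<^sub>1 \<in> A" "K\<^sub>1 \<subseteq> fst c\<^sub>1" "c\<^sub>2 \<in> A" "K\<^sub>2 \<subseteq> fst c\<^sub>2" and K: "compact K\<^sub>1" "compact K\<^sub>2"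
    using sep by (auto simp: separated_def)
  \<comment> \<open>Indices below q carry the sets with the first parameter, those from q to 2q - 1
    the sets with the second, so that one finite family controls both.\<close>
  let ?c = "\<lambda>i. if i < q then (fst c\<^sub>1 \<times> fst (\<psi> i), map_prod (snd c\<^sub>1) (snd (\<psi> i)))
     else (fst c\<^sub>2 \<times> fst (\<psi> (i - q)), map_prod (snd c\<^sub>2) (snd (\<psi> (i - q))))"
  let ?K = "\<lambda>i. if i < q then K\<^sub>1 \<times> L i else K\<^sub>2 \<times> L (i - q)"
  have fam: "?c i \<in> AB \<and> compact (?K i) \<and> ?K i \<subseteq> fst (?c i)" if "i \<in> {..<2 * q}" for i
  proof (cases "i < q")
    case True
    then show ?thesis
      using prod_atlasI[OF c(1) D(2)[OF True]] compact_Times[OF K(1) D(3)[OF True]] c(2) D(4)[OF True] by auto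
  next
    case False
    then have k: "i - q < q" using that by auto
    show ?thesis
      using prod_atlasI[OF c(3) D(2)[OF k]] compact_Times[OF K(2) D(3)[OF k]] c(4) D(4)[OF k] False by auto
  qed
  obtain W where W: "openin (whitney_topology AB) W" "\<beta> \<in> W" and
    close: "\<And>g i p. g \<in> W \<Longrightarrow> i \<in> {..<2 * q} \<Longrightarrow> p \<in> ?K i \<Longrightarrow> \<bar>\<beta> p - g p\<bar> < \<eta> / 2"
    by (rule whitney_uniform_nbhd[OF AB \<beta> finite_lessThan fam half_gt_zero[OF \<eta>(1)]]) (assumption, rule that)
  have "W \<subseteq> ?O"
  proof
    fix g assume g: "g \<in> W"
    then have gs: "g \<in> smooth_functions AB"
      using openin_subset[OF W(1)] topspace_whitney_topology by blast
    have "coincidence q K\<^sub>1 K\<^sub>2 \<psi> L g \<subseteq> zeros q (K\<^sub>1 \<times> K\<^sub>2) (\<lambda>i. snd (\<psi> i) ` L i) (chart_gap \<psi> \<beta>) \<eta>"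
    proof (rule zeros_mono)
      fix i x w assume i: "i < q" and x: "x \<in> K\<^sub>1 \<times> K\<^sub>2" and "w \<in> snd (\<psi> i) ` L i"
      then obtain v where v: "v \<in> L i" "w = snd (\<psi> i) v" by blast
      have "\<bar>\<beta> (fst x, v) - g (fst x, v)\<bar> < \<eta> / 2"
        by (rule close[OF g, of i]) (use i x v in auto)
      moreover have "\<bar>\<beta> (snd x, v) - g (snd x, v)\<bar> < \<eta> / 2"
        by (rule close[OF g, of "i + q"]) (use i x v in auto)
      ultimately show "\<bar>chart_gap \<psi> \<beta> i (x, w) - chart_gap \<psi> g i (x, w)\<bar> \<le> \<eta>"
        unfolding v(2) chart_gap_def gap_def fst_conv snd_conv D(6)[OF i v(1)] by linarith
    qed
    moreover have "zeros q (K\<^sub>1 \<times> K\<^sub>2) (\<lambda>i. snd (\<psi> i) ` L i) (chart_gap \<psi> \<beta>) \<eta> \<in> sets (lborel_power {..<q})"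
      using compact_zeros(2)[OF D(1) D(5) continuous_chart_gap[OF \<beta> D(2) D(4)]]
      by (rule compact_in_sets_lborel_power) (auto simp: zeros_def PiE_def)
    ultimately have "emeasure (lborel_power {..<q}) (coincidence q K\<^sub>1 K\<^sub>2 \<psi> L g) < \<epsilon>"
      using \<eta>(2) by (meson emeasure_mono le_less_trans)
    then show "g \<in> ?O" using gs by simp
  qed
  then show "\<exists>T. openin (whitney_topology AB) T \<and> \<beta> \<in> T \<and> T \<subseteq> ?O" using W by blast
qed

text \<open>With the points \<open>u i\<close> fixed, the values are smooth functions of x in the
  chart c; their coordinate derivatives are bounded on a small ball, where the grid count applies,
  and compactness of K reduces to finitely many balls.\<close>

lemma cell_cover_smooth:
  assumes \<beta>: "\<beta> \<in> smooth_functions AB" and K: "compact K" "K \<subseteq> fst c" and c: "c \<in> A"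
    and u: "\<And>i. i < q \<Longrightarrow> \<psi> i \<in> B \<and> u i \<in> fst (\<psi> i)"
  shows "cell_cover r q K (\<lambda>i x. \<beta> (x, u i))"
proof (rule cell_cover_compact[OF K(1)])
  fix x assume "x \<in> K"
  then have x: "x \<in> fst c" using K(2) by blast
  note chc = chart_A[OF c]
  let ?pc = "\<lambda>i. (fst c \<times> fst (\<psi> i), map_prod (snd c) (snd (\<psi> i)))"
  let ?g = "\<lambda>i. in_chart (?pc i) \<beta>"
  let ?w = "\<lambda>i. snd (\<psi> i) (u i)"
  let ?S = "\<lambda>i. snd c ` fst c \<times> snd (\<psi> i) ` fst (\<psi> i)"
  have pch: "is_chart (?pc i)" if "i < q" for i
    using prod_chart(1)[OF chc chart_B] u[OF that] by blast
  have im: "snd (?pc i) ` fst (?pc i) = ?S i" for i by (auto simp: image_iff)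
  have sm: "smooth_on (?S i) (?g i)" if "i < q" for i
  proof -
    have "?pc i \<in> max_atlas AB"
      using prod_atlasI[OF c] u[OF that] atlas_subset_max_atlas[OF AB] by blast
    from smooth_function_in_chart[OF \<beta> this] show ?thesis unfolding im .
  qed
  \<comment> \<open>Derivatives in the X-directions are those of the product chart along
    \<open>(b j, 0)\<close>.\<close>
  let ?D = "\<lambda>i z. frechet_derivative (?g i) (at (z, ?w i))"
  have mem: "(z, ?w i) \<in> ?S i" if "i < q" "z \<in> snd c ` fst c" for i z
    using u[OF that(1)] that(2) by blast
  have der: "((\<lambda>z. ?g i (z, ?w i)) has_derivative (\<lambda>v. ?D i z (v, 0))) (at z)"
    if i: "i < q" and z: "z \<in> snd c ` fst c" for i z
  proof -
    have "((\<lambda>z. (z, ?w i)) has_derivative (\<lambda>v. (v, 0))) (at z)"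
      by (intro has_derivative_Pair has_derivative_ident has_derivative_const)
    from has_derivative_compose[OF this smooth_on_has_derivative[OF sm[OF i] mem[OF i z]]] show ?thesis .
  qed
  have cont: "continuous_on (snd c ` fst c) (\<lambda>z. ?D i z (b j, 0))" if i: "i < q" for i j
    by (rule continuous_on_compose2[OF smooth_on_continuous_on[OF smooth_on_frechet[OF sm[OF i]]]
        continuous_on_Pair[OF continuous_on_id continuous_on_const]]) (use mem[OF i] in blast)
  let ?a = "snd c x"
  have a: "?a \<in> snd c ` fst c" using x by blast
  \<comment> \<open>M strictly exceeds every coordinate derivative at the centre, so by continuity
    it bounds them on a ball.\<close>
  define M where "M = 1 + (\<Sum>i<q. \<Sum>j<r. \<bar>?D i ?a (b j, 0)\<bar>)"
  have M: "\<bar>?D i ?a (b j, 0)\<bar> < M" if "i < q" "j < r" for i j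
  proof -
    have "\<bar>?D i ?a (b j, 0)\<bar> \<le> (\<Sum>j<r. \<bar>?D i ?a (b j, 0)\<bar>)"
      by (rule member_le_sum) (use that in auto)
    also have "\<dots> \<le> (\<Sum>i<q. \<Sum>j<r. \<bar>?D i ?a (b j, 0)\<bar>)"
      by (rule member_le_sum[of i "{..<q}" "\<lambda>i. \<Sum>j<r. \<bar>?D i ?a (b j, 0)\<bar>"]) (use that in \<open>auto intro: sum_nonneg\<close>)
    finally show ?thesis by (simp add: M_def)
  qed
  have op: "open {z \<in> snd c ` fst c. \<bar>?D i z (b j, 0)\<bar> < M}" if "i < q" for i j
  proof -
    have "open (snd c ` fst c \<inter> (\<lambda>z. \<bar>?D i z (b j, 0)\<bar>) -` {..<M})"
      by (intro continuous_open_preimage continuous_on_rabs cont that is_chartD(2)[OF chc]) auto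
    then show ?thesis by (simp add: vimage_def Int_def)
  qed
  have "open (snd c ` fst c \<inter> (\<Inter>i\<in>{..<q}. \<Inter>j\<in>{..<r}. {z \<in> snd c ` fst c. \<bar>?D i z (b j, 0)\<bar> < M}))"
    by (intro open_Int open_INT ballI op is_chartD(2)[OF chc]) auto
  then obtain \<rho> where \<rho>: "\<rho> > 0" "ball ?a \<rho> \<subseteq> snd c ` fst c \<inter> (\<Inter>i\<in>{..<q}. \<Inter>j\<in>{..<r}. {z \<in> snd c ` fst c. \<bar>?D i z (b j, 0)\<bar> < M})"
    using a M by (elim openE[of _ ?a]) auto
  have "cell_cover r q (ball ?a \<rho>) (\<lambda>i z. ?g i (z, ?w i))"
  proof (rule cell_cover_ball[OF coX])
    show "((\<lambda>z. ?g i (z, ?w i)) has_derivative (\<lambda>v. ?D i z (v, 0))) (at z)" if "i < q" "z \<in> ball ?a \<rho>" for i z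
      by (rule der) (use that \<rho>(2) in blast)+
    show "\<bar>?D i z (b j, 0)\<bar> \<le> M" if "i < q" "z \<in> ball ?a \<rho>" "j < r" for i z j
    proof -
      have "z \<in> {z \<in> snd c ` fst c. \<bar>?D i z (b j, 0)\<bar> < M}" using that \<rho>(2) by blast
      then show ?thesis by simp
    qed
  qed
  then have "cell_cover r q {y \<in> fst c. snd c y \<in> ball ?a \<rho>} (\<lambda>i y. \<beta> (y, u i))"
  proof (rule cell_cover_vimage[where f = "snd c"])
    fix i y assume "i < q" "y \<in> {y \<in> fst c. snd c y \<in> ball ?a \<rho>}"
    then show "\<beta> (y, u i) = ?g i (snd c y, ?w i)"
      using in_chart_apply[OF pch[of i], of "(y, u i)" \<beta>] u[of i] by simp
  qed simp
  moreover have "open {y \<in> fst c. snd c y \<in> ball ?a \<rho>}" by (rule chart_preimage_open[OF chc open_ball])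
  ultimately show "\<exists>V. open V \<and> x \<in> V \<and> cell_cover r q V (\<lambda>i x. \<beta> (x, u i))"
    using x \<rho>(1) by (intro exI[of _ "{y \<in> fst c. snd c y \<in> ball ?a \<rho>}"]) simp
qed

lemma coincidence_dense:
  assumes sep: "separated q K\<^sub>1 K\<^sub>2 \<psi> L g" and q: "2 * r < q" and "0 < \<epsilon>"
  shows "whitney_topology AB closure_of
    {\<beta> \<in> smooth_functions AB. emeasure (lborel_power {..<q}) (coincidence q K\<^sub>1 K\<^sub>2 \<psi> L \<beta>) < \<epsilon>} =
    topspace (whitney_topology AB)" (is "_ closure_of ?O = _")
  unfolding dense_intersects_open
proof (intro allI impI)
  fix V assume V: "openin (whitney_topology AB) V \<and> V \<noteq> {}"
  then obtain \<beta> where \<beta>V: "\<beta> \<in> V" by blast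
  then have \<beta>: "\<beta> \<in> smooth_functions AB"
    using V openin_subset topspace_whitney_topology by blast
  note D = separatedD[OF sep]
  obtain C where C: "compact C" "\<And>j p. j \<in> {..<q} \<Longrightarrow> p \<notin> C \<Longrightarrow> g j p = 0"
    using sep unfolding separated_def by blast
  have g: "g j \<in> smooth_functions AB" if "j \<in> {..<q}" for j
    using sep that unfolding separated_def by blast
  have g1: "g j (x, v) = (if i = j then 1 else 0)" if "i < q" "j < q" "v \<in> L i" "x \<in> K\<^sub>1" for i j v x
    using sep that unfolding separated_def by blast
  have g2: "g j (x, v) = 0" if "i < q" "j < q" "v \<in> L i" "x \<in> K\<^sub>2" for i j v x
    using sep that unfolding separated_def by blast
  have K: "compact K\<^sub>1" "compact K\<^sub>2" and c: "\<exists>c\<in>A. K\<^sub>1 \<subseteq> fst c" "\<exists>c\<in>A. K\<^sub>2 \<subseteq> fst c"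
    using sep unfolding separated_def by blast+
  let ?Z = "\<lambda>t. zeros q (K\<^sub>1 \<times> K\<^sub>2) (\<lambda>i. snd (\<psi> i) ` L i) (\<lambda>i z. chart_gap \<psi> \<beta> i z + t i) 0"
  let ?b = "\<lambda>t p. \<beta> p + (\<Sum>j\<in>{..<q}. t j * g j p)"
  have "\<exists>\<delta>>0. \<forall>t. (\<forall>j\<in>{..<q}. \<bar>t j\<bar> < \<delta>) \<longrightarrow> ?b t \<in> V"
    by (rule whitney_perturbation[OF coordinates_Pair[OF coX coU] AB \<beta> finite_lessThan g C conjunct1[OF V] \<beta>V])
  then obtain \<delta> where \<delta>: "\<delta> > 0" "\<forall>t. (\<forall>j\<in>{..<q}. \<bar>t j\<bar> < \<delta>) \<longrightarrow> ?b t \<in> V"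
    by (elim exE conjE)
  have "\<exists>t. (\<forall>i<q. \<bar>t i\<bar> < \<delta>) \<and>
    ?Z t \<in> null_sets (lborel_power {..<q})"
  proof (rule exists_small_null_section[where d = "r + r"])
    show "compact (K\<^sub>1 \<times> K\<^sub>2)" by (rule D(1))
    show "compact (snd (\<psi> i) ` L i)" if "i < q" for i by (rule D(5)[OF that])
    show "continuous_on ((K\<^sub>1 \<times> K\<^sub>2) \<times> snd (\<psi> i) ` L i) (chart_gap \<psi> \<beta> i)" if "i < q" for i
      by (rule continuous_chart_gap[where \<psi> = \<psi> and i = i, OF \<beta> D(2)[OF that] D(4)[OF that]])
    show "r + r < q" using q by simp
    show "\<delta> > 0" by (rule \<delta>(1))
    fix w assume w: "w \<in> (\<Pi>\<^sub>E i\<in>{..<q}. snd (\<psi> i) ` L i)"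
    define u where "u i = inv_into (fst (\<psi> i)) (snd (\<psi> i)) (w i)" for i
    have u: "\<psi> i \<in> B \<and> u i \<in> fst (\<psi> i)" if i: "i < q" for i
    proof -
      obtain v where v: "v \<in> L i" "w i = snd (\<psi> i) v" using PiE_mem[OF w, of i] i by auto
      then have "u i = v" using D(6)[OF i v(1)] by (simp add: u_def)
      then show ?thesis using D(2,4)[OF i] v(1) by blast
    qed
    obtain c\<^sub>1 c\<^sub>2 where "c\<^sub>1 \<in> A" "K\<^sub>1 \<subseteq> fst c\<^sub>1" "c\<^sub>2 \<in> A" "K\<^sub>2 \<subseteq> fst c\<^sub>2" using c by blast
    then have "cell_cover (r + r) q (K\<^sub>1 \<times> K\<^sub>2) (\<lambda>i z. \<beta> (fst z, u i) - \<beta> (snd z, u i))"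
      using K u by (intro cell_cover_Times_diff cell_cover_smooth[OF \<beta>])
    then show "cell_cover (r + r) q (K\<^sub>1 \<times> K\<^sub>2) (\<lambda>i x. chart_gap \<psi> \<beta> i (x, w i))"
      by (simp add: chart_gap_def gap_def u_def)
  qed
  then obtain t where t: "\<forall>i<q. \<bar>t i\<bar> < \<delta>"
    and null: "?Z t \<in> null_sets (lborel_power {..<q})"
    by blast
  \<comment> \<open>Tolerance 0 in \<open>zeros_mono\<close>: the perturbation adds exactly
    \<open>t i\<close> at the first parameter and nothing at the second, so both families of
    equations agree on the piece.\<close>
  have "coincidence q K\<^sub>1 K\<^sub>2 \<psi> L (?b t) \<subseteq>
      ?Z t"
  proof (rule zeros_mono)
    fix i x w assume i: "i < q" and x: "x \<in> K\<^sub>1 \<times> K\<^sub>2" and "w \<in> snd (\<psi> i) ` L i"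
    then obtain v where v: "v \<in> L i" "w = snd (\<psi> i) v" by blast
    have "(\<Sum>j\<in>{..<q}. t j * g j (fst x, v)) = (\<Sum>j\<in>{..<q}. if i = j then t j else 0)"
      using g1[OF i _ v(1)] x by (intro sum.cong refl) auto
    also have "\<dots> = t i" using i by simp
    finally have "(\<Sum>j\<in>{..<q}. t j * g j (fst x, v)) = t i" .
    moreover have "(\<Sum>j\<in>{..<q}. t j * g j (snd x, v)) = 0"
      using g2[OF i _ v(1)] x by (intro sum.neutral) auto
    ultimately show "\<bar>chart_gap \<psi> \<beta> i (x, w) + t i - chart_gap \<psi> (?b t) i (x, w)\<bar> \<le> 0"
      unfolding v(2) chart_gap_def gap_def fst_conv snd_conv D(6)[OF i v(1)] by linarith
  qed
  then have "emeasure (lborel_power {..<q}) (coincidence q K\<^sub>1 K\<^sub>2 \<psi> L (?b t)) \<le>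
      emeasure (lborel_power {..<q}) (?Z t)"
    using null by (intro emeasure_mono) auto
  also have "\<dots> = 0" using null by auto
  finally have "emeasure (lborel_power {..<q}) (coincidence q K\<^sub>1 K\<^sub>2 \<psi> L (?b t)) < \<epsilon>" using \<open>0 < \<epsilon>\<close> by simp
  moreover have "?b t \<in> smooth_functions AB" by (rule smooth_functions_lincomb[OF AB \<beta> g])
  moreover have "?b t \<in> V" by (rule \<delta>(2)[rule_format]) (use t in simp)
  ultimately show "?O \<inter> V \<noteq> {}" by blast
qed

text \<open>The bumps are supported in disjoint neighbourhoods, so the one around the first
  parameter vanishes on the compact set of the second, and the one around \<open>u j\<close>
  vanishes on the compact sets of the other entries. W records which configurations the piece takes
  care of.\<close>

lemma separated_exists:
  assumes x: "x\<^sub>1 \<noteq> x\<^sub>2" and u: "inj_on u {..<q}"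
  obtains K\<^sub>1 K\<^sub>2 \<psi> L g W where "separated q K\<^sub>1 K\<^sub>2 \<psi> L g" "open W" "(x\<^sub>1, x\<^sub>2, u) \<in> W"
    "\<And>y\<^sub>1 y\<^sub>2 v. (y\<^sub>1, y\<^sub>2, v) \<in> W \<Longrightarrow> y\<^sub>1 \<in> K\<^sub>1 \<and> y\<^sub>2 \<in> K\<^sub>2 \<and> (\<forall>i<q. v i \<in> L i)"
proof -
  obtain V\<^sub>1 V\<^sub>2 where V: "open V\<^sub>1" "open V\<^sub>2" "x\<^sub>1 \<in> V\<^sub>1" "x\<^sub>2 \<in> V\<^sub>2" "V\<^sub>1 \<inter> V\<^sub>2 = {}"
    using hausdorff[OF x] by blast
  obtain c\<^sub>1 a\<^sub>1 d\<^sub>1 N\<^sub>1 where 1: "c\<^sub>1 \<in> A" "d\<^sub>1 > 0" "cube r \<xi> a\<^sub>1 (2 * d\<^sub>1) \<subseteq> snd c\<^sub>1 ` fst c\<^sub>1"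
    "core c\<^sub>1 r \<xi> a\<^sub>1 (2 * d\<^sub>1) \<subseteq> V\<^sub>1" "open N\<^sub>1" "x\<^sub>1 \<in> N\<^sub>1" "N\<^sub>1 \<subseteq> core c\<^sub>1 r \<xi> a\<^sub>1 d\<^sub>1"
    by (rule core_exists[OF A coX V(1,3)])
  obtain c\<^sub>2 a\<^sub>2 d\<^sub>2 N\<^sub>2 where 2: "c\<^sub>2 \<in> A" "d\<^sub>2 > 0" "cube r \<xi> a\<^sub>2 (2 * d\<^sub>2) \<subseteq> snd c\<^sub>2 ` fst c\<^sub>2"
    "core c\<^sub>2 r \<xi> a\<^sub>2 (2 * d\<^sub>2) \<subseteq> V\<^sub>2" "open N\<^sub>2" "x\<^sub>2 \<in> N\<^sub>2" "N\<^sub>2 \<subseteq> core c\<^sub>2 r \<xi> a\<^sub>2 d\<^sub>2"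
    by (rule core_exists[OF A coX V(2,4)])
  obtain U where U: "\<And>i. i < q \<Longrightarrow> open (U i)" "\<And>i. i < q \<Longrightarrow> u i \<in> U i"
    "\<And>i j. i < q \<Longrightarrow> j < q \<Longrightarrow> i \<noteq> j \<Longrightarrow> U i \<inter> U j = {}"
    by (rule disjoint_neighbourhoods[OF u]) (rule that)
  \<comment> \<open>Chart, centre, radius and neighbourhood form one tuple, so that they are chosen
    together for every index.\<close>
  define Q where "Q i z \<longleftrightarrow> (case z of (c, a, d, N) \<Rightarrow> c \<in> B \<and> d > 0 \<and> cube m \<zeta> a (2 * d) \<subseteq> snd c ` fst c \<and>
    core c m \<zeta> a (2 * d) \<subseteq> U i \<and> open N \<and> u i \<in> N \<and> N \<subseteq> core c m \<zeta> a d)" for i z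
  have "\<exists>z. Q i z" if i: "i < q" for i
  proof -
    obtain c a d N where "c \<in> B" "d > 0" "cube m \<zeta> a (2 * d) \<subseteq> snd c ` fst c" "core c m \<zeta> a (2 * d) \<subseteq> U i"
      "open N" "u i \<in> N" "N \<subseteq> core c m \<zeta> a d"
      by (rule core_exists[OF B coU U(1)[OF i] U(2)[OF i]])
    then have "Q i (c, a, d, N)" by (simp add: Q_def)
    then show ?thesis by blast
  qed
  then obtain z where z: "\<And>i. i < q \<Longrightarrow> Q i (z i)" by metis
  define \<psi> a d N where "\<psi> i = fst (z i)" and "a i = fst (snd (z i))" and "d i = fst (snd (snd (z i)))"
    and "N i = snd (snd (snd (z i)))" for i
  have u': "\<psi> i \<in> B" "d i > 0" "cube m \<zeta> (a i) (2 * d i) \<subseteq> snd (\<psi> i) ` fst (\<psi> i)"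
    "core (\<psi> i) m \<zeta> (a i) (2 * d i) \<subseteq> U i" "open (N i)" "u i \<in> N i" "N i \<subseteq> core (\<psi> i) m \<zeta> (a i) (d i)"
    if "i < q" for i
    using z[OF that] by (auto simp: Q_def \<psi>_def a_def d_def N_def case_prod_beta)
  let ?K\<^sub>1 = "core c\<^sub>1 r \<xi> a\<^sub>1 d\<^sub>1" and ?K\<^sub>2 = "core c\<^sub>2 r \<xi> a\<^sub>2 d\<^sub>2" and ?L = "\<lambda>i. core (\<psi> i) m \<zeta> (a i) (d i)"
  let ?C\<^sub>1 = "core c\<^sub>1 r \<xi> a\<^sub>1 (2 * d\<^sub>1)" and ?C = "\<lambda>i. core (\<psi> i) m \<zeta> (a i) (2 * d i)"
  let ?g = "\<lambda>j. \<lambda>(x, v). bump c\<^sub>1 r \<xi> a\<^sub>1 d\<^sub>1 x * bump (\<psi> j) m \<zeta> (a j) (d j) v"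
  have cu1: "cube r \<xi> a\<^sub>1 d\<^sub>1 \<subseteq> snd c\<^sub>1 ` fst c\<^sub>1" using cube_mono[of d\<^sub>1 "2 * d\<^sub>1" r \<xi> a\<^sub>1] 1(2,3) by auto
  have cu2: "cube r \<xi> a\<^sub>2 d\<^sub>2 \<subseteq> snd c\<^sub>2 ` fst c\<^sub>2" using cube_mono[of d\<^sub>2 "2 * d\<^sub>2" r \<xi> a\<^sub>2] 2(2,3) by auto
  have cuU: "cube m \<zeta> (a i) (d i) \<subseteq> snd (\<psi> i) ` fst (\<psi> i)" if "i < q" for i
    using cube_mono[of "d i" "2 * d i" m \<zeta> "a i"] u'(2,3)[OF that] by auto
  have sub2: "?K\<^sub>2 \<subseteq> V\<^sub>2" using core_mono[of d\<^sub>2 "2 * d\<^sub>2" c\<^sub>2 r \<xi> a\<^sub>2] 2(2,4) by auto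
  have subU: "?L i \<subseteq> U i" if "i < q" for i
    using core_mono[of "d i" "2 * d i" "\<psi> i" m \<zeta> "a i"] u'(2,4)[OF that] by auto
  have "separated q ?K\<^sub>1 ?K\<^sub>2 \<psi> ?L ?g"
    unfolding separated_def
  proof (intro conjI allI impI ballI)
    show "compact ?K\<^sub>1" by (rule core_compact(1)[OF chart_A[OF 1(1)] coX cu1])
    show "compact ?K\<^sub>2" by (rule core_compact(1)[OF chart_A[OF 2(1)] coX cu2])
    show "\<exists>c\<in>A. ?K\<^sub>1 \<subseteq> fst c" using 1(1) by (intro bexI[of _ c\<^sub>1]) (auto simp: core_def)
    show "\<exists>c\<in>A. ?K\<^sub>2 \<subseteq> fst c" using 2(1) by (intro bexI[of _ c\<^sub>2]) (auto simp: core_def)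
    show "\<psi> i \<in> B" if "i < q" for i by (rule u'(1)[OF that])
    show "compact (?L i)" if "i < q" for i
      by (rule core_compact(1)[OF chart_B[OF u'(1)[OF that]] coU cuU[OF that]])
    show "?L i \<subseteq> fst (\<psi> i)" for i by (auto simp: core_def)
    show "?g j \<in> smooth_functions AB" if "j < q" for j
      by (rule bump_prod_smooth[OF A B 1(1) u'(1)[OF that] coX coU 1(2) u'(2)[OF that] 1(3) u'(3)[OF that]])
    show "\<exists>C. compact C \<and> (\<forall>j<q. \<forall>p. p \<notin> C \<longrightarrow> ?g j p = 0)"
    proof (intro exI[of _ "?C\<^sub>1 \<times> (\<Union>j\<in>{..<q}. ?C j)"] conjI allI impI)
      have "compact (?C i)" if "i < q" for i
        by (rule core_compact(1)[OF chart_B[OF u'(1)[OF that]] coU u'(3)[OF that]])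
      then show "compact (?C\<^sub>1 \<times> (\<Union>j\<in>{..<q}. ?C j))"
        by (intro compact_Times compact_UN core_compact(1)[OF chart_A[OF 1(1)] coX 1(3)]) auto
      fix j p assume j: "j < q" and p: "p \<notin> ?C\<^sub>1 \<times> (\<Union>j\<in>{..<q}. ?C j)"
      obtain x v where xv: "p = (x, v)" by (cases p)
      have "x \<notin> ?C\<^sub>1 \<or> v \<notin> ?C j" using p j xv by blast
      then have "bump c\<^sub>1 r \<xi> a\<^sub>1 d\<^sub>1 x = 0 \<or> bump (\<psi> j) m \<zeta> (a j) (d j) v = 0"
        using bump_0[OF 1(2), of x c\<^sub>1 r \<xi> a\<^sub>1] bump_0[OF u'(2)[OF j], of v "\<psi> j" m \<zeta> "a j"] by argo
      then show "?g j p = 0" using xv by auto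
    qed
    show "?g j (x, v) = (if i = j then 1 else 0)" if "i < q" "j < q" "v \<in> ?L i" "x \<in> ?K\<^sub>1" for i j v x
    proof (cases "i = j")
      case True
      then show ?thesis using bump_1[OF 1(2) that(4)] bump_1[OF u'(2)[OF that(1)] that(3)] by simp
    next
      case False
      then have v: "v \<notin> ?C j" using subU[OF that(1)] u'(4)[OF that(2)] U(3)[OF that(1,2)] that(3) by blast
      then show ?thesis using bump_0[OF u'(2)[OF that(2)] v] False by simp
    qed
    show "?g j (x, v) = 0" if "x \<in> ?K\<^sub>2" for j v x
    proof -
      have x: "x \<notin> ?C\<^sub>1" using sub2 1(4) V(5) that by blast
      show ?thesis by (simp only: case_prod_conv bump_0[OF 1(2) x] mult_zero_left)
    qed
  qed
  \<comment> \<open>Only the first q entries are constrained, which is open in the space of all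
    sequences.\<close>
  moreover have "open (N\<^sub>1 \<times> N\<^sub>2 \<times> {v. \<forall>i<q. v i \<in> N i})"
  proof (intro open_Times 1(5) 2(5))
    have "open ((\<lambda>v. v i) -` N i)" if "i < q" for i
      by (rule open_vimage[OF u'(5)[OF that] continuous_on_product_coordinates])
    then have "open (\<Inter>i\<in>{..<q}. (\<lambda>v. v i) -` N i)" by (intro open_INT) auto
    moreover have "(\<Inter>i\<in>{..<q}. (\<lambda>v. v i) -` N i) = {v. \<forall>i<q. v i \<in> N i}" by auto
    ultimately show "open {v. \<forall>i<q. v i \<in> N i}" by simp
  qed
  moreover have "(x\<^sub>1, x\<^sub>2, u) \<in> N\<^sub>1 \<times> N\<^sub>2 \<times> {v. \<forall>i<q. v i \<in> N i}" using 1(6) 2(6) u'(6) by simp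
  moreover have "y\<^sub>1 \<in> ?K\<^sub>1 \<and> y\<^sub>2 \<in> ?K\<^sub>2 \<and> (\<forall>i<q. v i \<in> ?L i)"
    if "(y\<^sub>1, y\<^sub>2, v) \<in> N\<^sub>1 \<times> N\<^sub>2 \<times> {v. \<forall>i<q. v i \<in> N i}" for y\<^sub>1 y\<^sub>2 v
    using that 1(7) 2(7) u'(7) by blast
  ultimately show ?thesis by (rule that)
qed

text \<open>The product chart \<psi> maps the bad tuples of the piece exactly onto the coincidence
  set, and nullity in one product chart suffices; closedness comes from compactness.\<close>

lemma coincidence_null_measure_zero:
  assumes sep: "separated q K\<^sub>1 K\<^sub>2 \<psi> L g" and \<beta>: "\<beta> \<in> smooth_functions AB"
    and zero: "emeasure (lborel_power {..<q}) (coincidence q K\<^sub>1 K\<^sub>2 \<psi> L \<beta>) = 0"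
  shows "measure_zero B q (zeros q (K\<^sub>1 \<times> K\<^sub>2) L (\<lambda>_. gap \<beta>) 0)"
    and "closedin (power_topology q) (zeros q (K\<^sub>1 \<times> K\<^sub>2) L (\<lambda>_. gap \<beta>) 0)"
proof -
  note D = separatedD[OF sep]
  let ?Z = "zeros q (K\<^sub>1 \<times> K\<^sub>2) L (\<lambda>_. gap \<beta>) 0" and ?F = "\<lambda>u. \<lambda>i\<in>{..<q}. snd (\<psi> i) (u i)"
  have "coincidence q K\<^sub>1 K\<^sub>2 \<psi> L \<beta> \<in> sets (lborel_power {..<q})"
    using compact_zeros(2)[OF D(1) D(5) continuous_chart_gap[OF \<beta> D(2) D(4)]]
    by (rule compact_in_sets_lborel_power) (auto simp: zeros_def PiE_def)
  then have null: "coincidence q K\<^sub>1 K\<^sub>2 \<psi> L \<beta> \<in> null_sets (lborel_power {..<q})" using zero by (simp add: null_sets_def)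
  have eq: "?F ` ?Z = coincidence q K\<^sub>1 K\<^sub>2 \<psi> L \<beta>"
  proof (intro subset_antisym subsetI)
    fix w assume "w \<in> ?F ` ?Z"
    then obtain u x where u: "w = ?F u" "u \<in> PiE {..<q} L" "x \<in> K\<^sub>1 \<times> K\<^sub>2" "\<forall>i<q. \<bar>gap \<beta> (x, u i)\<bar> \<le> 0"
      unfolding zeros_def by blast
    have ui: "u i \<in> L i" if "i < q" for i using PiE_mem[OF u(2), of i] that by simp
    have "w \<in> (\<Pi>\<^sub>E i\<in>{..<q}. snd (\<psi> i) ` L i)" unfolding u(1) restrict_PiE_iff using ui by simp
    moreover have "chart_gap \<psi> \<beta> i (x, w i) = gap \<beta> (x, u i)" if "i < q" for i
      using D(6)[OF that ui[OF that]] that by (simp add: chart_gap_def u(1))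
    ultimately show "w \<in> coincidence q K\<^sub>1 K\<^sub>2 \<psi> L \<beta>" unfolding zeros_def using u(3,4) by auto
  next
    fix w assume "w \<in> coincidence q K\<^sub>1 K\<^sub>2 \<psi> L \<beta>"
    then obtain x where w: "w \<in> (\<Pi>\<^sub>E i\<in>{..<q}. snd (\<psi> i) ` L i)" and x: "x \<in> K\<^sub>1 \<times> K\<^sub>2" "\<forall>i<q. \<bar>chart_gap \<psi> \<beta> i (x, w i)\<bar> \<le> 0"
      unfolding zeros_def by blast
    have "\<exists>v. v \<in> L i \<and> w i = snd (\<psi> i) v" if "i < q" for i using PiE_mem[OF w, of i] that by auto
    then obtain v where v: "\<And>i. i < q \<Longrightarrow> v i \<in> L i \<and> w i = snd (\<psi> i) (v i)" by metis
    let ?v = "restrict v {..<q}"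
    have "chart_gap \<psi> \<beta> i (x, w i) = gap \<beta> (x, ?v i)" if "i < q" for i
      using D(6)[OF that, of "v i"] v[OF that] that by (simp add: chart_gap_def)
    moreover have "?v \<in> PiE {..<q} L" unfolding restrict_PiE_iff using v by simp
    ultimately have "?v \<in> ?Z" unfolding zeros_def using x by auto
    moreover have "w = ?F ?v" using v PiE_arb[OF w] by (auto simp: fun_eq_iff)
    ultimately show "w \<in> ?F ` ?Z" by blast
  qed
  show "measure_zero B q ?Z"
  proof (rule measure_zero_chart_independent[OF B D(2)])
    have "PiE {..<q} L \<subseteq> (\<Pi>\<^sub>E i\<in>{..<q}. fst (\<psi> i))" using D(4) by (intro PiE_mono) simp
    then show "?Z \<subseteq> (\<Pi>\<^sub>E i\<in>{..<q}. fst (\<psi> i))" unfolding zeros_def by blast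
    show "?F ` ?Z \<in> null_sets (lborel_power {..<q})" unfolding eq by (rule null)
  qed
  show "closedin (power_topology q) ?Z"
  proof (rule closedin_power_compact)
    show "compact ?Z"
      by (rule compact_zeros(2)[OF D(1) D(3)]) (auto intro: continuous_on_subset[OF continuous_gap[OF \<beta>]])
    show "?Z \<subseteq> PiE {..<q} (\<lambda>_. UNIV)" by (auto simp: zeros_def PiE_def)
  qed
qed

end

section \<open>Assembly from countably many closed null sets\<close>

lemma generic_inI:
  assumes "countable \<D>" "\<And>D. D \<in> \<D> \<Longrightarrow> openin T D" "\<And>D. D \<in> \<D> \<Longrightarrow> T closure_of D = topspace T"
    and "S \<subseteq> topspace T" "topspace T \<inter> \<Inter>\<D> \<subseteq> S"
  shows "generic_in T S"
  unfolding generic_in_def using assms by blast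

text \<open>One countable family serves both claims: the union of its members is null, and the
  complement of each is open and dense.\<close>

lemma generic_full_measureI:
  fixes B :: "('u::t2_space, 'f::euclidean_space) chart set"
  assumes B: "smooth_atlas B" and \<Z>: "countable \<Z>" and closed: "\<And>Z. Z \<in> \<Z> \<Longrightarrow> closedin (power_topology q) Z"
    and null: "\<And>Z. Z \<in> \<Z> \<Longrightarrow> measure_zero B q Z"
    and S: "S \<subseteq> PiE {..<q} (\<lambda>_. UNIV)" "PiE {..<q} (\<lambda>_. UNIV) - S \<subseteq> \<Union>\<Z>"
  shows "generic_in (power_topology q) S" "full_measure B q S"
proof -
  let ?T = "topspace (power_topology q) :: (nat \<Rightarrow> 'u) set"
  have T: "?T = PiE {..<q} (\<lambda>_. UNIV)" by simp
  show "generic_in (power_topology q) S"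
  proof (rule generic_inI[where \<D> = "(\<lambda>Z. ?T - Z) ` \<Z>"])
    show "S \<subseteq> ?T" unfolding T by (rule S(1))
    show "countable ((\<lambda>Z. ?T - Z) ` \<Z>)" using \<Z> by (rule countable_image)
    show "?T \<inter> \<Inter>((\<lambda>Z. ?T - Z) ` \<Z>) \<subseteq> S" unfolding T using S(2) by blast
    fix D assume "D \<in> (\<lambda>Z. ?T - Z) ` \<Z>"
    then obtain Z where "Z \<in> \<Z>" "D = ?T - Z" by blast
    then show "openin (power_topology q) D" "power_topology q closure_of D = ?T"
      using closed_measure_zero_complement[OF B closed null] by auto
  qed
  show "full_measure B q S"
    unfolding full_measure_def using measure_zero_Union[OF \<Z> null] S(2) by (rule measure_zero_subset)
qed

context manifold_pair
begin

lemma universal_tuples_generic: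
  assumes q: "2 * r < q"
  shows "generic_in (whitney_topology AB)
    {\<beta> \<in> smooth_functions AB. generic_in (power_topology q) (universal_tuples \<beta> q) \<and>
       full_measure B q (universal_tuples \<beta> q)}"
proof -
  define P :: "('x \<times> 'x \<times> (nat \<Rightarrow> 'u)) set" where "P = {(x\<^sub>1, x\<^sub>2, u). x\<^sub>1 \<noteq> x\<^sub>2 \<and> inj_on u {..<q}}"
  define R where "R p d \<longleftrightarrow> (case d of (K\<^sub>1, K\<^sub>2, \<psi>, L, g, W) \<Rightarrow> separated q K\<^sub>1 K\<^sub>2 \<psi> L g \<and> open W \<and> p \<in> W \<and>
    (\<forall>y\<^sub>1 y\<^sub>2 v. (y\<^sub>1, y\<^sub>2, v) \<in> W \<longrightarrow> y\<^sub>1 \<in> K\<^sub>1 \<and> y\<^sub>2 \<in> K\<^sub>2 \<and> (\<forall>i<q. v i \<in> L i)))" for p d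
  have "\<exists>d. R p d" if p: "p \<in> P" for p
  proof -
    obtain x\<^sub>1 x\<^sub>2 u where xu: "p = (x\<^sub>1, x\<^sub>2, u)" "x\<^sub>1 \<noteq> x\<^sub>2" "inj_on u {..<q}" using p by (auto simp: P_def)
    obtain K\<^sub>1 K\<^sub>2 \<psi> L g W where "separated q K\<^sub>1 K\<^sub>2 \<psi> L g" "open W" "(x\<^sub>1, x\<^sub>2, u) \<in> W"
      "\<And>y\<^sub>1 y\<^sub>2 v. (y\<^sub>1, y\<^sub>2, v) \<in> W \<Longrightarrow> y\<^sub>1 \<in> K\<^sub>1 \<and> y\<^sub>2 \<in> K\<^sub>2 \<and> (\<forall>i<q. v i \<in> L i)"
      by (rule separated_exists[OF xu(2,3)]) (rule that)
    then have "R p (K\<^sub>1, K\<^sub>2, \<psi>, L, g, W)" unfolding R_def xu(1) prod.case by blast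
    then show ?thesis by blast
  qed
  then obtain d where d: "\<And>p. p \<in> P \<Longrightarrow> R p (d p)" by metis
  define K\<^sub>1 K\<^sub>2 \<psi> L g W where "K\<^sub>1 p = fst (d p)" and "K\<^sub>2 p = fst (snd (d p))" and "\<psi> p = fst (snd (snd (d p)))"
    and "L p = fst (snd (snd (snd (d p))))" and "g p = fst (snd (snd (snd (snd (d p)))))"
    and "W p = snd (snd (snd (snd (snd (d p)))))" for p
  have sep: "separated q (K\<^sub>1 p) (K\<^sub>2 p) (\<psi> p) (L p) (g p)" and W: "open (W p)" "p \<in> W p"
    and cover: "\<And>y\<^sub>1 y\<^sub>2 v. (y\<^sub>1, y\<^sub>2, v) \<in> W p \<Longrightarrow> y\<^sub>1 \<in> K\<^sub>1 p \<and> y\<^sub>2 \<in> K\<^sub>2 p \<and> (\<forall>i<q. v i \<in> L p i)"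
    if "p \<in> P" for p
    using d[OF that] unfolding R_def K\<^sub>1_def K\<^sub>2_def \<psi>_def L_def g_def W_def case_prod_beta by blast+
  \<comment> \<open>Tuples are taken as arbitrary sequences here; a countable power of a second
    countable space is second countable, so countably many pieces cover P.\<close>
  obtain \<F> where \<F>: "\<F> \<subseteq> W ` P" "countable \<F>" "\<Union>\<F> = \<Union>(W ` P)"
    by (rule Lindelof[of "W ` P"]) (use W(1) in blast)
  then obtain Q where Q: "countable Q" "Q \<subseteq> P" "\<F> = W ` Q" using countable_subset_image[of \<F> W P] by blast
  have PQ: "P \<subseteq> (\<Union>p\<in>Q. W p)" using \<F>(3) Q(3) W(2) by blast
  \<comment> \<open>The second index runs through the bounds 1/(n+1); lying in all these sets forces
    measure 0.\<close>
  define O' where "O' = (\<lambda>(p, n). {\<beta> \<in> smooth_functions AB. emeasure (lborel_power {..<q})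
    (coincidence q (K\<^sub>1 p) (K\<^sub>2 p) (\<psi> p) (L p) \<beta>) < ennreal (inverse (real (Suc n)))})"
  show ?thesis
  proof (rule generic_inI[where \<D> = "O' ` (Q \<times> UNIV)"])
    show "{\<beta> \<in> smooth_functions AB. generic_in (power_topology q) (universal_tuples \<beta> q) \<and>
       full_measure B q (universal_tuples \<beta> q)} \<subseteq> topspace (whitney_topology AB)"
      unfolding topspace_whitney_topology by blast
    show "countable (O' ` (Q \<times> UNIV))" using Q(1) by (intro countable_image countable_SIGMA) auto
    fix X assume "X \<in> O' ` (Q \<times> UNIV)"
    then obtain p n where p: "p \<in> P" and X: "X = O' (p, n)" using Q(2) by blast
    show "openin (whitney_topology AB) X"
      unfolding X O'_def prod.case by (rule coincidence_open[OF sep[OF p]])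
    show "whitney_topology AB closure_of X = topspace (whitney_topology AB)"
      unfolding X O'_def prod.case by (rule coincidence_dense[OF sep[OF p] q]) simp
  next
    show "topspace (whitney_topology AB) \<inter> \<Inter>(O' ` (Q \<times> UNIV)) \<subseteq>
      {\<beta> \<in> smooth_functions AB. generic_in (power_topology q) (universal_tuples \<beta> q) \<and>
       full_measure B q (universal_tuples \<beta> q)}"
    proof
      fix \<beta> assume "\<beta> \<in> topspace (whitney_topology AB) \<inter> \<Inter>(O' ` (Q \<times> UNIV))"
      then have \<beta>: "\<beta> \<in> smooth_functions AB" and \<beta>O: "\<And>p n. p \<in> Q \<Longrightarrow> \<beta> \<in> O' (p, n)"
        unfolding topspace_whitney_topology by blast+
      define Z where "Z p = zeros q (K\<^sub>1 p \<times> K\<^sub>2 p) (L p) (\<lambda>_. gap \<beta>) 0" for p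
      have zero: "emeasure (lborel_power {..<q}) (coincidence q (K\<^sub>1 p) (K\<^sub>2 p) (\<psi> p) (L p) \<beta>) = 0"
        (is "?e = 0") if p: "p \<in> Q" for p
      proof -
        have "?e \<le> 0"
        proof (rule ennreal_le_epsilon)
          fix e :: real assume "e > 0"
          then obtain n where n: "inverse (real (Suc n)) < e" using reals_Archimedean by blast
          have "?e < ennreal (inverse (real (Suc n)))" using \<beta>O[OF p, of n] by (simp add: O'_def)
          also have "\<dots> \<le> ennreal e" using n by (intro ennreal_leI) simp
          finally show "?e \<le> 0 + ennreal e" by simp
        qed
        then show ?thesis by simp
      qed
      have Z: "measure_zero B q (Z p)" "closedin (power_topology q) (Z p)" if "p \<in> Q" for p
        unfolding Z_def using coincidence_null_measure_zero[OF sep \<beta> zero] Q(2) that by blast+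
      define \<Delta> where "\<Delta> = (\<lambda>(i, j). {u \<in> PiE {..<q} (\<lambda>_. UNIV :: 'u set). u i = u j})"
      define I where "I = {(i, j). i < q \<and> j < q \<and> i \<noteq> j}"
      have I: "finite I" by (rule finite_subset[of _ "{..<q} \<times> {..<q}"]) (auto simp: I_def)
      have \<Delta>: "measure_zero B q (\<Delta> k)" "closedin (power_topology q) (\<Delta> k)" if "k \<in> I" for k
        using that diagonal_measure_zero closedin_diagonal by (auto simp: I_def \<Delta>_def)
      \<comment> \<open>A tuple fails either by a repeated entry, and then lies on one of finitely
        many diagonals, or by missing a distinguishable pair, and then lies in the bad set of some
        piece.\<close>
      have sub: "PiE {..<q} (\<lambda>_. UNIV) - universal_tuples \<beta> q \<subseteq> \<Union>(Z ` Q \<union> \<Delta> ` I)"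
      proof
        fix u assume u: "u \<in> PiE {..<q} (\<lambda>_. UNIV :: 'u set) - universal_tuples \<beta> q"
        show "u \<in> \<Union>(Z ` Q \<union> \<Delta> ` I)"
        proof (cases "inj_on u {..<q}")
          case False
          then obtain i j where "i < q" "j < q" "i \<noteq> j" "u i = u j" by (auto simp: inj_on_def)
          then have "(i, j) \<in> I" "u \<in> \<Delta> (i, j)" using u by (auto simp: I_def \<Delta>_def)
          then show ?thesis by blast
        next
          case True
          then obtain x\<^sub>1 x\<^sub>2 where x: "distinguishable \<beta> x\<^sub>1 x\<^sub>2" "\<And>i. i < q \<Longrightarrow> \<beta> (x\<^sub>1, u i) = \<beta> (x\<^sub>2, u i)"
            using u by (auto simp: universal_tuples_def distinct_tuples_def)
          \<comment> \<open>Distinguishable parameters are distinct, so the configuration belongs to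
            P and some chosen piece contains it.\<close>
          then have "(x\<^sub>1, x\<^sub>2, u) \<in> P" using True by (auto simp: P_def distinguishable_def)
          then obtain p where p: "p \<in> Q" "(x\<^sub>1, x\<^sub>2, u) \<in> W p" using PQ by blast
          have c: "x\<^sub>1 \<in> K\<^sub>1 p" "x\<^sub>2 \<in> K\<^sub>2 p" "\<forall>i<q. u i \<in> L p i" using cover[OF _ p(2)] p(1) Q(2) by blast+
          have "u \<in> PiE {..<q} (L p)" using u c(3) unfolding PiE_def by auto
          moreover have "\<forall>i<q. \<bar>gap \<beta> ((x\<^sub>1, x\<^sub>2), u i)\<bar> \<le> 0" using x(2) by (simp add: gap_def)
          moreover have "(x\<^sub>1, x\<^sub>2) \<in> K\<^sub>1 p \<times> K\<^sub>2 p" using c by simp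
          ultimately have "u \<in> Z p" unfolding Z_def zeros_def by blast
          then show ?thesis using p(1) by blast
        qed
      qed
      have ut: "universal_tuples \<beta> q \<subseteq> PiE {..<q} (\<lambda>_. UNIV)"
        unfolding universal_tuples_def distinct_tuples_def by blast
      have count: "countable (Z ` Q \<union> \<Delta> ` I)"
        using Q(1) countable_finite[OF I] by (intro countable_Un countable_image)
      have cl: "closedin (power_topology q) Y" and mz: "measure_zero B q Y" if "Y \<in> Z ` Q \<union> \<Delta> ` I" for Y
        using that Z \<Delta> by blast+
      show "\<beta> \<in> {\<beta> \<in> smooth_functions AB. generic_in (power_topology q) (universal_tuples \<beta> q) \<and>
         full_measure B q (universal_tuples \<beta> q)}"
        using \<beta> generic_full_measureI[OF B count cl mz ut sub] by blast
    qed
  qed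
qed

end

theorem proposition2p5:
  fixes A :: "('x::{t2_space, second_countable_topology}, 'e::real_normed_vector) chart set"
    and B :: "('u::{t2_space, second_countable_topology}, 'f::euclidean_space) chart set"
    and r m :: nat
  assumes "smooth_manifold r A" and "connected (UNIV :: 'x set)"
    and "smooth_manifold m B" and "connected (UNIV :: 'u set)"
  shows "generic_in (whitney_topology (prod_atlas A B))
    {\<beta> \<in> smooth_functions (prod_atlas A B).
       generic_in (power_topology (2 * r + 1)) (universal_tuples \<beta> (2 * r + 1)) \<and>
       full_measure B (2 * r + 1) (universal_tuples \<beta> (2 * r + 1))}"
proof -
  obtain b :: "nat \<Rightarrow> 'e" and \<xi> where "coordinates r b \<xi>"
    using assms(1) coordinates_exists unfolding smooth_manifold_def by blast
  moreover obtain b' :: "nat \<Rightarrow> 'f" and \<zeta> where "coordinates m b' \<zeta>"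
    using assms(3) coordinates_exists unfolding smooth_manifold_def by blast
  ultimately have "manifold_pair A B r m b \<xi> b' \<zeta>"
    using assms by unfold_locales (auto simp: smooth_manifold_def)
  \<comment> \<open>Only \<open>2 * r < q\<close> enters, and \<open>2 * r + 1\<close> is the
    smallest such q.\<close>
  then show ?thesis by (rule manifold_pair.universal_tuples_generic) simp
qed

end
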